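(* For every integer $m\ge1$ and every real $h\ge0$ there is a constant $b=b(m,h)$, depending only on $m$ and $h$, such that the following holds. Let $n\ge1$ and let $M$ be a connected space-like $m$-dimensional submanifold of the pseudo-Euclidean space $\mathbb{R}^{m+n}_n$ of index $n$ with parallel mean curvature, the norm of whose mean curvature is $|H|=h$. Let $z=\langle X,X\rangle$ be the pseudo-distance function on $M$, and suppose $z\ge0$ on $M$. If for some $k>0$ the set $\{x\in M: z(x)\le k\}$ is compact, then for all $x\in M$ with $z(x)\le \frac k2$, $$|\nabla z|(x)\le b\,(z(x)+1).$$
   Context: $\mathbb{R}^{m+n}_n$ is $\mathbb{R}^{m+n}$ with coordinates $(x_1,\dots,x_m;y_1,\dots,y_n)$ and the inner product $\langle\cdot,\cdot\rangle$ with quadratic form $\sum_i x_i^2-\sum_s y_s^2$. A smooth $m$-dimensional submanifold $M\subset\mathbb{R}^{m+n}_n$ is space-like if $\langle\cdot,\cdot\rangle$ is positive definite on every tangent space $T_xM$; the restriction is the induced Riemannian metric of $M$. The normal space $N_xM=(T_xM)^\perp$ is then negative definite of dimension $n$. $X$ is the position vector of $M$, so the pseudo-distance function is $z=\langle X,X\rangle=\sum_i x_i^2-\sum_s y_s^2$ restricted to $M$; $\nabla z$ and $|\nabla z|$ are its gradient and gradient norm with respect to the induced Riemannian metric on $M$. With the flat connection $\bar\nabla$ of $\mathbb{R}^{m+n}$, the second fundamental form is $B(V,W)=(\bar\nabla_V W)^{\perp}$ for tangent fields $V,W$; the mean curvature vector is $H=\frac1m\sum_{i=1}^m B(e_i,e_i)$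 for any local orthonormal tangent frame; $|H|=\sqrt{-\langle H,H\rangle}$. The normal connection is $D_V\nu=(\bar\nabla_V\nu)^\perp$, and $M$ has parallel mean curvature if $DH\equiv0$ (in this case $|H|$ is constant). *)

theory Defs
  imports "HOL-Analysis.Analysis"
begin

section \<open>The pseudo-Euclidean space of index \<open>n\<close>\<close>

text \<open>
  The constant of the theorem must not depend on \<open>n\<close>, so \<open>n\<close> is a natural number that
  can be quantified inside a formula, whereas \<open>m = CARD('m)\<close>. A vector
  \<open>(x\<^sub>1,\<dots>,x\<^sub>m;y\<^sub>1,\<dots>,y\<^sub>n)\<close> is a function \<open>v\<close> with \<open>v (Inl i)\<close> the space-like
  coordinates and \<open>v (Inr s)\<close>, \<open>s < n\<close>, the time-like ones; all further coordinates
  vanish. On this carrier the product topology of the function type is the Euclidean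
  topology.
\<close>

type_synonym 'm ambient = "'m + nat \<Rightarrow> real"

definition pseudo_space :: "nat \<Rightarrow> 'm ambient set" where
  "pseudo_space n = {v. \<forall>s\<ge>n. v (Inr s) = 0}"

definition pip :: "nat \<Rightarrow> 'm::finite ambient \<Rightarrow> 'm ambient \<Rightarrow> real" where
  "pip n v w = (\<Sum>i\<in>UNIV. v (Inl i) * w (Inl i)) - (\<Sum>s<n. v (Inr s) * w (Inr s))"


section \<open>Smooth submanifolds\<close>

text \<open>Meaningful on open sets \<open>U\<close>.\<close>

primrec Ck_on :: "nat \<Rightarrow> 'a::real_normed_vector set \<Rightarrow> ('a \<Rightarrow> real) \<Rightarrow> bool" where
  "Ck_on 0 U f \<longleftrightarrow> continuous_on U f"
| "Ck_on (Suc k) U f \<longleftrightarrow> (\<forall>u\<in>U. f differentiable (at u)) \<and>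
     (\<forall>v. Ck_on k U (\<lambda>u. frechet_derivative f (at u) v))"

definition smooth_on :: "'a::real_normed_vector set \<Rightarrow> ('a \<Rightarrow> real) \<Rightarrow> bool" where
  "smooth_on U f \<longleftrightarrow> (\<forall>k. Ck_on k U f)"

definition ambient_deriv ::
  "(real^'m::finite \<Rightarrow> 'm ambient) \<Rightarrow> real^'m \<Rightarrow> real^'m \<Rightarrow> 'm ambient" where
  "ambient_deriv \<phi> u v = (\<lambda>c. frechet_derivative (\<lambda>u. \<phi> u c) (at u) v)"

definition local_param ::
  "'m::finite ambient set \<Rightarrow> (real^'m) set \<Rightarrow> (real^'m \<Rightarrow> 'm ambient) \<Rightarrow> bool" where
  "local_param M U \<phi> \<longleftrightarrow> open U \<and>
     (\<forall>c. smooth_on U (\<lambda>u. \<phi> u c)) \<and>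
     (\<forall>u\<in>U. \<forall>v. ambient_deriv \<phi> u v = (\<lambda>_. 0) \<longrightarrow> v = 0) \<and>
     openin (top_of_set M) (\<phi> ` U) \<and>
     (\<exists>\<psi>. homeomorphism U (\<phi> ` U) \<phi> \<psi>)"

definition submanifold :: "nat \<Rightarrow> 'm::finite ambient set \<Rightarrow> bool" where
  "submanifold n M \<longleftrightarrow> M \<subseteq> pseudo_space n \<and>
     (\<forall>p\<in>M. \<exists>U \<phi>. local_param M U \<phi> \<and> p \<in> \<phi> ` U)"

definition tangent_space :: "'m::finite ambient set \<Rightarrow> 'm ambient \<Rightarrow> 'm ambient set" where
  "tangent_space M p =
     {ambient_deriv \<phi> u v | U \<phi> u v. local_param M U \<phi> \<and> u \<in> U \<and> \<phi> u = p}"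

definition spacelike_submanifold :: "nat \<Rightarrow> 'm::finite ambient set \<Rightarrow> bool" where
  "spacelike_submanifold n M \<longleftrightarrow> submanifold n M \<and>
     (\<forall>p\<in>M. \<forall>v\<in>tangent_space M p. v \<noteq> (\<lambda>_. 0) \<longrightarrow> pip n v v > 0)"

definition normal_space ::
  "nat \<Rightarrow> 'm::finite ambient set \<Rightarrow> 'm ambient \<Rightarrow> 'm ambient set" where
  "normal_space n M p = {\<nu> \<in> pseudo_space n. \<forall>v\<in>tangent_space M p. pip n \<nu> v = 0}"

definition normal_part ::
  "nat \<Rightarrow> 'm::finite ambient set \<Rightarrow> 'm ambient \<Rightarrow> 'm ambient \<Rightarrow> 'm ambient" where
  "normal_part n M p w =
     (THE \<nu>. \<nu> \<in> normal_space n M p \<and> (\<lambda>c. w c - \<nu> c) \<in> tangent_space M p)"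


section \<open>Differentiation along a submanifold\<close>

text \<open>
  Functions and fields along \<open>M\<close> are total functions on the ambient type; only their
  values on \<open>M\<close> matter. The derivative is taken through a local parametrization; for
  functions differentiable along \<open>M\<close> and \<open>v\<close> tangent, the value does not depend on it.
\<close>

definition smooth_along ::
  "'m::finite ambient set \<Rightarrow> 'm ambient set \<Rightarrow> ('m ambient \<Rightarrow> real) \<Rightarrow> bool" where
  "smooth_along M N f \<longleftrightarrow>
     (\<forall>q\<in>N. \<exists>U \<phi>. local_param M U \<phi> \<and> q \<in> \<phi> ` U \<and> \<phi> ` U \<subseteq> N \<and> smooth_on U (f \<circ> \<phi>))"

definition deriv_along ::
  "'m::finite ambient set \<Rightarrow> ('m ambient \<Rightarrow> real) \<Rightarrow> 'm ambient \<Rightarrow> 'm ambient \<Rightarrow> real" where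
  "deriv_along M f p v =
     (THE d. \<exists>U \<phi> u w. local_param M U \<phi> \<and> u \<in> U \<and> \<phi> u = p \<and> ambient_deriv \<phi> u w = v \<and>
        d = frechet_derivative (f \<circ> \<phi>) (at u) w)"

text \<open>The flat connection of the ambient space: \<open>flat_conn M W p v\<close> is the derivative of
  the field \<open>W\<close> at \<open>p\<close> in the tangent direction \<open>v\<close>.\<close>

definition flat_conn ::
  "'m::finite ambient set \<Rightarrow> ('m ambient \<Rightarrow> 'm ambient) \<Rightarrow> 'm ambient \<Rightarrow> 'm ambient \<Rightarrow> 'm ambient"
  where
  "flat_conn M W p v = (\<lambda>c. deriv_along M (\<lambda>q. W q c) p v)"

definition gradient ::
  "nat \<Rightarrow> 'm::finite ambient set \<Rightarrow> ('m ambient \<Rightarrow> real) \<Rightarrow> 'm ambient \<Rightarrow> 'm ambient" where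
  "gradient n M f p =
     (THE g. g \<in> tangent_space M p \<and> (\<forall>v\<in>tangent_space M p. pip n g v = deriv_along M f p v))"

definition gradient_norm ::
  "nat \<Rightarrow> 'm::finite ambient set \<Rightarrow> ('m ambient \<Rightarrow> real) \<Rightarrow> 'm ambient \<Rightarrow> real" where
  "gradient_norm n M f p = sqrt (pip n (gradient n M f p) (gradient n M f p))"

definition pseudo_distance :: "nat \<Rightarrow> 'm::finite ambient \<Rightarrow> real" where
  "pseudo_distance n X = pip n X X"


section \<open>Second fundamental form and mean curvature\<close>

definition tangent_field ::
  "'m::finite ambient set \<Rightarrow> 'm ambient set \<Rightarrow> ('m ambient \<Rightarrow> 'm ambient) \<Rightarrow> bool" where
  "tangent_field M N W \<longleftrightarrow>
     (\<forall>q\<in>N. W q \<in> tangent_space M q) \<and> (\<forall>c. smooth_along M N (\<lambda>q. W q c))"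

definition second_fundamental_form ::
  "nat \<Rightarrow> 'm::finite ambient set \<Rightarrow> ('m ambient \<Rightarrow> 'm ambient) \<Rightarrow> ('m ambient \<Rightarrow> 'm ambient)
     \<Rightarrow> 'm ambient \<Rightarrow> 'm ambient" where
  "second_fundamental_form n M V W p = normal_part n M p (flat_conn M W p (V p))"

definition local_orthonormal_frame ::
  "nat \<Rightarrow> 'm::finite ambient set \<Rightarrow> 'm ambient set \<Rightarrow> ('m \<Rightarrow> 'm ambient \<Rightarrow> 'm ambient) \<Rightarrow> bool"
  where
  "local_orthonormal_frame n M N e \<longleftrightarrow> openin (top_of_set M) N \<and>
     (\<forall>i. tangent_field M N (e i)) \<and>
     (\<forall>q\<in>N. \<forall>i j. pip n (e i q) (e j q) = (if i = j then 1 else 0))"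

definition mean_curvature ::
  "nat \<Rightarrow> 'm::finite ambient set \<Rightarrow> 'm ambient \<Rightarrow> 'm ambient" where
  "mean_curvature n M p =
     (THE \<eta>. \<exists>N e. p \<in> N \<and> local_orthonormal_frame n M N e \<and>
        \<eta> = (\<lambda>c. (\<Sum>i\<in>UNIV. second_fundamental_form n M (e i) (e i) p c) / real CARD('m)))"

text \<open>The mean curvature vector is time-like or zero, whence the sign.\<close>

definition mean_curvature_norm :: "nat \<Rightarrow> 'm::finite ambient set \<Rightarrow> 'm ambient \<Rightarrow> real" where
  "mean_curvature_norm n M p = sqrt (- pip n (mean_curvature n M p) (mean_curvature n M p))"

definition normal_conn ::
  "nat \<Rightarrow> 'm::finite ambient set \<Rightarrow> ('m ambient \<Rightarrow> 'm ambient) \<Rightarrow> 'm ambient \<Rightarrow> 'm ambient \<Rightarrow> 'm ambient"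
  where
  "normal_conn n M \<nu> p v = normal_part n M p (flat_conn M \<nu> p v)"

definition parallel_mean_curvature :: "nat \<Rightarrow> 'm::finite ambient set \<Rightarrow> bool" where
  "parallel_mean_curvature n M \<longleftrightarrow>
     (\<forall>p\<in>M. \<forall>v\<in>tangent_space M p. normal_conn n M (mean_curvature n M) p v = (\<lambda>_. 0))"

end

theory Submission
  imports Defs
begin

text \<open>
  Let \<open>g\<close> be the squared gradient norm of \<open>z\<close>, \<open>m\<close> the dimension, \<open>p = 4 m\<close>, and consider
  \<open>F = (k - z)^p g / (z + 1)^2\<close> on the compact set \<open>z \<le> k\<close>. The theorem follows from
  \<open>F \<le> k^p C^2\<close>, because \<open>k - z \<ge> k/2\<close> at the points of interest. As \<open>F\<close> vanishes on \<open>z = k\<close>, only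
  a positive maximum at a point with \<open>z < k\<close> matters; there \<open>log F\<close> is critical and its Laplacian
  is at most \<open>0\<close>.

  With \<open>B\<close> the second fundamental form, \<open>H\<close> the mean curvature, \<open>X\<close> the position vector and a
  tangent orthonormal basis \<open>e\<^sub>i\<close>, the Bochner formula for \<open>z\<close> is
  \<open>1/2 \<Delta>g = |Hess z|^2 + \<Sum>\<^sub>i |B(\<nabla>z, e\<^sub>i)|^2\<close>: the Ricci term given by the Gauss equation and the term
  \<open>\<nabla>z(\<Delta>z)\<close>, where \<open>\<Delta>z = 2m + 2m \<langle>X, H\<rangle>\<close> and \<open>DH = 0\<close>, contain the same expression in \<open>H\<close> with
  opposite signs, and normal vectors are time-like, whence the sign of the last sum. Criticality of
  \<open>log F\<close> makes \<open>\<nabla>z\<close> an eigenvector of \<open>Hess z\<close> with eigenvalue \<open>g s / 2\<close>, where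
  \<open>s = p / (k - z) + 2 / (z + 1)\<close>. The Hessian term and the \<open>B\<close>-term each contribute the square of this
  eigenvalue up to lower order, and together they exactly absorb \<open>|\<nabla>g|^2 / g^2\<close>. What decides is the
  rest of the Hessian, whose trace is \<open>\<Delta>z - g s / 2\<close>: it yields a term of order \<open>g s^2 / m\<close>, which beats the
  remaining bad term \<open>p g / (k - z)^2\<close> because \<open>p = 4 m\<close> is large. Since \<open>z \<ge> 0\<close>, the normal part of
  \<open>X\<close> is not longer than the tangential part, which has length \<open>sqrt g / 2\<close>; so \<open>\<Delta>z\<close> is at most linear
  in \<open>sqrt g\<close>, and \<open>g\<close> is bounded by a multiple of \<open>(1 + sqrt g) (z + 1)\<close> at the maximum. The algebra is in
  \<open>max_point_inequality\<close> and \<open>quadratic_root_bound\<close>, the geometry in \<open>gradient_bound_at_max\<close>.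

  Second derivatives of \<open>g\<close> itself are avoided by a support function. For a tangent field \<open>T\<close> one has
  \<open>4 (2 \<langle>X, T\<rangle> - \<langle>T, T\<rangle>) \<le> g\<close>, with equality where \<open>T\<close> is the tangential part of \<open>X\<close>. Replacing \<open>g\<close> by
  the left-hand side preserves the maximum. In coordinates that are normal at the maximum point the
  field \<open>T\<close> can be chosen with affine coefficients and still agree with the tangential part of \<open>X\<close> to
  first order, which is all the Laplacian sees. In terms of the parametrization,
  the Codazzi equation becomes the symmetry of third partial derivatives, and \<open>DH = 0\<close>
  becomes the linear relation \<open>parallel_third_derivative\<close>.

  The geometric notions are definite descriptions over all parametrizations and frames. They are
  meaningful because transition maps are differentiable (\<open>transition\<close>), which gives the local formulas
  \<open>deriv_along_eq\<close>, \<open>normal_part_eq\<close>, \<open>gradient_eq\<close> and \<open>mean_curvature_coord\<close>.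
\<close>


section \<open>Calculus of smooth real functions\<close>

text \<open>The directional derivative with the direction first, so that iterated derivatives
  are iterated applications of \<open>pd v\<close> to functions.\<close>

definition pd :: "'a \<Rightarrow> ('a::real_normed_vector \<Rightarrow> real) \<Rightarrow> 'a \<Rightarrow> real" where
  "pd v f u = frechet_derivative f (at u) v"

lemma has_derivative_pd: "f differentiable (at u) \<Longrightarrow> (f has_derivative (\<lambda>v. pd v f u)) (at u)"
  unfolding pd_def using frechet_derivative_works by fastforce

lemma pd_eqI: "(f has_derivative F) (at u) \<Longrightarrow> pd v f u = F v"
  unfolding pd_def using frechet_derivative_at by metis

lemma pd_linear: "f differentiable (at u) \<Longrightarrow> linear (\<lambda>v. pd v f u)"
  using has_derivative_pd has_derivative_linear by blast

lemma pd_cong_open: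
  assumes "open U" "u \<in> U" "\<And>x. x \<in> U \<Longrightarrow> f x = g x"
  shows "f differentiable (at u) \<longleftrightarrow> g differentiable (at u)" "pd v f u = pd v g u"
proof -
  have d: "(f has_derivative D) (at u) \<longleftrightarrow> (g has_derivative D) (at u)" for D
    using assms has_derivative_transform_within_open[of f D u UNIV U g]
      has_derivative_transform_within_open[of g D u UNIV U f] by auto
  then show "f differentiable (at u) \<longleftrightarrow> g differentiable (at u)"
    unfolding differentiable_def by blast
  show "pd v f u = pd v g u"
    unfolding pd_def frechet_derivative_def d ..
qed

lemma Ck_on_Suc_pd:
  "Ck_on (Suc k) U f \<longleftrightarrow> (\<forall>u\<in>U. f differentiable (at u)) \<and> (\<forall>v. Ck_on k U (pd v f))"
  unfolding pd_def[abs_def] by simp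

declare Ck_on.simps(2)[simp del]
declare Ck_on_Suc_pd[simp]

lemma Ck_on_cong:
  assumes "open U" "\<And>x. x \<in> U \<Longrightarrow> f x = g x"
  shows "Ck_on k U f \<longleftrightarrow> Ck_on k U g"
  using assms(2)
proof (induction k arbitrary: f g)
  case 0
  then show ?case by (simp cong: continuous_on_cong)
next
  case (Suc k)
  have "pd v f x = pd v g x" if "x \<in> U" for v x
    using pd_cong_open(2)[OF assms(1) that] Suc.prems by blast
  then have "Ck_on k U (pd v f) \<longleftrightarrow> Ck_on k U (pd v g)" for v
    by (intro Suc.IH) auto
  moreover have "f differentiable (at x) \<longleftrightarrow> g differentiable (at x)" if "x \<in> U" for x
    using pd_cong_open(1)[OF assms(1) that] Suc.prems by blast
  ultimately show ?case by simp
qed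

lemma Ck_on_continuous: "Ck_on k U f \<Longrightarrow> continuous_on U f"
proof (cases k)
  case (Suc j)
  assume "Ck_on k U f"
  then have "\<forall>u\<in>U. isCont f u"
    using Suc differentiable_imp_continuous_within by fastforce
  then show ?thesis
    by (simp add: continuous_at_imp_continuous_on)
qed simp

lemma Ck_on_SucD: "Ck_on (Suc k) U f \<Longrightarrow> Ck_on k U f"
proof (induction k arbitrary: f)
  case 0
  then show ?case using Ck_on_continuous by (metis Ck_on.simps(1))
next
  case (Suc k)
  then show ?case by (metis Ck_on_Suc_pd)
qed

lemma Ck_on_const: "Ck_on k U (\<lambda>_. c)"
proof (induction k arbitrary: c)
  case (Suc k)
  have "pd v (\<lambda>_. c) = (\<lambda>_. 0)" for v :: 'a
    by (auto simp: pd_def)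
  then show ?case using Suc by simp
qed simp

lemma Ck_on_linear: "bounded_linear f \<Longrightarrow> Ck_on k U f"
proof (cases k)
  case (Suc j)
  assume f: "bounded_linear f"
  have "pd v f = (\<lambda>_. f v)" for v
    using f by (auto intro!: pd_eqI bounded_linear_imp_has_derivative)
  then show ?thesis
    using f Suc Ck_on_const bounded_linear_imp_differentiable by auto
qed (simp add: linear_continuous_on)

lemma pd_add:
  "f differentiable (at u) \<Longrightarrow> g differentiable (at u) \<Longrightarrow> pd v (\<lambda>x. f x + g x) u = pd v f u + pd v g u"
  by (rule pd_eqI) (auto intro!: derivative_eq_intros has_derivative_pd)

lemma pd_diff:
  "f differentiable (at u) \<Longrightarrow> g differentiable (at u) \<Longrightarrow> pd v (\<lambda>x. f x - g x) u = pd v f u - pd v g u"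
  by (rule pd_eqI) (auto intro!: derivative_eq_intros has_derivative_pd)

lemma pd_mult:
  "f differentiable (at u) \<Longrightarrow> g differentiable (at u) \<Longrightarrow>
    pd v (\<lambda>x. f x * g x) u = f u * pd v g u + pd v f u * g u"
  by (rule pd_eqI) (auto intro!: derivative_eq_intros has_derivative_pd)

lemma pd_cmult: "f differentiable (at u) \<Longrightarrow> pd v (\<lambda>x. c * f x) u = c * pd v f u"
  by (rule pd_eqI) (auto intro!: derivative_eq_intros has_derivative_pd)

lemma pd_sum:
  "(\<And>i. i \<in> I \<Longrightarrow> f i differentiable (at u)) \<Longrightarrow> pd v (\<lambda>x. \<Sum>i\<in>I. f i x) u = (\<Sum>i\<in>I. pd v (f i) u)"
  by (rule pd_eqI) (auto intro!: derivative_eq_intros has_derivative_pd)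

lemma Ck_on_add:
  assumes "open U" "Ck_on k U f" "Ck_on k U g"
  shows "Ck_on k U (\<lambda>x. f x + g x)"
  using assms(2,3)
proof (induction k arbitrary: f g)
  case (Suc k)
  have "Ck_on k U (pd v (\<lambda>x. f x + g x))" for v
    using Suc by (subst Ck_on_cong[OF assms(1), where g="\<lambda>x. pd v f x + pd v g x"]) (auto simp: pd_add)
  then show ?case using Suc.prems by simp
qed (simp add: continuous_on_add)

lemma Ck_on_mult:
  assumes "open U" "Ck_on k U f" "Ck_on k U g"
  shows "Ck_on k U (\<lambda>x. f x * g x)"
  using assms(2,3)
proof (induction k arbitrary: f g)
  case (Suc k)
  have "Ck_on k U (pd v (\<lambda>x. f x * g x))" for v
    using Suc Suc.prems[THEN Ck_on_SucD]
    by (subst Ck_on_cong[OF assms(1), where g="\<lambda>x. f x * pd v g x + pd v f x * g x"])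
      (auto simp: pd_mult intro!: Ck_on_add assms(1))
  then show ?case using Suc.prems by simp
qed (simp add: continuous_on_mult)

text \<open>Arbitrary real exponents make the induction close, since differentiating lowers the exponent by one.
  The exponent \<open>-1/2\<close> normalizes vectors in the Gram-Schmidt process.\<close>

lemma Ck_on_powr:
  fixes a :: real
  assumes "open U" "\<And>x. x \<in> U \<Longrightarrow> f x > 0" "Ck_on k U f"
  shows "Ck_on k U (\<lambda>x. f x powr a)"
  using assms(3)
proof (induction k arbitrary: a)
  case 0
  have "\<forall>x\<in>U. f x \<noteq> 0" using assms(2) by force
  then show ?case using 0 by (auto intro: continuous_on_powr)
next
  case (Suc k)
  have der: "((\<lambda>x. f x powr a) has_derivative (\<lambda>v. a * f u powr (a - 1) * pd v f u)) (at u)" if "u \<in> U" for u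
  proof -
    have fu: "f u > 0" using assms(2) that by blast
    have "((\<lambda>y. y powr a) has_real_derivative a * f u powr (a - 1)) (at (f u))"
      by (rule has_real_derivative_powr[OF fu])
    then have *: "((\<lambda>y. y powr a) has_derivative (\<lambda>y. a * f u powr (a - 1) * y)) (at (f u))"
      by (simp add: has_field_derivative_def)
    have fd: "f differentiable (at u)" using Suc.prems that by simp
    from diff_chain_at[OF has_derivative_pd[OF fd] * ] show ?thesis
      by (simp add: o_def)
  qed
  have "Ck_on k U (pd v (\<lambda>x. f x powr a))" for v
  proof (subst Ck_on_cong[OF assms(1)])
    show "pd v (\<lambda>x. f x powr a) x = (\<lambda>x. (a * f x powr (a - 1)) * pd v f x) x" if "x \<in> U" for x
      using pd_eqI[OF der[OF that]] by simp
    show "Ck_on k U (\<lambda>x. (a * f x powr (a - 1)) * pd v f x)"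
      using Suc.prems Suc.IH[OF Ck_on_SucD[OF Suc.prems]]
      by (intro Ck_on_mult Ck_on_const assms(1)) auto
  qed
  then show ?case using der by (auto simp: differentiable_def)
qed

lemma pd_compose:
  fixes P :: "'a::euclidean_space \<Rightarrow> 'b::euclidean_space"
  assumes P: "(P has_derivative P') (at u)" and f: "f differentiable (at (P u))"
  shows "(\<lambda>x. f (P x)) differentiable (at u)" "pd v (\<lambda>x. f (P x)) u = pd (P' v) f (P u)"
proof -
  have "((\<lambda>x. f (P x)) has_derivative (\<lambda>v. pd (P' v) f (P u))) (at u)"
    using diff_chain_at[OF P has_derivative_pd[OF f]] by (simp add: o_def)
  then show "(\<lambda>x. f (P x)) differentiable (at u)" "pd v (\<lambda>x. f (P x)) u = pd (P' v) f (P u)"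
    by (auto simp: differentiable_def intro: pd_eqI)
qed

lemma pd_euclidean_expand:
  fixes f :: "'a::euclidean_space \<Rightarrow> real"
  assumes "f differentiable (at u)"
  shows "pd v f u = (\<Sum>b\<in>Basis. (v \<bullet> b) * pd b f u)"
proof -
  have lin: "linear (\<lambda>v. pd v f u)" by (rule pd_linear[OF assms])
  have "pd v f u = pd (\<Sum>b\<in>Basis. (v \<bullet> b) *\<^sub>R b) f u" by (simp add: euclidean_representation)
  also have "\<dots> = (\<Sum>b\<in>Basis. (v \<bullet> b) * pd b f u)"
    by (subst linear_sum[OF lin]) (simp add: linear_scale[OF lin, unfolded real_scaleR_def])
  finally show ?thesis .
qed

lemma Ck_on_sum:
  assumes "open U" "\<And>i. i \<in> I \<Longrightarrow> Ck_on k U (f i)"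
  shows "Ck_on k U (\<lambda>x. \<Sum>i\<in>I. f i x)"
proof (cases "finite I")
  case True
  then show ?thesis using assms(2)
    by (induction I rule: finite_induct) (auto intro!: Ck_on_const Ck_on_add[OF assms(1)])
qed (simp add: Ck_on_const)

text \<open>By the chain rule a derivative of the composition is a sum of products of derivatives of \<open>P\<close> with
  compositions of lower order, to which the induction hypothesis applies.\<close>

lemma Ck_on_compose:
  fixes P :: "'a::euclidean_space \<Rightarrow> 'b::euclidean_space"
  assumes "open V" "open U" "P ` V \<subseteq> U" "\<And>b. b \<in> Basis \<Longrightarrow> Ck_on k V (\<lambda>x. P x \<bullet> b)" "Ck_on k U f"
  shows "Ck_on k V (\<lambda>x. f (P x))"
  using assms(4,5)
proof (induction k arbitrary: f)
  case 0
  have "continuous_on V P"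
    using 0 by (subst continuous_on_componentwise) auto
  then show ?case
    using 0 continuous_on_compose2[of U f V P] assms(3) by auto
next
  case (Suc k)
  have P': "(P has_derivative (\<lambda>v. \<Sum>b\<in>Basis. pd v (\<lambda>x. P x \<bullet> b) u *\<^sub>R b)) (at u)" if "u \<in> V" for u
    using Suc.prems(1) that
    by (subst has_derivative_componentwise_within) (auto intro!: has_derivative_pd)
  have fd: "f differentiable (at (P u))" if "u \<in> V" for u
    using Suc.prems(2) that assms(3) by auto
  have "Ck_on k V (pd v (\<lambda>x. f (P x)))" for v
  proof (subst Ck_on_cong[OF assms(1)])
    show "pd v (\<lambda>x. f (P x)) x = (\<lambda>x. \<Sum>b\<in>Basis. pd v (\<lambda>x. P x \<bullet> b) x * pd b f (P x)) x" if "x \<in> V" for x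
      by (subst pd_compose(2)[OF P'[OF that] fd[OF that]], subst pd_euclidean_expand[OF fd[OF that]])
        (rule sum.cong, simp_all only: inner_sum_left_Basis)
    show "Ck_on k V (\<lambda>x. \<Sum>b\<in>Basis. pd v (\<lambda>x. P x \<bullet> b) x * pd b f (P x))"
      using Suc.prems(2) Suc.IH[OF Ck_on_SucD[OF Suc.prems(1)]] Suc.prems(1)
      by (intro Ck_on_sum Ck_on_mult assms(1)) simp_all
  qed
  then show ?case unfolding Ck_on_Suc_pd using pd_compose(1)[OF P' fd] by blast
qed

lemma smooth_onD: "smooth_on U f \<Longrightarrow> Ck_on k U f"
  by (simp add: smooth_on_def)

lemma smooth_onI: "(\<And>k. Ck_on k U f) \<Longrightarrow> smooth_on U f"
  by (simp add: smooth_on_def)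

lemma smooth_on_pd: "smooth_on U f \<Longrightarrow> smooth_on U (pd v f)"
  using smooth_onD[of U f "Suc k" for k] by (intro smooth_onI) simp

lemma smooth_on_differentiable: "smooth_on U f \<Longrightarrow> u \<in> U \<Longrightarrow> f differentiable (at u)"
  using smooth_onD[of U f "Suc 0"] by simp

lemma smooth_on_cong: "open U \<Longrightarrow> (\<And>x. x \<in> U \<Longrightarrow> f x = g x) \<Longrightarrow> smooth_on U f \<longleftrightarrow> smooth_on U g"
  unfolding smooth_on_def using Ck_on_cong[of U f g] by simp

lemma smooth_on_continuous: "smooth_on U f \<Longrightarrow> continuous_on U f"
  using smooth_onD[of U f 0] by simp

lemma smooth_on_const: "smooth_on U (\<lambda>_. c)"
  by (intro smooth_onI Ck_on_const)

lemma smooth_on_linear: "bounded_linear f \<Longrightarrow> smooth_on U f"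
  by (intro smooth_onI Ck_on_linear)

lemma smooth_on_add: "open U \<Longrightarrow> smooth_on U f \<Longrightarrow> smooth_on U g \<Longrightarrow> smooth_on U (\<lambda>x. f x + g x)"
  by (simp add: smooth_on_def Ck_on_add)

lemma smooth_on_mult: "open U \<Longrightarrow> smooth_on U f \<Longrightarrow> smooth_on U g \<Longrightarrow> smooth_on U (\<lambda>x. f x * g x)"
  by (simp add: smooth_on_def Ck_on_mult)

lemma smooth_on_sum:
  "open U \<Longrightarrow> (\<And>i. i \<in> I \<Longrightarrow> smooth_on U (f i)) \<Longrightarrow> smooth_on U (\<lambda>x. \<Sum>i\<in>I. f i x)"
  by (simp add: smooth_on_def Ck_on_sum)

lemma smooth_on_diff:
  assumes "open U" "smooth_on U f" "smooth_on U g"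
  shows "smooth_on U (\<lambda>x. f x - g x)"
  using smooth_on_add[OF assms(1,2) smooth_on_mult[OF assms(1) smooth_on_const[of U "-1"] assms(3)]] by simp

lemma smooth_on_powr:
  fixes a :: real
  shows "open U \<Longrightarrow> (\<And>x. x \<in> U \<Longrightarrow> f x > 0) \<Longrightarrow> smooth_on U f \<Longrightarrow> smooth_on U (\<lambda>x. f x powr a)"
  by (simp add: smooth_on_def Ck_on_powr)

lemma smooth_on_compose:
  fixes P :: "'a::euclidean_space \<Rightarrow> 'b::euclidean_space"
  assumes "open V" "open U" "P ` V \<subseteq> U" "\<And>b. b \<in> Basis \<Longrightarrow> smooth_on V (\<lambda>x. P x \<bullet> b)" "smooth_on U f"
  shows "smooth_on V (\<lambda>x. f (P x))"
  by (rule smooth_onI, rule Ck_on_compose[OF assms(1-3) smooth_onD[OF assms(4)] smooth_onD[OF assms(5)]])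

lemma pd_line:
  assumes "f differentiable (at (x + t *\<^sub>R v))"
  shows "((\<lambda>s. f (x + s *\<^sub>R v)) has_real_derivative pd v f (x + t *\<^sub>R v)) (at t)"
proof -
  have "((\<lambda>s. x + s *\<^sub>R v) has_derivative (\<lambda>s. s *\<^sub>R v)) (at t)"
    by (auto intro!: derivative_eq_intros)
  from diff_chain_at[OF this has_derivative_pd[OF assms]]
  have "((\<lambda>s. f (x + s *\<^sub>R v)) has_derivative (\<lambda>s. pd (s *\<^sub>R v) f (x + t *\<^sub>R v))) (at t)"
    by (simp add: o_def)
  moreover have "pd (s *\<^sub>R v) f (x + t *\<^sub>R v) = pd v f (x + t *\<^sub>R v) * s" for s
    by (subst linear_scale[OF pd_linear[OF assms]]) simp
  ultimately show ?thesis by (simp add: has_field_derivative_def)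
qed

text \<open>Two applications of the mean value theorem, one in each direction. The left-hand side is symmetric in
  \<open>v\<close> and \<open>w\<close>, which yields the symmetry of second derivatives below.\<close>

lemma second_difference_mean_value:
  assumes f: "smooth_on U f" and t: "t > 0"
    and box: "\<And>r s. 0 \<le> r \<Longrightarrow> r \<le> t \<Longrightarrow> 0 \<le> s \<Longrightarrow> s \<le> t \<Longrightarrow> x + r *\<^sub>R v + s *\<^sub>R w \<in> U"
  obtains r s where "0 < r" "r < t" "0 < s" "s < t"
    "f (x + t *\<^sub>R v + t *\<^sub>R w) - f (x + t *\<^sub>R v) - f (x + t *\<^sub>R w) + f x
      = t * t * pd w (pd v f) (x + r *\<^sub>R v + s *\<^sub>R w)"
proof -
  define h where "h r = f ((x + t *\<^sub>R w) + r *\<^sub>R v) - f (x + r *\<^sub>R v)" for r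
  have der: "(h has_real_derivative pd v f ((x + t *\<^sub>R w) + r *\<^sub>R v) - pd v f (x + r *\<^sub>R v)) (at r)"
    if "0 \<le> r" "r \<le> t" for r
  proof -
    have "(x + t *\<^sub>R w) + r *\<^sub>R v \<in> U" "x + r *\<^sub>R v \<in> U"
      using box[of r t] box[of r 0] that t by (auto simp: add.assoc add.commute add.left_commute)
    from this[THEN smooth_on_differentiable[OF f], THEN pd_line] show ?thesis
      unfolding h_def by (rule DERIV_diff)
  qed
  obtain r where r: "0 < r" "r < t"
    "h t - h 0 = (t - 0) * (pd v f ((x + t *\<^sub>R w) + r *\<^sub>R v) - pd v f (x + r *\<^sub>R v))"
    using MVT2[of 0 t h, OF t der] by auto
  have der2: "((\<lambda>s. pd v f ((x + r *\<^sub>R v) + s *\<^sub>R w)) has_real_derivative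
      pd w (pd v f) ((x + r *\<^sub>R v) + s *\<^sub>R w)) (at s)"
    if "0 \<le> s" "s \<le> t" for s
    by (rule pd_line, rule smooth_on_differentiable[OF smooth_on_pd[OF f]])
      (use box[of r s] that r in simp)
  obtain s where s: "0 < s" "s < t"
    "pd v f ((x + r *\<^sub>R v) + t *\<^sub>R w) - pd v f ((x + r *\<^sub>R v) + 0 *\<^sub>R w)
      = (t - 0) * pd w (pd v f) ((x + r *\<^sub>R v) + s *\<^sub>R w)"
    using MVT2[OF t der2] by blast
  have "f (x + t *\<^sub>R v + t *\<^sub>R w) - f (x + t *\<^sub>R v) - f (x + t *\<^sub>R w) + f x = h t - h 0"
    by (simp add: h_def algebra_simps)
  also have "\<dots> = t * t * pd w (pd v f) (x + r *\<^sub>R v + s *\<^sub>R w)"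
    using r(3) s(3) by (simp add: algebra_simps)
  finally show ?thesis using that r s by blast
qed

text \<open>By continuity, both mixed derivatives at \<open>x\<close> are the limit of the same normalized second difference over
  shrinking parallelograms.\<close>

lemma pd_commute:
  assumes U: "open U" "x \<in> U" and f: "smooth_on U f"
  shows "pd v (pd w f) x = pd w (pd v f) x"
proof (rule ccontr)
  assume ne: "pd v (pd w f) x \<noteq> pd w (pd v f) x"
  define e where "e = \<bar>pd v (pd w f) x - pd w (pd v f) x\<bar> / 2"
  have "e > 0" using ne by (simp add: e_def)
  have cont: "isCont (pd a (pd b f)) x" for a b
    using smooth_on_continuous[OF smooth_on_pd[OF smooth_on_pd[OF f]]] U
    by (simp add: continuous_on_eq_continuous_at)
  obtain d0 where d0: "d0 > 0" "\<And>y. dist y x < d0 \<Longrightarrow> y \<in> U"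
    using U open_dist by metis
  obtain d1 where d1: "d1 > 0" "\<And>y. dist y x < d1 \<Longrightarrow> dist (pd v (pd w f) y) (pd v (pd w f) x) < e"
    using cont[of v w] \<open>e > 0\<close> unfolding continuous_at_eps_delta by blast
  obtain d2 where d2: "d2 > 0" "\<And>y. dist y x < d2 \<Longrightarrow> dist (pd w (pd v f) y) (pd w (pd v f) x) < e"
    using cont[of w v] \<open>e > 0\<close> unfolding continuous_at_eps_delta by blast
  define d where "d = min d0 (min d1 d2)"
  have "d > 0" using d0 d1 d2 by (simp add: d_def)
  define t where "t = d / (norm v + norm w + 1)"
  have nz: "norm v + norm w + 1 > 0" by (smt (verit) norm_ge_zero)
  then have t: "t > 0" using \<open>d > 0\<close> by (simp add: t_def)
  have near: "dist (x + r *\<^sub>R v + s *\<^sub>R w) x < d"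
    if "0 \<le> r" "r \<le> t" "0 \<le> s" "s \<le> t" for r s
  proof -
    have "dist (x + r *\<^sub>R v + s *\<^sub>R w) x = norm (r *\<^sub>R v + s *\<^sub>R w)"
      by (simp add: dist_norm algebra_simps)
    also have "\<dots> \<le> r * norm v + s * norm w"
      using norm_triangle_ineq[of "r *\<^sub>R v" "s *\<^sub>R w"] that by simp
    also have "\<dots> \<le> t * norm v + t * norm w"
      using that by (intro add_mono mult_right_mono) auto
    also have "\<dots> < t * (norm v + norm w + 1)" using t by (simp add: algebra_simps)
    also have "\<dots> = d" using nz by (simp add: t_def)
    finally show ?thesis .
  qed
  have near': "dist (x + r *\<^sub>R w + s *\<^sub>R v) x < d"
    if "0 \<le> r" "r \<le> t" "0 \<le> s" "s \<le> t" for r s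
    using near[of s r] that by (simp add: algebra_simps)
  obtain r s where rs: "0 < r" "r < t" "0 < s" "s < t"
    "f (x + t *\<^sub>R v + t *\<^sub>R w) - f (x + t *\<^sub>R v) - f (x + t *\<^sub>R w) + f x
      = t * t * pd w (pd v f) (x + r *\<^sub>R v + s *\<^sub>R w)"
  proof (rule second_difference_mean_value[OF f t, of x v w])
    show "x + r *\<^sub>R v + s *\<^sub>R w \<in> U" if "0 \<le> r" "r \<le> t" "0 \<le> s" "s \<le> t" for r s
      using near[OF that] d0 by (auto simp: d_def)
  qed
  obtain r' s' where rs': "0 < r'" "r' < t" "0 < s'" "s' < t"
    "f (x + t *\<^sub>R w + t *\<^sub>R v) - f (x + t *\<^sub>R w) - f (x + t *\<^sub>R v) + f x
      = t * t * pd v (pd w f) (x + r' *\<^sub>R w + s' *\<^sub>R v)"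
  proof (rule second_difference_mean_value[OF f t, of x w v])
    show "x + r *\<^sub>R w + s *\<^sub>R v \<in> U" if "0 \<le> r" "r \<le> t" "0 \<le> s" "s \<le> t" for r s
      using near'[OF that] d0 by (auto simp: d_def)
  qed
  have "t * t * pd v (pd w f) (x + r' *\<^sub>R w + s' *\<^sub>R v) = t * t * pd w (pd v f) (x + r *\<^sub>R v + s *\<^sub>R w)"
    using rs(5) rs'(5) add.commute[of "t *\<^sub>R v" "t *\<^sub>R w"] by (simp only: add.assoc)
  then have "pd v (pd w f) (x + r' *\<^sub>R w + s' *\<^sub>R v) = pd w (pd v f) (x + r *\<^sub>R v + s *\<^sub>R w)"
    using t by simp
  moreover have "dist (pd w (pd v f) (x + r *\<^sub>R v + s *\<^sub>R w)) (pd w (pd v f) x) < e"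
    using near[of r s] rs d2 by (auto simp: d_def)
  moreover have "dist (pd v (pd w f) (x + r' *\<^sub>R w + s' *\<^sub>R v)) (pd v (pd w f) x) < e"
    using near'[of r' s'] rs' d1 by (auto simp: d_def)
  ultimately show False
    by (auto simp: e_def dist_real_def abs_if split: if_splits)
qed



section \<open>Pseudo-Euclidean algebra and differentiation of ambient-valued maps\<close>

lemma pip_commute: "pip n v w = pip n w v"
  by (simp add: pip_def mult.commute)

lemma pip_add_left: "pip n (\<lambda>c. a c + b c) w = pip n a w + pip n b w"
  by (simp add: pip_def sum.distrib distrib_right)

lemma pip_diff_left: "pip n (\<lambda>c. a c - b c) w = pip n a w - pip n b w"
  by (simp add: pip_def sum_subtractf left_diff_distrib)

lemma pip_scale_left: "pip n (\<lambda>c. r * a c) w = r * pip n a w"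
  by (simp add: pip_def sum_distrib_left mult.assoc right_diff_distrib)

lemma pip_zero_left: "pip n (\<lambda>c. 0) w = 0"
  by (simp add: pip_def)

lemma pip_sum_left: "pip n (\<lambda>c. \<Sum>i\<in>I. E i c) w = (\<Sum>i\<in>I. pip n (E i) w)"
  by (induction I rule: infinite_finite_induct) (simp_all add: pip_zero_left pip_add_left)

lemma pip_lincomb_left: "pip n (\<lambda>c. \<Sum>i\<in>I. a i * E i c) w = (\<Sum>i\<in>I. a i * pip n (E i) w)"
  by (simp add: pip_sum_left pip_scale_left)

lemma pip_add_right: "pip n w (\<lambda>c. a c + b c) = pip n w a + pip n w b"
  by (simp add: pip_commute[of n w] pip_add_left)

lemma pip_diff_right: "pip n w (\<lambda>c. a c - b c) = pip n w a - pip n w b"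
  by (simp add: pip_commute[of n w] pip_diff_left)

lemma pip_scale_right: "pip n w (\<lambda>c. r * a c) = r * pip n w a"
  by (simp add: pip_commute[of n w] pip_scale_left)

lemma pip_zero_right: "pip n w (\<lambda>c. 0) = 0"
  by (simp add: pip_def)

lemma pip_sum_right: "pip n w (\<lambda>c. \<Sum>i\<in>I. E i c) = (\<Sum>i\<in>I. pip n w (E i))"
  by (simp add: pip_commute[of n w] pip_sum_left)

lemma pip_lincomb_right: "pip n w (\<lambda>c. \<Sum>i\<in>I. a i * E i c) = (\<Sum>i\<in>I. a i * pip n w (E i))"
  by (simp add: pip_commute[of n w] pip_lincomb_left)

lemma pseudo_space_add: "a \<in> pseudo_space n \<Longrightarrow> b \<in> pseudo_space n \<Longrightarrow> (\<lambda>c. a c + b c) \<in> pseudo_space n"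
  by (simp add: pseudo_space_def)

lemma pseudo_space_diff: "a \<in> pseudo_space n \<Longrightarrow> b \<in> pseudo_space n \<Longrightarrow> (\<lambda>c. a c - b c) \<in> pseudo_space n"
  by (simp add: pseudo_space_def)

lemma pseudo_space_scale: "a \<in> pseudo_space n \<Longrightarrow> (\<lambda>c. r * a c) \<in> pseudo_space n"
  by (simp add: pseudo_space_def)

lemma pseudo_space_sum: "(\<And>i. i \<in> I \<Longrightarrow> E i \<in> pseudo_space n) \<Longrightarrow> (\<lambda>c. \<Sum>i\<in>I. E i c) \<in> pseudo_space n"
  by (simp add: pseudo_space_def)

lemma pseudo_space_lincomb:
  "(\<And>i. i \<in> I \<Longrightarrow> E i \<in> pseudo_space n) \<Longrightarrow> (\<lambda>c. \<Sum>i\<in>I. a i * E i c) \<in> pseudo_space n"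
  by (simp add: pseudo_space_def)

text \<open>Ambient vectors are functions without a norm, so differentiation and smoothness of maps into the ambient
  space are taken coordinate by coordinate.\<close>

definition apd :: "'a \<Rightarrow> ('a::real_normed_vector \<Rightarrow> 'm ambient) \<Rightarrow> 'a \<Rightarrow> 'm ambient" where
  "apd v \<Phi> u = (\<lambda>c. pd v (\<lambda>x. \<Phi> x c) u)"

lemma ambient_deriv_eq_apd: "ambient_deriv \<Phi> u v = apd v \<Phi> u"
  by (simp add: ambient_deriv_def apd_def pd_def)

definition asmooth :: "'a::real_normed_vector set \<Rightarrow> ('a \<Rightarrow> 'm ambient) \<Rightarrow> bool" where
  "asmooth U \<Phi> \<longleftrightarrow> (\<forall>c. smooth_on U (\<lambda>x. \<Phi> x c))"

definition adiff :: "('a::real_normed_vector \<Rightarrow> 'm ambient) \<Rightarrow> 'a \<Rightarrow> bool" where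
  "adiff \<Phi> u \<longleftrightarrow> (\<forall>c. (\<lambda>x. \<Phi> x c) differentiable (at u))"

lemma asmooth_adiff: "asmooth U \<Phi> \<Longrightarrow> u \<in> U \<Longrightarrow> adiff \<Phi> u"
  by (auto simp: asmooth_def adiff_def intro: smooth_on_differentiable)

lemma asmooth_apd: "asmooth U \<Phi> \<Longrightarrow> asmooth U (apd v \<Phi>)"
  by (simp add: asmooth_def apd_def smooth_on_pd)

lemma asmooth_lincomb:
  assumes "open U" "\<And>i. i \<in> I \<Longrightarrow> smooth_on U (a i)" "\<And>i. i \<in> I \<Longrightarrow> asmooth U (E i)"
  shows "asmooth U (\<lambda>x c. \<Sum>i\<in>I. a i x * E i x c)"
  using assms unfolding asmooth_def by (intro allI smooth_on_sum smooth_on_mult) simp_all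

lemma asmooth_diff:
  "open U \<Longrightarrow> asmooth U \<Phi> \<Longrightarrow> asmooth U \<Psi> \<Longrightarrow> asmooth U (\<lambda>x c. \<Phi> x c - \<Psi> x c)"
  unfolding asmooth_def by (intro allI smooth_on_diff) auto

lemma asmooth_scale:
  "open U \<Longrightarrow> smooth_on U f \<Longrightarrow> asmooth U \<Phi> \<Longrightarrow> asmooth U (\<lambda>x c. f x * \<Phi> x c)"
  unfolding asmooth_def by (intro allI smooth_on_mult) auto

lemma smooth_on_pip:
  assumes "open U" "asmooth U \<Phi>" "asmooth U \<Psi>"
  shows "smooth_on U (\<lambda>x. pip n (\<Phi> x) (\<Psi> x))"
  using assms unfolding pip_def asmooth_def
  by (intro smooth_on_diff smooth_on_sum smooth_on_mult) auto

lemma pd_pip: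
  fixes \<Phi> \<Psi> :: "'a::real_normed_vector \<Rightarrow> 'm::finite ambient"
  assumes "adiff \<Phi> u" "adiff \<Psi> u"
  shows "(\<lambda>x. pip n (\<Phi> x) (\<Psi> x)) differentiable (at u)"
    "pd v (\<lambda>x. pip n (\<Phi> x) (\<Psi> x)) u = pip n (apd v \<Phi> u) (\<Psi> u) + pip n (\<Phi> u) (apd v \<Psi> u)"
proof -
  have d: "(\<lambda>x. \<Phi> x c) differentiable (at u)" "(\<lambda>x. \<Psi> x c) differentiable (at u)" for c
    using assms by (auto simp: adiff_def)
  have m: "(\<lambda>x. \<Phi> x c * \<Psi> x c) differentiable (at u)" for c
    using d by (intro differentiable_mult)
  show "(\<lambda>x. pip n (\<Phi> x) (\<Psi> x)) differentiable (at u)"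
    unfolding pip_def using m by (intro differentiable_diff differentiable_sum) auto
  show "pd v (\<lambda>x. pip n (\<Phi> x) (\<Psi> x)) u = pip n (apd v \<Phi> u) (\<Psi> u) + pip n (\<Phi> u) (apd v \<Psi> u)"
    unfolding pip_def using m d
    by (subst pd_diff)
      (auto simp: pd_sum pd_mult apd_def sum.distrib algebra_simps intro!: differentiable_sum)
qed

lemma apd_lincomb:
  assumes "\<And>i. i \<in> I \<Longrightarrow> a i differentiable (at u)" "\<And>i. i \<in> I \<Longrightarrow> adiff (E i) u"
  shows "apd v (\<lambda>x c. \<Sum>i\<in>I. a i x * E i x c) u =
    (\<lambda>c. (\<Sum>i\<in>I. a i u * apd v (E i) u c) + (\<Sum>i\<in>I. pd v (a i) u * E i u c))"
proof
  fix c
  have d: "(\<lambda>x. E i x c) differentiable (at u)" if "i \<in> I" for i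
    using assms(2) that by (auto simp: adiff_def)
  have "apd v (\<lambda>x c. \<Sum>i\<in>I. a i x * E i x c) u c = (\<Sum>i\<in>I. pd v (\<lambda>x. a i x * E i x c) u)"
    unfolding apd_def using assms(1) d by (intro pd_sum differentiable_mult) auto
  also have "\<dots> = (\<Sum>i\<in>I. a i u * pd v (\<lambda>x. E i x c) u + pd v (a i) u * E i u c)"
    using assms(1) d by (intro sum.cong pd_mult) auto
  finally show "apd v (\<lambda>x c. \<Sum>i\<in>I. a i x * E i x c) u c =
    (\<Sum>i\<in>I. a i u * apd v (E i) u c) + (\<Sum>i\<in>I. pd v (a i) u * E i u c)"
    by (simp add: sum.distrib apd_def)
qed

lemma adiff_lincomb:
  assumes "\<And>i. i \<in> I \<Longrightarrow> a i differentiable (at u)" "\<And>i. i \<in> I \<Longrightarrow> adiff (E i) u"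
  shows "adiff (\<lambda>x c. \<Sum>i\<in>I. a i x * E i x c) u"
proof (cases "finite I")
  case True
  then show ?thesis
    using assms unfolding adiff_def by (intro allI differentiable_sum differentiable_mult) auto
qed (simp add: adiff_def)

lemma apd_cong_open:
  assumes "open U" "u \<in> U" "\<And>x. x \<in> U \<Longrightarrow> \<Phi> x = \<Psi> x"
  shows "adiff \<Phi> u \<longleftrightarrow> adiff \<Psi> u" "apd v \<Phi> u = apd v \<Psi> u"
  using pd_cong_open[OF assms(1,2), of "\<lambda>x. \<Phi> x c" "\<lambda>x. \<Psi> x c" for c] assms(3)
  by (simp_all add: adiff_def apd_def)

lemma pd_const: "pd v (\<lambda>_. c) u = 0"
  by (simp add: pd_def)

lemma apd_pseudo_space:
  assumes "open U" "u \<in> U" "\<And>x. x \<in> U \<Longrightarrow> \<Phi> x \<in> pseudo_space n"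
  shows "apd v \<Phi> u \<in> pseudo_space n"
proof -
  have "pd v (\<lambda>x. \<Phi> x (Inr s)) u = pd v (\<lambda>_. 0) u" if "s \<ge> n" for s
    using assms(3) that by (intro pd_cong_open(2)[OF assms(1,2)]) (simp add: pseudo_space_def)
  then show ?thesis by (simp add: pseudo_space_def apd_def pd_const)
qed

lemma pd_expand:
  fixes f :: "real^'m \<Rightarrow> real"
  assumes "f differentiable (at u)"
  shows "pd v f u = (\<Sum>k\<in>UNIV. v $ k * pd (axis k 1) f u)"
proof -
  have lin: "linear (\<lambda>v. pd v f u)" by (rule pd_linear[OF assms])
  have "pd v f u = pd (\<Sum>k\<in>UNIV. (v $ k) *\<^sub>R axis k 1) f u"
    using basis_expansion[of v] by (simp add: scalar_mult_eq_scaleR)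
  also have "\<dots> = (\<Sum>k\<in>UNIV. v $ k * pd (axis k 1) f u)"
    by (subst linear_sum[OF lin]) (simp add: linear_scale[OF lin, unfolded real_scaleR_def])
  finally show ?thesis .
qed

lemma apd_expand:
  fixes \<Phi> :: "real^'m \<Rightarrow> 'k ambient"
  assumes "adiff \<Phi> u"
  shows "apd v \<Phi> u = (\<lambda>c. \<Sum>k\<in>UNIV. v $ k * apd (axis k 1) \<Phi> u c)"
  unfolding apd_def using assms[unfolded adiff_def] pd_expand by blast

lemma apd_compose:
  fixes \<Phi> :: "real^'m \<Rightarrow> 'k ambient" and P :: "real^'l \<Rightarrow> real^'m"
  assumes P: "(P has_derivative P') (at u)" and "adiff \<Phi> (P u)"
  shows "adiff (\<lambda>x. \<Phi> (P x)) u" "apd v (\<lambda>x. \<Phi> (P x)) u = apd (P' v) \<Phi> (P u)"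
  using pd_compose[OF P, of "\<lambda>x. \<Phi> x c" for c] assms(2)
  by (auto simp: adiff_def apd_def)

section \<open>Charts of a space-like submanifold\<close>

text \<open>The remainder of \<open>f\<close> at \<open>\<theta> w\<close> is small relative to \<open>\<theta> x - \<theta> w\<close>. Absorbing it gives a Lipschitz estimate
  for \<open>\<theta>\<close> at \<open>w\<close>, and with this estimate the remainder is also small relative to \<open>x - w\<close>. Applied to coordinate
  changes, this improves continuity to differentiability.\<close>

lemma has_derivative_left_cancel:
  fixes f :: "'a::real_normed_vector \<Rightarrow> 'b::real_normed_vector"
    and \<theta> :: "'c::real_normed_vector \<Rightarrow> 'a"
  assumes f: "(f has_derivative f') (at (\<theta> w))" and g': "bounded_linear g'" "\<And>v. g' (f' v) = v"
    and cont: "isCont \<theta> w" and F: "(F has_derivative F') (at w)"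
    and W: "open W" "w \<in> W" and eq: "\<And>x. x \<in> W \<Longrightarrow> f (\<theta> x) = F x"
  shows "(\<theta> has_derivative (\<lambda>v. g' (F' v))) (at w)"
proof -
  interpret g': bounded_linear g' by fact
  have F': "bounded_linear F'" using F has_derivative_bounded_linear by blast
  obtain C where C: "C > 0" "\<And>x. norm (g' x) \<le> norm x * C" using g'.pos_bounded by blast
  obtain B where B: "B > 0" "\<And>x. norm (F' x) \<le> norm x * B"
    using bounded_linear.pos_bounded[OF F'] by blast
  obtain d0 where d0: "d0 > 0" "\<And>x. norm (x - w) < d0 \<Longrightarrow> x \<in> W"
    using W unfolding open_dist by (auto simp: dist_norm)
  have key: "\<exists>d>0. \<forall>x. norm (x - w) < d \<longrightarrow>
      norm (\<theta> x - \<theta> w - g' (F x - F w)) \<le> C * e * norm (\<theta> x - \<theta> w)" if "e > 0" for e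
  proof -
    obtain d1 where d1: "d1 > 0" "\<And>y. norm (y - \<theta> w) < d1 \<Longrightarrow>
        norm (f y - f (\<theta> w) - f' (y - \<theta> w)) \<le> e * norm (y - \<theta> w)"
      using f \<open>e > 0\<close> unfolding has_derivative_at_alt by blast
    obtain d2 where d2: "d2 > 0" "\<And>x. norm (x - w) < d2 \<Longrightarrow> norm (\<theta> x - \<theta> w) < d1"
      using cont d1(1) unfolding continuous_at_eps_delta dist_norm by blast
    show ?thesis
    proof (intro exI[of _ "min d0 d2"] conjI allI impI)
      show "0 < min d0 d2" using d0 d2 by simp
      fix x assume x: "norm (x - w) < min d0 d2"
      have "w \<in> W" by fact
      have "\<theta> x - \<theta> w - g' (F x - F w) = - g' (f (\<theta> x) - f (\<theta> w) - f' (\<theta> x - \<theta> w))"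
        using eq[of x] eq[OF \<open>w \<in> W\<close>] d0(2)[of x] x by (simp add: g'.diff g'(2))
      then have "norm (\<theta> x - \<theta> w - g' (F x - F w)) \<le> norm (f (\<theta> x) - f (\<theta> w) - f' (\<theta> x - \<theta> w)) * C"
        using C(2) by simp
      also have "\<dots> \<le> e * norm (\<theta> x - \<theta> w) * C"
        using d1(2) d2(2)[of x] x C(1) by (intro mult_right_mono) auto
      finally show "norm (\<theta> x - \<theta> w - g' (F x - F w)) \<le> C * e * norm (\<theta> x - \<theta> w)"
        by (simp add: mult_ac)
    qed
  qed
  have Flip: "\<exists>d>0. \<forall>x. norm (x - w) < d \<longrightarrow> norm (F x - F w) \<le> (B + 1) * norm (x - w)"
  proof -
    obtain d where d: "d > 0" "\<And>x. norm (x - w) < d \<Longrightarrow> norm (F x - F w - F' (x - w)) \<le> 1 * norm (x - w)"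
      using F zero_less_one unfolding has_derivative_at_alt by blast
    have "norm (F x - F w) \<le> (B + 1) * norm (x - w)" if "norm (x - w) < d" for x
      using d(2)[OF that] B(2)[of "x - w"] norm_triangle_sub[of "F x - F w" "F' (x - w)"]
      by (simp add: algebra_simps)
    then show ?thesis using d(1) by blast
  qed
  have \<theta>lip: "\<exists>d>0. \<forall>x. norm (x - w) < d \<longrightarrow> norm (\<theta> x - \<theta> w) \<le> 2 * C * (B + 1) * norm (x - w)"
  proof -
    obtain d1 where d1: "d1 > 0" "\<And>x. norm (x - w) < d1 \<Longrightarrow>
        norm (\<theta> x - \<theta> w - g' (F x - F w)) \<le> C * (1 / (2 * C)) * norm (\<theta> x - \<theta> w)"
      using key[of "1 / (2 * C)"] C(1) by auto
    obtain d2 where d2: "d2 > 0" "\<And>x. norm (x - w) < d2 \<Longrightarrow> norm (F x - F w) \<le> (B + 1) * norm (x - w)"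
      using Flip by blast
    have "norm (\<theta> x - \<theta> w) \<le> 2 * C * (B + 1) * norm (x - w)" if x: "norm (x - w) < min d1 d2" for x
    proof -
      have "norm (\<theta> x - \<theta> w - g' (F x - F w)) \<le> 1 / 2 * norm (\<theta> x - \<theta> w)"
        using d1(2)[of x] x C(1) by simp
      then have "norm (\<theta> x - \<theta> w) \<le> 2 * norm (g' (F x - F w))"
        using norm_triangle_sub[of "\<theta> x - \<theta> w" "g' (F x - F w)"] by simp
      also have "\<dots> \<le> 2 * (norm (F x - F w) * C)" using C(2) by simp
      also have "\<dots> \<le> 2 * ((B + 1) * norm (x - w) * C)"
        using d2(2)[of x] x C(1) by (intro mult_left_mono mult_right_mono) auto
      finally show ?thesis by (simp add: algebra_simps)
    qed
    then show ?thesis using d1(1) d2(1) by (intro exI[of _ "min d1 d2"]) simp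
  qed
  show ?thesis
    unfolding has_derivative_at_alt
  proof (intro conjI allI impI)
    show "bounded_linear (\<lambda>v. g' (F' v))" using bounded_linear_compose[OF g'(1) F'] .
    fix e :: real assume "e > 0"
    define K where "K = 2 * C * (B + 1)"
    have K: "K > 0" using B C by (simp add: K_def)
    define e1 where "e1 = e / (2 * C * K)"
    define e2 where "e2 = e / (2 * C)"
    have e12: "e1 > 0" "e2 > 0" using \<open>e > 0\<close> C K by (auto simp: e1_def e2_def)
    obtain d1 where d1: "d1 > 0" "\<And>x. norm (x - w) < d1 \<Longrightarrow>
        norm (\<theta> x - \<theta> w - g' (F x - F w)) \<le> C * e1 * norm (\<theta> x - \<theta> w)"
      using key[OF e12(1)] by blast
    obtain d2 where d2: "d2 > 0" "\<And>x. norm (x - w) < d2 \<Longrightarrow> norm (\<theta> x - \<theta> w) \<le> K * norm (x - w)"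
      using \<theta>lip unfolding K_def by blast
    obtain d3 where d3: "d3 > 0" "\<And>x. norm (x - w) < d3 \<Longrightarrow>
        norm (F x - F w - F' (x - w)) \<le> e2 * norm (x - w)"
      using F e12(2) unfolding has_derivative_at_alt by blast
    have "norm (\<theta> x - \<theta> w - g' (F' (x - w))) \<le> e * norm (x - w)"
      if x: "norm (x - w) < min d1 (min d2 d3)" for x
    proof -
      have "\<theta> x - \<theta> w - g' (F' (x - w)) = (\<theta> x - \<theta> w - g' (F x - F w)) + g' (F x - F w - F' (x - w))"
        by (simp add: g'.diff)
      then have "norm (\<theta> x - \<theta> w - g' (F' (x - w))) \<le>
          norm (\<theta> x - \<theta> w - g' (F x - F w)) + norm (g' (F x - F w - F' (x - w)))"
        by (metis norm_triangle_ineq)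
      also have "norm (\<theta> x - \<theta> w - g' (F x - F w)) \<le> C * e1 * (K * norm (x - w))"
        using d1(2)[of x] d2(2)[of x] x C e12
        by (smt (verit) min_less_iff_conj mult_left_mono mult_pos_pos)
      also have "norm (g' (F x - F w - F' (x - w))) \<le> (e2 * norm (x - w)) * C"
        using C(2)[of "F x - F w - F' (x - w)"] d3(2)[of x] x C(1)
        by (smt (verit) min_less_iff_conj mult_right_mono)
      also have "C * e1 * (K * norm (x - w)) + (e2 * norm (x - w)) * C = e * norm (x - w)"
        using C K by (simp add: e1_def e2_def field_simps)
      finally show ?thesis by simp
    qed
    then show "\<exists>d>0. \<forall>y. norm (y - w) < d \<longrightarrow> norm (\<theta> y - \<theta> w - g' (F' (y - w))) \<le> e * norm (y - w)"
      using d1(1) d2(1) d3(1) by (intro exI[of _ "min d1 (min d2 d3)"]) simp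
  qed
qed

locale spacelike_chart =
  fixes n :: nat and M :: "'m::finite ambient set" and U :: "(real^'m) set" and \<phi> :: "real^'m \<Rightarrow> 'm ambient"
  assumes spacelike: "spacelike_submanifold n M" and param: "local_param M U \<phi>"
begin

lemma open_U: "open U" and asmooth_\<phi>: "asmooth U \<phi>"
  and immersed: "u \<in> U \<Longrightarrow> apd v \<phi> u = (\<lambda>_. 0) \<Longrightarrow> v = 0"
  and openin_image: "openin (top_of_set M) (\<phi> ` U)"
  and homeo: "\<exists>\<psi>. homeomorphism U (\<phi> ` U) \<phi> \<psi>"
  using param by (auto simp: local_param_def asmooth_def ambient_deriv_eq_apd)

lemma adiff_\<phi>: "u \<in> U \<Longrightarrow> adiff \<phi> u"
  using asmooth_\<phi> asmooth_adiff by blast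

lemma \<phi>_in_M: "u \<in> U \<Longrightarrow> \<phi> u \<in> M"
  using openin_image openin_imp_subset by blast

lemma \<phi>_pseudo_space: "u \<in> U \<Longrightarrow> \<phi> u \<in> pseudo_space n"
  using \<phi>_in_M spacelike by (auto simp: spacelike_submanifold_def submanifold_def)

lemma continuous_\<phi>: "continuous_on U \<phi>"
  using homeo by (auto simp: homeomorphism_def)

lemma apd_\<phi>_pseudo_space: "u \<in> U \<Longrightarrow> apd v \<phi> u \<in> pseudo_space n"
  by (rule apd_pseudo_space[OF open_U]) (auto intro: \<phi>_pseudo_space)

lemma tangentI: "u \<in> U \<Longrightarrow> apd v \<phi> u \<in> tangent_space M (\<phi> u)"
  unfolding tangent_space_def using param by (auto simp: ambient_deriv_eq_apd)

lemma metric_pos: "u \<in> U \<Longrightarrow> v \<noteq> 0 \<Longrightarrow> pip n (apd v \<phi> u) (apd v \<phi> u) > 0"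
  using spacelike tangentI[of u v] immersed[of u v] \<phi>_in_M[of u]
  by (auto simp: spacelike_submanifold_def)

lemma apd_\<phi>_expand: "u \<in> U \<Longrightarrow> apd v \<phi> u = (\<lambda>c. \<Sum>k\<in>UNIV. v $ k * apd (axis k 1) \<phi> u c)"
  by (rule apd_expand[OF adiff_\<phi>])

lemma apd_\<phi>_inj: "u \<in> U \<Longrightarrow> apd v \<phi> u = apd w \<phi> u \<Longrightarrow> v = w"
proof -
  assume u: "u \<in> U" and eq: "apd v \<phi> u = apd w \<phi> u"
  have "apd (v - w) \<phi> u c = apd v \<phi> u c - apd w \<phi> u c" for c
    by (subst (1 2 3) apd_\<phi>_expand[OF u]) (simp add: sum_subtractf left_diff_distrib)
  then show ?thesis using immersed[OF u, of "v - w"] eq by auto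
qed

text \<open>Positivity of the metric at \<open>u\<close> forces the coordinate change \<open>\<theta>\<close>, which is continuous because parametrizations are
  homeomorphisms, to be differentiable at \<open>w\<close>. This is the source of all chart independence.\<close>

lemma transition:
  assumes chart2: "local_param M V \<rho>" and "w \<in> V" "u \<in> U" "\<rho> w = \<phi> u"
  obtains W \<theta> T where "open W" "w \<in> W" "W \<subseteq> V" "(\<theta> has_derivative T) (at w)" "\<theta> w = u"
    "\<And>x. x \<in> W \<Longrightarrow> \<theta> x \<in> U \<and> \<phi> (\<theta> x) = \<rho> x"
proof -
  interpret c2: spacelike_chart n M V \<rho> by unfold_locales (rule spacelike, rule chart2)
  obtain \<psi> where \<psi>: "homeomorphism U (\<phi> ` U) \<phi> \<psi>" using homeo by blast
  define W where "W = V \<inter> \<rho> -` (\<phi> ` U)"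
  have "openin (top_of_set V) W"
    unfolding W_def
    by (rule continuous_openin_preimage[OF c2.continuous_\<phi> _ openin_image]) (auto intro: c2.\<phi>_in_M)
  then have "open W" using openin_open_trans[OF _ c2.open_U] by blast
  have "w \<in> W" using assms by (auto simp: W_def)
  define \<theta> where "\<theta> x = \<psi> (\<rho> x)" for x
  have \<theta>: "\<theta> x \<in> U \<and> \<phi> (\<theta> x) = \<rho> x" if "x \<in> W" for x
    using that \<psi> by (auto simp: W_def \<theta>_def homeomorphism_def)
  have \<theta>w: "\<theta> w = u"
    using assms \<psi> by (auto simp: \<theta>_def homeomorphism_def)
  have "continuous_on W \<theta>"
    unfolding \<theta>_def
  proof (rule continuous_on_compose2[of "\<phi> ` U" \<psi>])
    show "continuous_on (\<phi> ` U) \<psi>" using \<psi> by (simp add: homeomorphism_def)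
    show "continuous_on W \<rho>" using c2.continuous_\<phi> by (rule continuous_on_subset) (auto simp: W_def)
  qed (auto simp: W_def)
  then have cont: "isCont \<theta> w"
    using \<open>open W\<close> \<open>w \<in> W\<close> by (simp add: continuous_on_eq_continuous_at)
  \<comment> \<open>Pairing with the coordinate tangent vectors at \<open>u\<close> turns \<open>\<phi>\<close> into a map between spaces of
    equal dimension whose derivative at \<open>u\<close>, the metric tensor, is invertible.\<close>
  define E where "E k = apd (axis k 1) \<phi> u" for k :: 'm
  define f where "f y = (\<chi> k. pip n (\<phi> y) (E k))" for y
  define F where "F x = (\<chi> k. pip n (\<rho> x) (E k))" for x
  have adE: "adiff (\<lambda>_. E k) x" for k and x :: "real^'m" by (simp add: adiff_def)
  have apdE: "apd v (\<lambda>_. E k) x = (\<lambda>_. 0)" for k v and x :: "real^'m" by (simp add: apd_def pd_const)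
  have vecder: "((\<lambda>y. (\<chi> k. pip n (\<Phi> y) (E k)) :: real^'m) has_derivative
      (\<lambda>v. \<chi> k. pip n (apd v \<Phi> y) (E k))) (at y)"
    if "adiff \<Phi> y" for \<Phi> and y :: "real^'m"
  proof -
    have "((\<lambda>y. pip n (\<Phi> y) (E k)) has_derivative (\<lambda>v. pip n (apd v \<Phi> y) (E k))) (at y)" for k
      using has_derivative_pd[OF pd_pip(1)[OF that adE]] pd_pip(2)[OF that adE]
      by (simp add: apdE pip_zero_right)
    then show ?thesis
      by (subst has_derivative_componentwise_within)
        (auto simp: Basis_vec_def inner_axis)
  qed
  define f' where "f' v = (\<chi> k. pip n (apd v \<phi> u) (E k))" for v
  have f': "(f has_derivative f') (at (\<theta> w))"
    unfolding \<theta>w f_def f'_def using vecder[OF adiff_\<phi>[OF \<open>u \<in> U\<close>]] .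
  have linf: "linear f'" using f' has_derivative_linear by blast
  have "inj f'"
    unfolding linear_injective_0[OF linf]
  proof (intro allI impI)
    fix v assume "f' v = 0"
    then have "pip n (apd v \<phi> u) (E k) = 0" for k by (auto simp: f'_def vec_eq_iff)
    then have "pip n (apd v \<phi> u) (apd v \<phi> u) = 0"
      by (subst (2) apd_\<phi>_expand[OF \<open>u \<in> U\<close>]) (simp add: pip_lincomb_right E_def)
    then show "v = 0" using metric_pos[OF \<open>u \<in> U\<close>, of v] by force
  qed
  then obtain g' where g': "linear g'" "g' \<circ> f' = id"
    using linear_injective_left_inverse[OF linf] by blast
  have "(\<theta> has_derivative (\<lambda>v. g' (\<chi> k. pip n (apd v \<rho> w) (E k)))) (at w)"
  proof (rule has_derivative_left_cancel[where f=f and f'=f' and g'=g' and F=F and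
        F'="\<lambda>v. \<chi> k. pip n (apd v \<rho> w) (E k)", OF f' _ _ cont _ \<open>open W\<close> \<open>w \<in> W\<close>])
    show "bounded_linear g'" using g'(1) linear_conv_bounded_linear by blast
    show "g' (f' v) = v" for v using g'(2) by (metis comp_apply id_apply)
    show "(F has_derivative (\<lambda>v. \<chi> k. pip n (apd v \<rho> w) (E k))) (at w)"
      unfolding F_def using vecder[OF c2.adiff_\<phi>[OF \<open>w \<in> V\<close>]] .
    show "f (\<theta> x) = F x" if "x \<in> W" for x
      using \<theta>[OF that] by (simp add: f_def F_def)
  qed
  then show ?thesis using that[of W \<theta>] \<open>open W\<close> \<open>w \<in> W\<close> \<theta> \<theta>w by (auto simp: W_def)
qed

text \<open>The chain rule for a coordinate change \<open>\<theta>\<close> with derivative \<open>T\<close>, for the position vector and for functions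
  along the submanifold at once.\<close>

lemma pd_transition:
  assumes chart2: "local_param M V \<rho>" and "w \<in> V" "u \<in> U" "\<rho> w = \<phi> u"
  shows "\<exists>T. \<forall>v. apd v \<rho> w = apd (T v) \<phi> u \<and>
    (\<forall>f. (\<lambda>x. f (\<phi> x)) differentiable (at u) \<longrightarrow>
      (\<lambda>x. f (\<rho> x)) differentiable (at w) \<and> pd v (\<lambda>x. f (\<rho> x)) w = pd (T v) (\<lambda>x. f (\<phi> x)) u)"
proof -
  obtain W \<theta> T where W: "open W" "w \<in> W" "W \<subseteq> V" and T: "(\<theta> has_derivative T) (at w)" "\<theta> w = u"
    and \<theta>: "\<And>x. x \<in> W \<Longrightarrow> \<theta> x \<in> U \<and> \<phi> (\<theta> x) = \<rho> x"
    using transition[OF assms] by metis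
  have *: "(\<lambda>x. f (\<rho> x)) differentiable (at w) \<and> pd v (\<lambda>x. f (\<rho> x)) w = pd (T v) (\<lambda>x. f (\<phi> x)) u"
    if "(\<lambda>x. f (\<phi> x)) differentiable (at u)" for f v
  proof -
    have fd: "(\<lambda>x. f (\<phi> x)) differentiable (at (\<theta> w))" using that T(2) by simp
    show ?thesis
      using pd_compose[OF T(1) fd] T(2)
        pd_cong_open[OF W(1,2), where f="\<lambda>x. f (\<phi> (\<theta> x))" and g="\<lambda>x. f (\<rho> x)"] \<theta>
      by simp
  qed
  have "apd v \<rho> w = apd (T v) \<phi> u" for v
    unfolding apd_def using *[of "\<lambda>p. p c" v for c] adiff_\<phi>[OF \<open>u \<in> U\<close>] by (simp add: adiff_def)
  with * show ?thesis by blast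
qed

lemma tangent_space_eq: "u \<in> U \<Longrightarrow> tangent_space M (\<phi> u) = range (\<lambda>v. apd v \<phi> u)"
proof (intro equalityI subsetI)
  fix t assume u: "u \<in> U" and "t \<in> tangent_space M (\<phi> u)"
  then obtain V \<rho> w v where "local_param M V \<rho>" "w \<in> V" "\<rho> w = \<phi> u" "t = apd v \<rho> w"
    unfolding tangent_space_def ambient_deriv_eq_apd by blast
  from pd_transition[OF this(1,2) u this(3)] obtain T where "\<And>v. apd v \<rho> w = apd (T v) \<phi> u"
    by blast
  then show "t \<in> range (\<lambda>v. apd v \<phi> u)" using \<open>t = apd v \<rho> w\<close> by simp
qed (auto intro: tangentI)

lemma deriv_along_eq:
  assumes u: "u \<in> U" and f: "(\<lambda>x. f (\<phi> x)) differentiable (at u)"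
  shows "deriv_along M f (\<phi> u) (apd v \<phi> u) = pd v (\<lambda>x. f (\<phi> x)) u"
  unfolding deriv_along_def
proof (rule the_equality)
  show "\<exists>V \<rho> w x. local_param M V \<rho> \<and> w \<in> V \<and> \<rho> w = \<phi> u \<and> ambient_deriv \<rho> w x = apd v \<phi> u \<and>
      pd v (\<lambda>x. f (\<phi> x)) u = frechet_derivative (f \<circ> \<rho>) (at w) x"
    using param u by (intro exI[of _ U] exI[of _ \<phi>] exI[of _ u] exI[of _ v])
      (simp add: ambient_deriv_eq_apd pd_def o_def)
next
  fix d
  assume "\<exists>V \<rho> w x. local_param M V \<rho> \<and> w \<in> V \<and> \<rho> w = \<phi> u \<and> ambient_deriv \<rho> w x = apd v \<phi> u \<and>
      d = frechet_derivative (f \<circ> \<rho>) (at w) x"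
  then obtain V \<rho> w x where chi: "local_param M V \<rho>" "w \<in> V" "\<rho> w = \<phi> u" "apd x \<rho> w = apd v \<phi> u"
    "d = pd x (\<lambda>x. f (\<rho> x)) w"
    unfolding ambient_deriv_eq_apd pd_def o_def by blast
  obtain T where T: "\<And>v. apd v \<rho> w = apd (T v) \<phi> u"
    "\<And>v. pd v (\<lambda>x. f (\<rho> x)) w = pd (T v) (\<lambda>x. f (\<phi> x)) u"
    using pd_transition[OF chi(1,2) u chi(3)] f by blast
  have "apd (T x) \<phi> u = apd v \<phi> u" using T(1)[of x] chi(4) by simp
  then have "T x = v" by (rule apd_\<phi>_inj[OF u])
  then show "d = pd v (\<lambda>x. f (\<phi> x)) u" using T(2)[of x] chi(5) by simp
qed

lemma differentiable_smooth_along: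
  assumes f: "smooth_along M N f" and u: "u \<in> U" "\<phi> u \<in> N"
  shows "(\<lambda>x. f (\<phi> x)) differentiable (at u)"
proof -
  obtain V \<rho> where V: "local_param M V \<rho>" "\<phi> u \<in> \<rho> ` V" "smooth_on V (f \<circ> \<rho>)"
    using f u(2) by (auto simp: smooth_along_def)
  then obtain w where w: "w \<in> V" "\<rho> w = \<phi> u" by auto
  interpret c2: spacelike_chart n M V \<rho> by unfold_locales (rule spacelike, rule V)
  have "(\<lambda>x. f (\<rho> x)) differentiable (at w)"
    using smooth_on_differentiable[OF V(3) w(1)] by (simp add: o_def)
  then show ?thesis
    using c2.pd_transition[OF param u(1) w(1) w(2)[symmetric]] by blast
qed

end



section \<open>Orthonormal frames, gradient and normal space\<close>

context spacelike_chart
begin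

lemma linear_apd_\<phi>: "u \<in> U \<Longrightarrow> linear (\<lambda>v. apd v \<phi> u c)"
  using adiff_\<phi> unfolding apd_def adiff_def by (blast intro: pd_linear)

lemma linear_metric_left: "u \<in> U \<Longrightarrow> linear (\<lambda>v. pip n (apd v \<phi> u) w)"
  using linear_add[OF linear_apd_\<phi>] linear_scale[OF linear_apd_\<phi>]
  by (intro linearI) (simp_all add: pip_def sum.distrib sum_distrib_left algebra_simps)

lemma linear_metric_right: "u \<in> U \<Longrightarrow> linear (\<lambda>v. pip n w (apd v \<phi> u))"
  by (simp add: pip_commute[of n w] linear_metric_left)

lemma asmooth_tangent_field:
  assumes "\<And>k. smooth_on U (\<lambda>u. V u $ k)"
  shows "asmooth U (\<lambda>u. apd (V u) \<phi> u)"
proof -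
  have "asmooth U (\<lambda>u c. \<Sum>k\<in>UNIV. V u $ k * apd (axis k 1) \<phi> u c)"
    using assms by (intro asmooth_lincomb open_U asmooth_apd asmooth_\<phi>)
  moreover have "smooth_on U (\<lambda>u. \<Sum>k\<in>UNIV. V u $ k * apd (axis k 1) \<phi> u c) \<longleftrightarrow>
      smooth_on U (\<lambda>u. apd (V u) \<phi> u c)" for c
    by (rule smooth_on_cong[OF open_U]) (simp add: apd_\<phi>_expand[of _ "V _"])
  ultimately show ?thesis by (simp add: asmooth_def)
qed

text \<open>Induction over the index set. Only the coefficients with respect to the coordinate vectors are constructed; that
  the coefficients of the vectors for \<open>S\<close> vanish outside \<open>S\<close> keeps the new coordinate direction linearly
  independent of the earlier vectors, so that its projection can be normalized.\<close>

lemma gram_schmidt: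
  "\<exists>A::'m \<Rightarrow> real^'m \<Rightarrow> real^'m. (\<forall>i\<in>S. (\<forall>k. smooth_on U (\<lambda>u. A i u $ k)) \<and>
     (\<forall>u\<in>U. \<forall>k. k \<notin> S \<longrightarrow> A i u $ k = 0) \<and>
     (\<forall>u\<in>U. \<forall>j\<in>S. pip n (apd (A i u) \<phi> u) (apd (A j u) \<phi> u) = (if i = j then 1 else 0)))"
  using finite[of S]
proof (induction S rule: finite_induct)
  case empty
  then show ?case by simp
next
  case (insert j S)
  from insert.IH obtain A :: "'m \<Rightarrow> real^'m \<Rightarrow> real^'m" where
    A: "\<forall>i\<in>S. (\<forall>k. smooth_on U (\<lambda>u. A i u $ k)) \<and> (\<forall>u\<in>U. \<forall>k. k \<notin> S \<longrightarrow> A i u $ k = 0) \<and>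
      (\<forall>u\<in>U. \<forall>j\<in>S. pip n (apd (A i u) \<phi> u) (apd (A j u) \<phi> u) = (if i = j then 1 else 0))"
    by (rule exE)
  have smooth: "smooth_on U (\<lambda>u. A i u $ k)" if "i \<in> S" for i k
    using A that by blast
  have zero: "A i u $ k = 0" if "i \<in> S" "u \<in> U" "k \<notin> S" for i u k
    using A that by blast
  have orth: "pip n (apd (A i u) \<phi> u) (apd (A l u) \<phi> u) = (if i = l then 1 else 0)"
    if "i \<in> S" "l \<in> S" "u \<in> U" for i l u
    using A that by blast
  define g where "g u v w = pip n (apd v \<phi> u) (apd w \<phi> u)" for u v w
  define B where "B u = axis j 1 - (\<Sum>i\<in>S. g u (axis j 1) (A i u) *\<^sub>R A i u)" for u
  have Bk: "B u $ k = (if k = j then 1 else 0) - (\<Sum>i\<in>S. g u (axis j 1) (A i u) * A i u $ k)" for u k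
    by (simp add: B_def axis_def)
  \<comment> \<open>The earlier vectors have no component in direction \<open>j\<close>; hence \<open>B u\<close> is not zero.\<close>
  have Bj: "B u $ j = 1" if "u \<in> U" for u
    using zero[OF _ that insert.hyps(2)] by (simp add: Bk)
  have smooth_g: "smooth_on U (\<lambda>u. g u (V u) (W u))"
    if "\<And>k. smooth_on U (\<lambda>u. V u $ k)" "\<And>k. smooth_on U (\<lambda>u. W u $ k)" for V W
    unfolding g_def using that by (intro smooth_on_pip open_U asmooth_tangent_field)
  have smooth_B: "smooth_on U (\<lambda>u. B u $ k)" for k
    unfolding Bk using smooth
    by (intro smooth_on_diff smooth_on_const smooth_on_sum smooth_on_mult smooth_g open_U) auto
  have pos: "g u (B u) (B u) > 0" if "u \<in> U" for u
    unfolding g_def using Bj[OF that] by (intro metric_pos[OF that]) auto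
  have orthB: "g u (B u) (A l u) = 0" if "u \<in> U" "l \<in> S" for u l
  proof -
    have lin: "linear (\<lambda>v. g u v (A l u))" unfolding g_def using linear_metric_left[OF that(1)] .
    have "g u (B u) (A l u) = g u (axis j 1) (A l u) - (\<Sum>i\<in>S. g u (axis j 1) (A i u) * g u (A i u) (A l u))"
      unfolding B_def by (subst linear_diff[OF lin], subst linear_sum[OF lin])
        (simp add: linear_scale[OF lin, unfolded real_scaleR_def])
    also have "(\<Sum>i\<in>S. g u (axis j 1) (A i u) * g u (A i u) (A l u)) =
        (\<Sum>i\<in>S. if i = l then g u (axis j 1) (A l u) else 0)"
      using orth[OF _ that(2,1)] by (intro sum.cong) (auto simp: g_def)
    finally show ?thesis using that insert.hyps(1) by simp
  qed
  define A' where "A' i u = (if i = j then (g u (B u) (B u) powr (-1/2)) *\<^sub>R B u else A i u)" for i u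
  have sc: "g u (r *\<^sub>R v) w = r * g u v w" "g u w (r *\<^sub>R v) = r * g u w v" if "u \<in> U" for u r v w
    unfolding g_def using linear_scale[OF linear_metric_left[OF that]] linear_scale[OF linear_metric_right[OF that]]
    by auto
  have comm: "g u v w = g u w v" for u v w by (simp add: g_def pip_commute)
  have "smooth_on U (\<lambda>u. A' i u $ k)" if "i \<in> insert j S" for i k
  proof (cases "i = j")
    case True
    have "smooth_on U (\<lambda>u. g u (B u) (B u) powr (-1/2) * B u $ k)"
      using pos smooth_B by (intro smooth_on_mult smooth_on_powr smooth_g open_U)
    then show ?thesis using True by (simp add: A'_def)
  next
    case False
    then show ?thesis using that smooth by (simp add: A'_def)
  qed
  moreover have "A' i u $ k = 0" if "i \<in> insert j S" "u \<in> U" "k \<notin> insert j S" for i u k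
  proof (cases "i = j")
    case True
    have "B u $ k = 0" using that zero[OF _ that(2), of _ k] by (simp add: Bk)
    then show ?thesis using True by (simp add: A'_def)
  next
    case False
    then show ?thesis using that zero by (simp add: A'_def)
  qed
  moreover have "g u (A' i u) (A' l u) = (if i = l then 1 else 0)"
    if "i \<in> insert j S" "l \<in> insert j S" "u \<in> U" for i l u
  proof -
    have jj: "g u (A' j u) (A' j u) = 1"
    proof -
      have "x powr (-1/2) * x powr (-1/2) = inverse x" if "x > 0" for x :: real
        using that by (simp add: powr_minus powr_half_sqrt flip: inverse_mult_distrib)
      from this[OF pos[OF \<open>u \<in> U\<close>]] show ?thesis
        using pos[OF \<open>u \<in> U\<close>] by (simp add: A'_def sc[OF that(3)] mult.assoc[symmetric])
    qed
    have "g u (A' j u) (A' l u) = 0" if "l \<in> S" for l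
      using that insert.hyps(2) orthB[OF \<open>u \<in> U\<close> that] by (auto simp: A'_def sc[OF \<open>u \<in> U\<close>])
    moreover from this have "g u (A' l u) (A' j u) = 0" if "l \<in> S" for l
      using that comm by metis
    moreover have "g u (A' i u) (A' l u) = (if i = l then 1 else 0)" if "i \<in> S" "l \<in> S"
      using orth[OF that \<open>u \<in> U\<close>] that insert.hyps(2) by (auto simp: A'_def g_def)
    ultimately show ?thesis using that jj by auto
  qed
  ultimately show ?case unfolding g_def by blast
qed

lemma ex_orthonormal_coefficients:
  "\<exists>A::'m \<Rightarrow> real^'m \<Rightarrow> real^'m. (\<forall>i k. smooth_on U (\<lambda>u. A i u $ k)) \<and>
     (\<forall>u\<in>U. \<forall>i j. pip n (apd (A i u) \<phi> u) (apd (A j u) \<phi> u) = (if i = j then 1 else 0))"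
proof -
  obtain A :: "'m \<Rightarrow> real^'m \<Rightarrow> real^'m" where "\<And>i k. smooth_on U (\<lambda>u. A i u $ k)"
    "\<And>u i j. u \<in> U \<Longrightarrow> pip n (apd (A i u) \<phi> u) (apd (A j u) \<phi> u) = (if i = j then 1 else 0)"
    using gram_schmidt[of UNIV] by blast
  then show ?thesis by blast
qed

text \<open>Positivity on the tangent space makes the projection of tangent vectors to the \<open>m\<close> space-like coordinates injective, hence
  bijective. So some tangent vector \<open>t\<close> has the same space-like coordinates as \<open>\<nu>\<close>; the vector \<open>\<nu> - t\<close> has only
  time-like coordinates, and its square \<open>\<langle>\<nu>, \<nu>\<rangle> + \<langle>t, t\<rangle>\<close> is not positive.\<close>

lemma normal_pip_nonpos:
  assumes u: "u \<in> U" and \<nu>: "\<nu> \<in> pseudo_space n" "\<And>v. pip n \<nu> (apd v \<phi> u) = 0"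
  shows "pip n \<nu> \<nu> \<le> 0"
proof -
  define L where "L v = (\<chi> i. apd v \<phi> u (Inl i))" for v
  have lin: "linear L"
    using linear_add[OF linear_apd_\<phi>[OF u]] linear_scale[OF linear_apd_\<phi>[OF u]]
    by (intro linearI) (simp_all add: L_def vec_eq_iff)
  have "inj L"
    unfolding linear_injective_0[OF lin]
  proof (intro allI impI)
    fix v assume "L v = 0"
    then have "pip n (apd v \<phi> u) (apd v \<phi> u) \<le> 0"
      by (simp add: L_def vec_eq_iff pip_def sum_nonneg)
    then show "v = 0" using metric_pos[OF u, of v] by force
  qed
  then have "surj L" using linear_injective_imp_surjective[OF lin] by blast
  then obtain v where v: "L v = (\<chi> i. \<nu> (Inl i))" by (metis surjD)
  define t where "t = apd v \<phi> u"
  have ti: "t (Inl i) = \<nu> (Inl i)" for i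
    using v by (simp add: L_def t_def vec_eq_iff)
  have "pip n (\<lambda>c. \<nu> c - t c) (\<lambda>c. \<nu> c - t c) \<le> 0"
    by (simp add: pip_def ti sum_nonneg)
  moreover have "pip n (\<lambda>c. \<nu> c - t c) (\<lambda>c. \<nu> c - t c) = pip n \<nu> \<nu> + pip n t t"
    using \<nu>(2)[of v] pip_commute[of n t \<nu>] by (simp add: pip_diff_left pip_diff_right t_def)
  moreover have "pip n t t \<ge> 0"
    using metric_pos[OF u, of v] immersed[OF u] by (cases "v = 0")
      (auto simp: t_def linear_0[OF linear_metric_left[OF u]])
  ultimately show ?thesis by simp
qed

text \<open>The form is negative semidefinite on normal vectors; the usual discriminant argument applies.\<close>

lemma normal_cauchy_schwarz:
  assumes u: "u \<in> U" and \<nu>: "\<nu> \<in> pseudo_space n" "\<And>v. pip n \<nu> (apd v \<phi> u) = 0"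
    and \<mu>: "\<mu> \<in> pseudo_space n" "\<And>v. pip n \<mu> (apd v \<phi> u) = 0"
  shows "(pip n \<nu> \<mu>)\<^sup>2 \<le> pip n \<nu> \<nu> * pip n \<mu> \<mu>"
proof -
  have q: "pip n \<nu> \<nu> + 2 * s * pip n \<nu> \<mu> + s\<^sup>2 * pip n \<mu> \<mu> \<le> 0" for s
  proof -
    have "pip n (\<lambda>c. \<nu> c + s * \<mu> c) (\<lambda>c. \<nu> c + s * \<mu> c) \<le> 0"
      using \<nu> \<mu> by (intro normal_pip_nonpos[OF u] pseudo_space_add pseudo_space_scale)
        (simp_all add: pip_add_left pip_scale_left)
    then show ?thesis
      using pip_commute[of n \<mu> \<nu>]
      by (simp add: pip_add_left pip_add_right pip_scale_left pip_scale_right power2_eq_square algebra_simps)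
  qed
  define a b c where "a = - pip n \<nu> \<nu>" and "b = - pip n \<nu> \<mu>" and "c = - pip n \<mu> \<mu>"
  have ac: "a \<ge> 0" "c \<ge> 0" using normal_pip_nonpos[OF u] \<nu> \<mu> by (auto simp: a_def c_def)
  have q: "a + 2 * s * b + s\<^sup>2 * c \<ge> 0" for s using q[of s] by (simp add: a_def b_def c_def)
  have "b\<^sup>2 \<le> a * c"
  proof (cases "c = 0")
    case True
    have "b = 0"
    proof (rule ccontr)
      assume "b \<noteq> 0"
      then show False using q[of "- (a + 1) / (2 * b)"] ac True by (simp add: field_simps)
    qed
    then show ?thesis using True by simp
  next
    case False
    then show ?thesis using q[of "- b / c"] ac
      by (simp add: field_simps power2_eq_square)
  qed
  then show ?thesis by (simp add: a_def b_def c_def)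
qed

end

text \<open>A chart with a smooth orthonormal tangent frame, given by its coefficients \<open>A i\<close> with respect to
  the coordinate vectors.\<close>

locale framed_chart = spacelike_chart +
  fixes A :: "'m \<Rightarrow> real^'m \<Rightarrow> real^'m"
  assumes A_smooth: "smooth_on U (\<lambda>u. A i u $ k)"
    and A_orthonormal: "u \<in> U \<Longrightarrow> pip n (apd (A i u) \<phi> u) (apd (A j u) \<phi> u) = (if i = j then 1 else 0)"
begin

definition e :: "'m \<Rightarrow> real^'m \<Rightarrow> 'm ambient" where
  "e i u = apd (A i u) \<phi> u"

lemma e_orthonormal: "u \<in> U \<Longrightarrow> pip n (e i u) (e j u) = (if i = j then 1 else 0)"
  unfolding e_def by (rule A_orthonormal)

lemma asmooth_e: "asmooth U (e i)"
  unfolding e_def[abs_def] by (rule asmooth_tangent_field[OF A_smooth])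

lemma adiff_e: "u \<in> U \<Longrightarrow> adiff (e i) u"
  using asmooth_e asmooth_adiff by blast

lemma e_pseudo_space: "u \<in> U \<Longrightarrow> e i u \<in> pseudo_space n"
  unfolding e_def by (rule apd_\<phi>_pseudo_space)

text \<open>The coordinate functionals of \<open>m\<close> orthonormal vectors form a surjective, hence injective, linear map.\<close>

lemma coefficient_expansion:
  assumes u: "u \<in> U"
  shows "v = (\<Sum>j\<in>UNIV. pip n (apd v \<phi> u) (e j u) *\<^sub>R A j u)"
proof -
  define L where "L v = (\<chi> j. pip n (apd v \<phi> u) (e j u))" for v
  note lin1 = linear_metric_left[OF u]
  have lin: "linear L"
    using linear_add[OF lin1] linear_scale[OF lin1]
    by (intro linearI) (simp_all add: L_def vec_eq_iff)
  have LA: "L (A i u) = axis i 1" for i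
    using e_orthonormal[OF u, of i] by (simp add: L_def vec_eq_iff axis_def e_def[of i])
  have sumL: "L (\<Sum>j\<in>UNIV. y $ j *\<^sub>R A j u) = y" for y
  proof -
    have "L (\<Sum>j\<in>UNIV. y $ j *\<^sub>R A j u) = (\<Sum>j\<in>UNIV. y $ j *\<^sub>R axis j 1)"
      by (subst linear_sum[OF lin]) (simp add: linear_scale[OF lin] LA)
    then show ?thesis using basis_expansion[of y] by (simp add: scalar_mult_eq_scaleR)
  qed
  then have "surj L" by (rule surjI[where f="\<lambda>y. \<Sum>j\<in>UNIV. y $ j *\<^sub>R A j u"])
  then have "inj L" using linear_surjective_imp_injective[OF lin] by blast
  moreover have "L (\<Sum>j\<in>UNIV. L v $ j *\<^sub>R A j u) = L v" by (rule sumL)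
  ultimately have "(\<Sum>j\<in>UNIV. L v $ j *\<^sub>R A j u) = v" by (simp add: inj_eq)
  then show ?thesis by (simp add: L_def)
qed

lemma tangent_expansion:
  assumes u: "u \<in> U"
  shows "apd v \<phi> u = (\<lambda>c. \<Sum>j\<in>UNIV. pip n (apd v \<phi> u) (e j u) * e j u c)"
proof
  fix c
  note lin = linear_apd_\<phi>[OF u, of c]
  have "apd v \<phi> u c = apd (\<Sum>j\<in>UNIV. pip n (apd v \<phi> u) (e j u) *\<^sub>R A j u) \<phi> u c"
    using coefficient_expansion[OF u, of v] by simp
  also have "\<dots> = (\<Sum>j\<in>UNIV. pip n (apd v \<phi> u) (e j u) * e j u c)"
    by (subst linear_sum[OF lin]) (simp add: linear_scale[OF lin, unfolded real_scaleR_def] e_def)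
  finally show "apd v \<phi> u c = (\<Sum>j\<in>UNIV. pip n (apd v \<phi> u) (e j u) * e j u c)" .
qed

lemma tangent_space_expansion:
  "u \<in> U \<Longrightarrow> t \<in> tangent_space M (\<phi> u) \<Longrightarrow> t = (\<lambda>c. \<Sum>j\<in>UNIV. pip n t (e j u) * e j u c)"
  using tangent_space_eq tangent_expansion by auto

lemma lincomb_e_tangent: "u \<in> U \<Longrightarrow> (\<lambda>c. \<Sum>j\<in>UNIV. a j * e j u c) \<in> tangent_space M (\<phi> u)"
proof -
  assume u: "u \<in> U"
  have "(\<lambda>c. \<Sum>j\<in>UNIV. a j * e j u c) = apd (\<Sum>j\<in>UNIV. a j *\<^sub>R A j u) \<phi> u"
    unfolding e_def
    by (rule ext, subst linear_sum[OF linear_apd_\<phi>[OF u]])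
      (simp add: linear_scale[OF linear_apd_\<phi>[OF u], unfolded real_scaleR_def])
  then show ?thesis using tangentI[OF u] by simp
qed

lemma normal_iff_e:
  assumes u: "u \<in> U"
  shows "(\<forall>v. pip n \<nu> (apd v \<phi> u) = 0) \<longleftrightarrow> (\<forall>j. pip n \<nu> (e j u) = 0)"
proof
  assume *: "\<forall>j. pip n \<nu> (e j u) = 0"
  show "\<forall>v. pip n \<nu> (apd v \<phi> u) = 0"
    by (subst tangent_expansion[OF u]) (simp add: pip_lincomb_right *)
qed (simp add: e_def)

text \<open>The orthogonal projection to the normal space in terms of the frame, defined on all ambient vectors.\<close>

definition nu :: "real^'m \<Rightarrow> 'm ambient \<Rightarrow> 'm ambient" where
  "nu u w = (\<lambda>c. w c - (\<Sum>j\<in>UNIV. pip n w (e j u) * e j u c))"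

lemma nu_normal: "u \<in> U \<Longrightarrow> pip n (nu u w) (e j u) = 0"
  by (simp add: nu_def pip_diff_left pip_lincomb_left e_orthonormal if_distrib cong: if_cong)

lemma nu_pseudo_space: "u \<in> U \<Longrightarrow> w \<in> pseudo_space n \<Longrightarrow> nu u w \<in> pseudo_space n"
  unfolding nu_def by (intro pseudo_space_diff pseudo_space_lincomb e_pseudo_space)

lemma nu_add: "nu u (\<lambda>c. a c + b c) = (\<lambda>c. nu u a c + nu u b c)"
  by (rule ext) (simp add: nu_def pip_add_left sum.distrib algebra_simps)

lemma nu_lincomb: "nu u (\<lambda>c. \<Sum>i\<in>I. a i * E i c) = (\<lambda>c. \<Sum>i\<in>I. a i * nu u (E i) c)"
proof
  fix c
  have "(\<Sum>j\<in>UNIV. (\<Sum>i\<in>I. a i * pip n (E i) (e j u)) * e j u c) =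
      (\<Sum>i\<in>I. a i * (\<Sum>j\<in>UNIV. pip n (E i) (e j u) * e j u c))"
    by (simp add: sum_distrib_left sum_distrib_right mult.assoc sum.swap[of _ UNIV])
  then show "nu u (\<lambda>c. \<Sum>i\<in>I. a i * E i c) c = (\<Sum>i\<in>I. a i * nu u (E i) c)"
    by (simp add: nu_def pip_lincomb_left right_diff_distrib sum_subtractf)
qed

lemma nu_tangent: "u \<in> U \<Longrightarrow> nu u (apd v \<phi> u) = (\<lambda>_. 0)"
  by (rule ext, unfold nu_def, subst (1) tangent_expansion) auto

lemma normal_part_eq:
  assumes u: "u \<in> U" and w: "w \<in> pseudo_space n"
  shows "normal_part n M (\<phi> u) w = nu u w"
  unfolding normal_part_def
proof (rule the_equality)
  have "nu u w \<in> normal_space n M (\<phi> u)"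
    using nu_pseudo_space[OF u w] nu_normal[OF u] normal_iff_e[OF u]
    by (auto simp: normal_space_def tangent_space_eq[OF u])
  moreover have "(\<lambda>c. w c - nu u w c) \<in> tangent_space M (\<phi> u)"
    using lincomb_e_tangent[OF u] by (simp add: nu_def)
  ultimately show "nu u w \<in> normal_space n M (\<phi> u) \<and> (\<lambda>c. w c - nu u w c) \<in> tangent_space M (\<phi> u)" ..
next
  fix \<nu> assume *: "\<nu> \<in> normal_space n M (\<phi> u) \<and> (\<lambda>c. w c - \<nu> c) \<in> tangent_space M (\<phi> u)"
  then have z: "pip n \<nu> (e j u) = 0" for j
    by (simp add: normal_space_def e_def tangentI[OF u])
  have "(\<lambda>c. w c - \<nu> c) = (\<lambda>c. \<Sum>j\<in>UNIV. pip n (\<lambda>c. w c - \<nu> c) (e j u) * e j u c)"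
    using tangent_space_expansion[OF u] * by blast
  then have "w c - \<nu> c = (\<Sum>j\<in>UNIV. pip n w (e j u) * e j u c)" for c
    by (simp add: pip_diff_left z fun_eq_iff)
  then show "\<nu> = nu u w" by (simp add: nu_def fun_eq_iff algebra_simps)
qed

lemma gradient_eq:
  assumes u: "u \<in> U" and f: "(\<lambda>x. f (\<phi> x)) differentiable (at u)"
  shows "gradient n M f (\<phi> u) = (\<lambda>c. \<Sum>j\<in>UNIV. pd (A j u) (\<lambda>x. f (\<phi> x)) u * e j u c)"
  unfolding gradient_def
proof (rule the_equality)
  let ?g = "\<lambda>c. \<Sum>j\<in>UNIV. pd (A j u) (\<lambda>x. f (\<phi> x)) u * e j u c"
  have "pip n ?g (apd v \<phi> u) = deriv_along M f (\<phi> u) (apd v \<phi> u)" for v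
  proof -
    note lin = pd_linear[OF f]
    have "pd v (\<lambda>x. f (\<phi> x)) u = (\<Sum>j\<in>UNIV. pip n (apd v \<phi> u) (e j u) * pd (A j u) (\<lambda>x. f (\<phi> x)) u)"
      by (subst coefficient_expansion[OF u, of v], subst linear_sum[OF lin])
        (simp add: linear_scale[OF lin, unfolded real_scaleR_def])
    then show ?thesis
      unfolding deriv_along_eq[OF u f] pip_lincomb_left
      by (simp add: mult.commute pip_commute[of n "apd v \<phi> u"])
  qed
  then show "?g \<in> tangent_space M (\<phi> u) \<and> (\<forall>v\<in>tangent_space M (\<phi> u). pip n ?g v = deriv_along M f (\<phi> u) v)"
    using lincomb_e_tangent[OF u] by (auto simp: tangent_space_eq[OF u])
next
  fix g assume *: "g \<in> tangent_space M (\<phi> u) \<and> (\<forall>v\<in>tangent_space M (\<phi> u). pip n g v = deriv_along M f (\<phi> u) v)"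
  then have "pip n g (e j u) = pd (A j u) (\<lambda>x. f (\<phi> x)) u" for j
    unfolding e_def using deriv_along_eq[OF u f] tangentI[OF u] by simp
  then show "g = (\<lambda>c. \<Sum>j\<in>UNIV. pd (A j u) (\<lambda>x. f (\<phi> x)) u * e j u c)"
    using tangent_space_expansion[OF u, of g] * by simp
qed

lemma gradient_norm_pseudo_distance:
  assumes u: "u \<in> U"
  shows "gradient_norm n M (pseudo_distance n) (\<phi> u) = 2 * sqrt (\<Sum>j\<in>UNIV. (pip n (\<phi> u) (e j u))\<^sup>2)"
proof -
  have d: "(\<lambda>x. pseudo_distance n (\<phi> x)) differentiable (at u)"
    and pd: "pd v (\<lambda>x. pseudo_distance n (\<phi> x)) u = 2 * pip n (\<phi> u) (apd v \<phi> u)" for v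
    using pd_pip[OF adiff_\<phi>[OF u] adiff_\<phi>[OF u]] pip_commute[of n _ "\<phi> u"]
    by (simp_all add: pseudo_distance_def)
  have "pip n (gradient n M (pseudo_distance n) (\<phi> u)) (gradient n M (pseudo_distance n) (\<phi> u)) =
      (\<Sum>j\<in>UNIV. (2 * pip n (\<phi> u) (e j u))\<^sup>2)"
    unfolding gradient_eq[OF u d]
    by (simp add: pip_lincomb_left pip_lincomb_right e_orthonormal[OF u] pd e_def[symmetric]
      if_distrib power2_eq_square cong: if_cong)
  also have "\<dots> = 2\<^sup>2 * (\<Sum>j\<in>UNIV. (pip n (\<phi> u) (e j u))\<^sup>2)"
    by (simp add: sum_distrib_left power_mult_distrib)
  finally show ?thesis by (simp add: gradient_norm_def real_sqrt_mult)
qed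

text \<open>Complete the square: the difference of the two sides is four times the squared length of the difference
  of the given tangent vector and the tangential part of the position vector.\<close>

lemma gradient_norm_lower_bound:
  assumes u: "u \<in> U"
  shows "4 * (2 * pip n (\<phi> u) (apd v \<phi> u) - pip n (apd v \<phi> u) (apd v \<phi> u))
    \<le> (gradient_norm n M (pseudo_distance n) (\<phi> u))\<^sup>2"
proof -
  define t where "t j = pip n (apd v \<phi> u) (e j u)" for j
  define x where "x j = pip n (\<phi> u) (e j u)" for j
  have eq: "apd v \<phi> u = (\<lambda>c. \<Sum>j\<in>UNIV. t j * e j u c)" unfolding t_def by (rule tangent_expansion[OF u])
  have "pip n (\<phi> u) (apd v \<phi> u) = (\<Sum>j\<in>UNIV. t j * x j)"
    unfolding eq by (simp add: pip_lincomb_right x_def)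
  moreover have "pip n (apd v \<phi> u) (apd v \<phi> u) = (\<Sum>j\<in>UNIV. (t j)\<^sup>2)"
    unfolding eq by (simp add: pip_lincomb_right pip_lincomb_left e_orthonormal[OF u]
      if_distrib power2_eq_square cong: if_cong)
  moreover have "(gradient_norm n M (pseudo_distance n) (\<phi> u))\<^sup>2 = 4 * (\<Sum>j\<in>UNIV. (x j)\<^sup>2)"
    unfolding gradient_norm_pseudo_distance[OF u] x_def by (simp add: power_mult_distrib sum_nonneg)
  moreover have "0 \<le> (\<Sum>j\<in>UNIV. (x j - t j)\<^sup>2)" by (simp add: sum_nonneg)
  moreover have "(\<Sum>j\<in>UNIV. (x j - t j)\<^sup>2) = (\<Sum>j\<in>UNIV. (x j)\<^sup>2) - 2 * (\<Sum>j\<in>UNIV. t j * x j) + (\<Sum>j\<in>UNIV. (t j)\<^sup>2)"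
    by (simp add: power2_diff sum.distrib sum_subtractf sum_distrib_left algebra_simps)
  ultimately show ?thesis by simp
qed

end



section \<open>Mean curvature in a framed chart\<close>

lemma apd_lincomb_dir:
  fixes \<Phi> :: "'a::real_normed_vector \<Rightarrow> 'm ambient"
  assumes "adiff \<Phi> u"
  shows "apd (\<Sum>i\<in>I. a i *\<^sub>R v i) \<Phi> u = (\<lambda>c. \<Sum>i\<in>I. a i * apd (v i) \<Phi> u c)"
proof
  fix c
  have lin: "linear (\<lambda>v. pd v (\<lambda>x. \<Phi> x c) u)"
    using assms by (intro pd_linear) (simp add: adiff_def)
  show "apd (\<Sum>i\<in>I. a i *\<^sub>R v i) \<Phi> u c = (\<Sum>i\<in>I. a i * apd (v i) \<Phi> u c)"
    unfolding apd_def by (subst linear_sum[OF lin]) (simp add: linear_scale[OF lin, unfolded real_scaleR_def])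
qed

lemma orthogonal_columns:
  fixes \<beta> :: "'m::finite \<Rightarrow> 'm \<Rightarrow> real"
  assumes "\<And>i j. (\<Sum>k\<in>UNIV. \<beta> i k * \<beta> j k) = (if i = j then 1 else 0)"
  shows "(\<Sum>i\<in>UNIV. \<beta> i j * \<beta> i k) = (if j = k then 1 else 0)"
proof -
  define B :: "real^'m^'m" where "B = (\<chi> i k. \<beta> i k)"
  have "B ** transpose B = mat 1"
    using assms by (simp add: B_def matrix_matrix_mult_def transpose_def mat_def vec_eq_iff)
  then have "transpose B ** B = mat 1" by (simp add: matrix_left_right_inverse)
  then have "(transpose B ** B) $ j $ k = mat 1 $ j $ k" by simp
  then show ?thesis
    by (simp add: B_def matrix_matrix_mult_def transpose_def mat_def)
qed

lemma sum_rotate: "(\<Sum>i\<in>I. \<Sum>j\<in>J. \<Sum>k\<in>K. f i j k) = (\<Sum>j\<in>J. \<Sum>k\<in>K. \<Sum>i\<in>I. f i j k)"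
proof -
  have "(\<Sum>i\<in>I. \<Sum>j\<in>J. \<Sum>k\<in>K. f i j k) = (\<Sum>j\<in>J. \<Sum>i\<in>I. \<Sum>k\<in>K. f i j k)"
    by (rule sum.swap)
  also have "\<dots> = (\<Sum>j\<in>J. \<Sum>k\<in>K. \<Sum>i\<in>I. f i j k)"
    by (intro sum.cong refl sum.swap)
  finally show ?thesis .
qed

context framed_chart
begin

lemma \<phi>_image_inverse: "\<exists>\<psi>. \<forall>u\<in>U. \<psi> (\<phi> u) = u"
  using homeo by (auto simp: homeomorphism_def)

lemma apd_e_pseudo_space: "u \<in> U \<Longrightarrow> apd v (e i) u \<in> pseudo_space n"
  by (rule apd_pseudo_space[OF open_U]) (auto intro: e_pseudo_space)

lemma flat_conn_eq:
  assumes "u \<in> U" "adiff (\<lambda>x. W (\<phi> x)) u"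
  shows "flat_conn M W (\<phi> u) (apd v \<phi> u) = apd v (\<lambda>x. W (\<phi> x)) u"
  using assms deriv_along_eq[OF assms(1), of "\<lambda>q. W q c" v for c]
  by (simp add: flat_conn_def adiff_def apd_def[of v "\<lambda>x. W (\<phi> x)"])

text \<open>The mean curvature vector computed with the chosen frame: differentiating along the frame vector
  \<open>e j u\<close> means differentiating in the coordinate direction \<open>A j u\<close>.\<close>

definition frame_trace :: "real^'m \<Rightarrow> 'm ambient" where
  "frame_trace u = (\<lambda>c. (\<Sum>j\<in>UNIV. nu u (apd (A j u) (e j) u) c) / real CARD('m))"

text \<open>Another frame is related to the chosen one by an orthogonal matrix \<open>\<beta>\<close> depending differentiably on the
  point. The derivatives of \<open>\<beta>\<close> contribute only tangent vectors, which the normal projection kills, and \<open>\<beta>\<close> itself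
  drops out because its columns are orthonormal.\<close>

lemma frame_trace_unique:
  assumes u: "u \<in> U" and N: "\<phi> u \<in> N" and fr: "local_orthonormal_frame n M N f"
  shows "(\<lambda>c. (\<Sum>i\<in>UNIV. second_fundamental_form n M (f i) (f i) (\<phi> u) c) / real CARD('m)) = frame_trace u"
proof -
  have Nopen: "openin (top_of_set M) N" and tf: "\<And>i. tangent_field M N (f i)"
    and orth: "\<And>q i j. q \<in> N \<Longrightarrow> pip n (f i q) (f j q) = (if i = j then 1 else 0)"
    using fr by (auto simp: local_orthonormal_frame_def)
  define W where "W = U \<inter> \<phi> -` N"
  have "openin (top_of_set U) W"
    unfolding W_def
    by (rule continuous_openin_preimage[OF continuous_\<phi> _ Nopen]) (auto intro: \<phi>_in_M)
  then have W: "open W" "u \<in> W" using openin_open_trans[OF _ open_U] u N by (auto simp: W_def)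
  have fad: "adiff (\<lambda>x. f i (\<phi> x)) u" for i
    unfolding adiff_def using tf[of i] differentiable_smooth_along[OF _ u N]
    by (auto simp: tangent_field_def)
  define \<beta> where "\<beta> i j x = pip n (f i (\<phi> x)) (e j x)" for i j x
  have \<beta>d: "\<beta> i j differentiable (at u)" for i j
    unfolding \<beta>_def[abs_def] by (rule pd_pip(1)[OF fad adiff_e[OF u]])
  have exp: "f i (\<phi> x) = (\<lambda>c. \<Sum>j\<in>UNIV. \<beta> i j x * e j x c)" if "x \<in> W" for i x
    unfolding \<beta>_def using that tf[of i] by (intro tangent_space_expansion) (auto simp: W_def tangent_field_def)
  have \<beta>orth: "(\<Sum>k\<in>UNIV. \<beta> i k u * \<beta> j k u) = (if i = j then 1 else 0)" for i j
  proof -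
    have "pip n (f i (\<phi> u)) (f j (\<phi> u)) = (\<Sum>k\<in>UNIV. \<beta> i k u * \<beta> j k u)"
      by (subst exp[OF W(2)], subst exp[OF W(2)])
        (simp add: pip_lincomb_left pip_lincomb_right e_orthonormal[OF u] if_distrib cong: if_cong)
    then show ?thesis using orth[OF N] by simp
  qed
  define w where "w i = (\<Sum>k\<in>UNIV. \<beta> i k u *\<^sub>R A k u)" for i
  have fw: "f i (\<phi> u) = apd (w i) \<phi> u" for i
    unfolding w_def apd_lincomb_dir[OF adiff_\<phi>[OF u]] using exp[OF W(2)] by (simp add: e_def)
  have sff: "second_fundamental_form n M (f i) (f i) (\<phi> u) =
      (\<lambda>c. \<Sum>j\<in>UNIV. \<Sum>k\<in>UNIV. \<beta> i j u * \<beta> i k u * nu u (apd (A k u) (e j) u) c)" for i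
  proof -
    have "flat_conn M (f i) (\<phi> u) (f i (\<phi> u)) = apd (w i) (\<lambda>x. f i (\<phi> x)) u"
      unfolding fw by (rule flat_conn_eq[OF u fad])
    also have "\<dots> = apd (w i) (\<lambda>x c. \<Sum>j\<in>UNIV. \<beta> i j x * e j x c) u"
      by (rule apd_cong_open(2)[OF W exp])
    also have "\<dots> = (\<lambda>c. (\<Sum>j\<in>UNIV. \<beta> i j u * apd (w i) (e j) u c) + (\<Sum>j\<in>UNIV. pd (w i) (\<beta> i j) u * e j u c))"
      by (intro apd_lincomb \<beta>d adiff_e[OF u])
    finally have fc: "flat_conn M (f i) (\<phi> u) (f i (\<phi> u)) =
      (\<lambda>c. (\<Sum>j\<in>UNIV. \<beta> i j u * apd (w i) (e j) u c) + (\<Sum>j\<in>UNIV. pd (w i) (\<beta> i j) u * e j u c))" .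
    have ps: "flat_conn M (f i) (\<phi> u) (f i (\<phi> u)) \<in> pseudo_space n"
      unfolding fc by (intro pseudo_space_add pseudo_space_lincomb apd_e_pseudo_space[OF u] e_pseudo_space[OF u])
    have w_dir: "apd (w i) (e j) u = (\<lambda>c. \<Sum>k\<in>UNIV. \<beta> i k u * apd (A k u) (e j) u c)" for j
      unfolding w_def by (rule apd_lincomb_dir[OF adiff_e[OF u]])
    have "second_fundamental_form n M (f i) (f i) (\<phi> u) = nu u (flat_conn M (f i) (\<phi> u) (f i (\<phi> u)))"
      unfolding second_fundamental_form_def by (rule normal_part_eq[OF u ps])
    also have "\<dots> = (\<lambda>c. \<Sum>j\<in>UNIV. \<beta> i j u * nu u (apd (w i) (e j) u) c)"
      unfolding fc nu_add nu_lincomb e_def nu_tangent[OF u] by simp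
    also have "\<dots> = (\<lambda>c. \<Sum>j\<in>UNIV. \<Sum>k\<in>UNIV. \<beta> i j u * \<beta> i k u * nu u (apd (A k u) (e j) u) c)"
      unfolding w_dir nu_lincomb by (simp add: sum_distrib_left mult.assoc)
    finally show ?thesis .
  qed
  have "(\<Sum>i\<in>UNIV. second_fundamental_form n M (f i) (f i) (\<phi> u) c) = (\<Sum>j\<in>UNIV. nu u (apd (A j u) (e j) u) c)" for c
  proof -
    have "(\<Sum>i\<in>UNIV. second_fundamental_form n M (f i) (f i) (\<phi> u) c) =
        (\<Sum>j\<in>UNIV. \<Sum>k\<in>UNIV. \<Sum>i\<in>UNIV. \<beta> i j u * \<beta> i k u * nu u (apd (A k u) (e j) u) c)"
      unfolding sff by (rule sum_rotate)
    also have "\<dots> = (\<Sum>j\<in>UNIV. \<Sum>k\<in>UNIV. (if j = k then 1 else 0) * nu u (apd (A k u) (e j) u) c)"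
      by (simp add: sum_distrib_right[symmetric] orthogonal_columns[OF \<beta>orth])
    also have "\<dots> = (\<Sum>j\<in>UNIV. nu u (apd (A j u) (e j) u) c)"
      by (simp add: if_distrib[of "\<lambda>x. x * _"] cong: if_cong)
    finally show ?thesis .
  qed
  then show ?thesis by (simp add: frame_trace_def)
qed

lemma ex_local_orthonormal_frame:
  "\<exists>f. local_orthonormal_frame n M (\<phi> ` U) f"
proof -
  obtain \<psi> where \<psi>: "\<And>u. u \<in> U \<Longrightarrow> \<psi> (\<phi> u) = u" using \<phi>_image_inverse by blast
  define f where "f i q = e i (\<psi> q)" for i q
  have f\<phi>: "f i (\<phi> u) = e i u" if "u \<in> U" for i u using \<psi>[OF that] by (simp add: f_def)
  have "smooth_along M (\<phi> ` U) (\<lambda>q. f i q c)" for i c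
    unfolding smooth_along_def
  proof (intro ballI exI conjI)
    show "local_param M U \<phi>" by (rule param)
    show "smooth_on U ((\<lambda>q. f i q c) \<circ> \<phi>)"
      using asmooth_e[of i] smooth_on_cong[OF open_U, of "\<lambda>x. e i x c" "(\<lambda>q. f i q c) \<circ> \<phi>"] f\<phi>
      by (simp add: asmooth_def)
  qed auto
  moreover have "f i q \<in> tangent_space M q" if "q \<in> \<phi> ` U" for i q
    using that f\<phi> by (auto simp: e_def tangentI)
  moreover have "pip n (f i q) (f j q) = (if i = j then 1 else 0)" if "q \<in> \<phi> ` U" for i j q
  proof -
    obtain u where u: "u \<in> U" "q = \<phi> u" using \<open>q \<in> \<phi> ` U\<close> by blast
    show ?thesis using e_orthonormal[OF u(1), of i j] by (simp only: u(2) f\<phi>[OF u(1)])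
  qed
  ultimately have "local_orthonormal_frame n M (\<phi> ` U) f"
    unfolding local_orthonormal_frame_def tangent_field_def using openin_image by blast
  then show ?thesis by blast
qed

lemma mean_curvature_frame:
  assumes u: "u \<in> U"
  shows "mean_curvature n M (\<phi> u) = frame_trace u"
  unfolding mean_curvature_def
proof (rule the_equality)
  obtain f where f: "local_orthonormal_frame n M (\<phi> ` U) f" using ex_local_orthonormal_frame by blast
  show "\<exists>N f. \<phi> u \<in> N \<and> local_orthonormal_frame n M N f \<and> frame_trace u =
      (\<lambda>c. (\<Sum>i\<in>UNIV. second_fundamental_form n M (f i) (f i) (\<phi> u) c) / real CARD('m))"
  proof (intro exI conjI)
    show "\<phi> u \<in> \<phi> ` U" using u by blast
    then show "frame_trace u =
      (\<lambda>c. (\<Sum>i\<in>UNIV. second_fundamental_form n M (f i) (f i) (\<phi> u) c) / real CARD('m))"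
      by (rule frame_trace_unique[OF u _ f, symmetric])
  qed (rule f)
next
  fix \<eta>
  assume "\<exists>N f. \<phi> u \<in> N \<and> local_orthonormal_frame n M N f \<and> \<eta> =
      (\<lambda>c. (\<Sum>i\<in>UNIV. second_fundamental_form n M (f i) (f i) (\<phi> u) c) / real CARD('m))"
  then obtain N f where *: "\<phi> u \<in> N" "local_orthonormal_frame n M N f"
    "\<eta> = (\<lambda>c. (\<Sum>i\<in>UNIV. second_fundamental_form n M (f i) (f i) (\<phi> u) c) / real CARD('m))"
    by (elim exE conjE)
  show "\<eta> = frame_trace u" unfolding *(3) by (rule frame_trace_unique[OF u *(1,2)])
qed

text \<open>The inverse of the metric tensor.\<close>

definition P :: "real^'m \<Rightarrow> 'm \<Rightarrow> 'm \<Rightarrow> real" where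
  "P u k l = (\<Sum>j\<in>UNIV. A j u $ k * A j u $ l)"

abbreviation \<phi>1 :: "'m \<Rightarrow> real^'m \<Rightarrow> 'm ambient" where
  "\<phi>1 k \<equiv> apd (axis k 1) \<phi>"

abbreviation \<phi>2 :: "'m \<Rightarrow> 'm \<Rightarrow> real^'m \<Rightarrow> 'm ambient" where
  "\<phi>2 k l \<equiv> apd (axis k 1) (apd (axis l 1) \<phi>)"

lemma asmooth_\<phi>1: "asmooth U (\<phi>1 k)" and asmooth_\<phi>2: "asmooth U (\<phi>2 k l)"
  by (intro asmooth_apd asmooth_\<phi>)+

lemma \<phi>1_pseudo_space: "u \<in> U \<Longrightarrow> \<phi>1 k u \<in> pseudo_space n"
  by (rule apd_\<phi>_pseudo_space)

lemma \<phi>2_pseudo_space: "u \<in> U \<Longrightarrow> \<phi>2 k l u \<in> pseudo_space n"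
  by (rule apd_pseudo_space[OF open_U]) (auto intro: \<phi>1_pseudo_space)

lemma smooth_P: "smooth_on U (\<lambda>u. P u k l)"
  unfolding P_def by (intro smooth_on_sum smooth_on_mult open_U A_smooth)

lemma P_inverse_metric:
  assumes u: "u \<in> U"
  shows "(\<Sum>l\<in>UNIV. pip n (\<phi>1 k u) (\<phi>1 l u) * P u l r) = (if k = r then 1 else 0)"
proof -
  have "(axis k 1 :: real^'m) $ r = (\<Sum>j\<in>UNIV. pip n (\<phi>1 k u) (e j u) * A j u $ r)"
    using arg_cong[OF coefficient_expansion[OF u, of "axis k 1"], of "\<lambda>v. v $ r"] by simp
  also have "\<dots> = (\<Sum>j\<in>UNIV. \<Sum>l\<in>UNIV. pip n (\<phi>1 k u) (\<phi>1 l u) * (A j u $ l * A j u $ r))"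
    unfolding e_def
    by (subst apd_\<phi>_expand[OF u, of "A _ u"]) (simp add: pip_lincomb_right sum_distrib_left sum_distrib_right mult_ac)
  also have "\<dots> = (\<Sum>l\<in>UNIV. pip n (\<phi>1 k u) (\<phi>1 l u) * P u l r)"
    by (subst sum.swap) (simp add: P_def sum_distrib_left)
  finally show ?thesis by (auto simp: axis_def)
qed

text \<open>The trace of the coordinate Hessian of the position vector with respect to the metric. Its normal part is
  \<open>m\<close> times the mean curvature; the Christoffel terms that would turn it into the Laplacian are tangent.\<close>

definition trace2 :: "real^'m \<Rightarrow> 'm ambient" where
  "trace2 u = (\<lambda>c. \<Sum>k\<in>UNIV. \<Sum>l\<in>UNIV. P u k l * \<phi>2 k l u c)"

lemma mean_curvature_coord:
  assumes u: "u \<in> U"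
  shows "mean_curvature n M (\<phi> u) = (\<lambda>c. nu u (trace2 u) c / real CARD('m))"
proof -
  have 1: "nu u (apd (A j u) (e j) u) = (\<lambda>c. \<Sum>l\<in>UNIV. \<Sum>k\<in>UNIV. A j u $ k * A j u $ l * nu u (\<phi>2 k l u) c)" for j
  proof -
    have "apd (A j u) (e j) u = apd (A j u) (\<lambda>x c. \<Sum>l\<in>UNIV. A j x $ l * \<phi>1 l x c) u"
      unfolding e_def by (rule apd_cong_open(2)[OF open_U u apd_\<phi>_expand])
    also have "\<dots> = (\<lambda>c. (\<Sum>l\<in>UNIV. A j u $ l * apd (A j u) (\<phi>1 l) u c) + (\<Sum>l\<in>UNIV. pd (A j u) (\<lambda>x. A j x $ l) u * \<phi>1 l u c))"
      using u by (intro apd_lincomb smooth_on_differentiable[OF A_smooth] asmooth_adiff[OF asmooth_\<phi>1])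
    finally have "nu u (apd (A j u) (e j) u) = (\<lambda>c. \<Sum>l\<in>UNIV. A j u $ l * nu u (apd (A j u) (\<phi>1 l) u) c)"
      by (simp only: nu_add nu_lincomb nu_tangent[OF u]) simp
    then show ?thesis
      unfolding apd_expand[OF asmooth_adiff[OF asmooth_\<phi>1 u], of "A j u"] nu_lincomb
      by (simp add: sum_distrib_left mult_ac)
  qed
  have "(\<Sum>j\<in>UNIV. nu u (apd (A j u) (e j) u) c) = nu u (trace2 u) c" for c
  proof -
    have "(\<Sum>j\<in>UNIV. nu u (apd (A j u) (e j) u) c) =
        (\<Sum>k\<in>UNIV. \<Sum>l\<in>UNIV. \<Sum>j\<in>UNIV. A j u $ k * A j u $ l * nu u (\<phi>2 k l u) c)"
      unfolding 1 by (rule trans[OF sum_rotate sum.swap])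
    also have "\<dots> = (\<Sum>k\<in>UNIV. \<Sum>l\<in>UNIV. P u k l * nu u (\<phi>2 k l u) c)"
      by (simp add: P_def sum_distrib_right)
    also have "\<dots> = nu u (trace2 u) c"
      using nu_lincomb[where u=u and I=UNIV and a="\<lambda>_. 1" and E="\<lambda>k c. \<Sum>l\<in>UNIV. P u k l * \<phi>2 k l u c"]
      by (simp add: trace2_def nu_lincomb)
    finally show ?thesis .
  qed
  then show ?thesis by (simp add: mean_curvature_frame[OF u] frame_trace_def)
qed

lemma smooth_trace2: "asmooth U trace2"
  unfolding trace2_def[abs_def] asmooth_def
  using asmooth_\<phi>2 by (intro allI smooth_on_sum smooth_on_mult open_U smooth_P) (simp add: asmooth_def)

lemma trace2_pseudo_space: "u \<in> U \<Longrightarrow> trace2 u \<in> pseudo_space n"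
  unfolding trace2_def by (intro pseudo_space_sum pseudo_space_scale \<phi>2_pseudo_space)

end



section \<open>Normal coordinates\<close>

text \<open>Coordinates that are normal at \<open>u0\<close>: the metric is standard there, and its first derivatives vanish
  because the second derivatives of the parametrization are normal vectors.\<close>

locale normal_chart = framed_chart n M U \<phi> A
  for n and M :: "'m::finite ambient set" and U \<phi> A +
  fixes u0 :: "real^'m"
  assumes u0: "u0 \<in> U"
    and coord_orthonormal: "pip n (\<phi>1 k u0) (\<phi>1 l u0) = (if k = l then 1 else 0)"
    and christoffel_zero: "pip n (\<phi>2 k l u0) (\<phi>1 j u0) = 0"
begin

lemma normal_iff_coord: "(\<forall>v. pip n \<nu> (apd v \<phi> u0) = 0) \<longleftrightarrow> (\<forall>j. pip n \<nu> (\<phi>1 j u0) = 0)"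
proof
  assume *: "\<forall>j. pip n \<nu> (\<phi>1 j u0) = 0"
  show "\<forall>v. pip n \<nu> (apd v \<phi> u0) = 0"
    by (subst apd_\<phi>_expand[OF u0]) (simp add: pip_lincomb_right *)
qed simp

lemma P_at_u0: "P u0 k l = (if k = l then 1 else 0)"
proof -
  have "(\<Sum>j\<in>UNIV. pip n (\<phi>1 k u0) (\<phi>1 j u0) * P u0 j l) = (\<Sum>j\<in>UNIV. if k = j then P u0 j l else 0)"
    by (intro sum.cong) (auto simp: coord_orthonormal)
  then show ?thesis using P_inverse_metric[OF u0, of k l] by simp
qed

lemma pd_metric_zero: "pd (axis i 1) (\<lambda>x. pip n (\<phi>1 k x) (\<phi>1 l x)) u0 = 0"
  using pd_pip(2)[OF asmooth_adiff[OF asmooth_\<phi>1 u0] asmooth_adiff[OF asmooth_\<phi>1 u0]]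
    christoffel_zero pip_commute[of n "\<phi>1 k u0"] by simp

lemma pd_P_zero: "pd (axis i 1) (\<lambda>x. P x k l) u0 = 0"
proof -
  have dP: "(\<lambda>x. P x j l) differentiable (at u0)" for j l
    by (rule smooth_on_differentiable[OF smooth_P u0])
  have dG: "(\<lambda>x. pip n (\<phi>1 k x) (\<phi>1 j x)) differentiable (at u0)" for k j
    by (rule pd_pip(1)[OF asmooth_adiff[OF asmooth_\<phi>1 u0] asmooth_adiff[OF asmooth_\<phi>1 u0]])
  have "0 = pd (axis i 1) (\<lambda>x. if k = l then 1 else 0) u0" by (simp add: pd_const)
  also have "\<dots> = pd (axis i 1) (\<lambda>x. \<Sum>j\<in>UNIV. pip n (\<phi>1 k x) (\<phi>1 j x) * P x j l) u0"
    by (rule pd_cong_open(2)[OF open_U u0]) (simp add: P_inverse_metric)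
  also have "\<dots> = (\<Sum>j\<in>UNIV. pd (axis i 1) (\<lambda>x. pip n (\<phi>1 k x) (\<phi>1 j x) * P x j l) u0)"
    by (intro pd_sum differentiable_mult dG dP)
  also have "\<dots> = (\<Sum>j\<in>UNIV. if k = j then pd (axis i 1) (\<lambda>x. P x j l) u0 else 0)"
    by (intro sum.cong) (auto simp: pd_mult[OF dG dP] pd_metric_zero coord_orthonormal)
  finally show ?thesis by simp
qed

lemma trace2_at_u0: "trace2 u0 = (\<lambda>c. \<Sum>k\<in>UNIV. \<phi>2 k k u0 c)"
  unfolding trace2_def by (rule ext) (simp add: P_at_u0 if_distrib[of "\<lambda>x. x * _"] cong: if_cong)

lemma trace2_normal: "pip n (trace2 u0) (e j u0) = 0"
proof -
  have "\<forall>j. pip n (trace2 u0) (\<phi>1 j u0) = 0"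
    by (simp add: trace2_at_u0 pip_sum_left christoffel_zero)
  then show ?thesis using normal_iff_coord normal_iff_e[OF u0] by blast
qed

lemma mean_curvature_at_u0:
  "mean_curvature n M (\<phi> u0) = (\<lambda>c. (\<Sum>k\<in>UNIV. \<phi>2 k k u0 c) / real CARD('m))"
  unfolding mean_curvature_coord[OF u0] nu_def trace2_normal by (simp add: trace2_at_u0)

text \<open>Near \<open>u0\<close> the vector field \<open>m H\<close> is \<open>trace2\<close> minus its tangential part. Differentiate at \<open>u0\<close> and pair with a normal
  vector: the derivative of the inverse metric vanishes in normal coordinates, and the tangential part contributes
  nothing because its coefficients vanish at \<open>u0\<close> and frame vectors are orthogonal to \<open>\<nu>\<close>. What is left is the third
  derivative of the parametrization. This takes the place of the Codazzi equation.\<close>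

lemma parallel_third_derivative:
  assumes par: "parallel_mean_curvature n M"
    and \<nu>: "\<And>j. pip n \<nu> (\<phi>1 j u0) = 0"
  shows "(\<Sum>k\<in>UNIV. pip n \<nu> (apd (axis i 1) (\<phi>2 k k) u0)) = 0"
proof -
  define v :: "real^'m" where "v = axis i 1"
  have \<nu>e: "pip n \<nu> (e j u0) = 0" for j using \<nu> normal_iff_coord normal_iff_e[OF u0] by blast
  define h where "h j x = pip n (trace2 x) (e j x)" for j x
  have adT: "adiff trace2 u0" by (rule asmooth_adiff[OF smooth_trace2 u0])
  have hs: "smooth_on U (h j)" for j
    unfolding h_def[abs_def] by (intro smooth_on_pip open_U smooth_trace2 asmooth_e)
  have hd: "h j differentiable (at u0)" for j by (rule smooth_on_differentiable[OF hs u0])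
  have h0: "h j u0 = 0" for j by (simp add: h_def trace2_normal)
  define m where "m = real CARD('m)"
  have m: "m \<noteq> 0" by (simp add: m_def)
  define S where "S x = (\<lambda>c. \<Sum>j\<in>UNIV. h j x * e j x c)" for x
  have Ss: "asmooth U S" unfolding S_def[abs_def] by (intro asmooth_lincomb open_U hs asmooth_e)
  have Hloc: "mean_curvature n M (\<phi> x) = (\<lambda>c. (1 / m) * (trace2 x c - S x c))" if "x \<in> U" for x
    unfolding mean_curvature_coord[OF that] nu_def by (simp add: m_def S_def h_def)
  define R where "R x = (\<lambda>c. (1 / m) * (trace2 x c - S x c))" for x
  have Rs: "asmooth U R" unfolding R_def[abs_def]
    by (intro asmooth_scale asmooth_diff open_U smooth_trace2 Ss smooth_on_const)
  have ad: "adiff (\<lambda>x. mean_curvature n M (\<phi> x)) u0"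
    and apdH: "apd v (\<lambda>x. mean_curvature n M (\<phi> x)) u0 = apd v R u0"
    using apd_cong_open[OF open_U u0, of "\<lambda>x. mean_curvature n M (\<phi> x)" R] Hloc asmooth_adiff[OF Rs u0]
    by (auto simp: R_def)
  have Rps: "R x \<in> pseudo_space n" if "x \<in> U" for x
    unfolding R_def S_def using that
    by (intro pseudo_space_scale pseudo_space_diff pseudo_space_lincomb trace2_pseudo_space e_pseudo_space)
  have "normal_conn n M (mean_curvature n M) (\<phi> u0) (apd v \<phi> u0) = (\<lambda>_. 0)"
    using par \<phi>_in_M[OF u0] tangentI[OF u0] by (simp add: parallel_mean_curvature_def)
  then have "nu u0 (apd v R u0) = (\<lambda>_. 0)"
    unfolding normal_conn_def flat_conn_eq[OF u0 ad] apdH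
    using normal_part_eq[OF u0 apd_pseudo_space[OF open_U u0 Rps]] by simp
  then have "apd v R u0 = (\<lambda>c. \<Sum>j\<in>UNIV. pip n (apd v R u0) (e j u0) * e j u0 c)"
    by (simp add: nu_def fun_eq_iff)
  then have "pip n \<nu> (apd v R u0) = pip n \<nu> (\<lambda>c. \<Sum>j\<in>UNIV. pip n (apd v R u0) (e j u0) * e j u0 c)"
    by (rule arg_cong)
  then have z: "pip n \<nu> (apd v R u0) = 0" by (simp add: pip_lincomb_right \<nu>e)
  have dT: "(\<lambda>x. trace2 x c) differentiable (at u0)" "(\<lambda>x. S x c) differentiable (at u0)" for c
    using adT asmooth_adiff[OF Ss u0] by (auto simp: adiff_def)
  have R': "apd v R u0 = (\<lambda>c. (1 / m) * (apd v trace2 u0 c - apd v S u0 c))"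
    unfolding apd_def R_def
    by (rule ext, subst pd_cmult) (auto intro: dT differentiable_diff simp: pd_diff[OF dT])
  have 1: "pip n \<nu> (apd v trace2 u0) = pip n \<nu> (apd v S u0)"
    using z m unfolding R' pip_scale_right pip_diff_right by simp
  have "apd v S u0 = (\<lambda>c. (\<Sum>j\<in>UNIV. h j u0 * apd v (e j) u0 c) + (\<Sum>j\<in>UNIV. pd v (h j) u0 * e j u0 c))"
    unfolding S_def by (intro apd_lincomb hd adiff_e[OF u0])
  then have 2: "pip n \<nu> (apd v S u0) = 0"
    by (simp add: pip_add_right pip_lincomb_right \<nu>e h0 pip_zero_right)
  have dP: "(\<lambda>x. P x k l) differentiable (at u0)" for k l
    by (rule smooth_on_differentiable[OF smooth_P u0])
  \<comment> \<open>The double sum over indices is one sum over pairs, to which the product rule for linear combinations applies.\<close>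
  have T: "trace2 x = (\<lambda>c. \<Sum>q\<in>UNIV. P x (fst q) (snd q) * \<phi>2 (fst q) (snd q) x c)" for x
    by (simp add: trace2_def sum.cartesian_product case_prod_unfold)
  have "apd v trace2 u0 = (\<lambda>c. (\<Sum>q\<in>UNIV. P u0 (fst q) (snd q) * apd v (\<phi>2 (fst q) (snd q)) u0 c)
      + (\<Sum>q\<in>UNIV. pd v (\<lambda>x. P x (fst q) (snd q)) u0 * \<phi>2 (fst q) (snd q) u0 c))"
    unfolding T[abs_def] by (intro apd_lincomb dP asmooth_adiff[OF asmooth_\<phi>2 u0])
  then have "apd v trace2 u0 = (\<lambda>c. \<Sum>q\<in>UNIV. P u0 (fst q) (snd q) * apd v (\<phi>2 (fst q) (snd q)) u0 c)"
    by (simp add: v_def pd_P_zero)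
  then have "pip n \<nu> (apd v trace2 u0) = (\<Sum>q\<in>UNIV. P u0 (fst q) (snd q) * pip n \<nu> (apd v (\<phi>2 (fst q) (snd q)) u0))"
    by (simp add: pip_lincomb_right)
  also have "\<dots> = (\<Sum>k\<in>UNIV. \<Sum>l\<in>UNIV. P u0 k l * pip n \<nu> (apd v (\<phi>2 k l) u0))"
    by (simp add: sum.cartesian_product case_prod_unfold)
  also have "\<dots> = (\<Sum>k\<in>UNIV. pip n \<nu> (apd v (\<phi>2 k k) u0))"
    by (simp add: P_at_u0 if_distrib[of "\<lambda>x. x * _"] cong: if_cong)
  finally show ?thesis using 1 2 by (simp add: v_def)
qed

end

context spacelike_chart
begin

text \<open>The geometric conditions on a parametrization survive composition with an injective smooth immersion
  between open sets of coordinates that is a homeomorphism onto its image.\<close>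

lemma reparametrization:
  assumes hom: "homeomorphism V V' p g" and opV: "open V" "open V'" and sub: "V' \<subseteq> U"
    and smooth: "\<And>b. b \<in> Basis \<Longrightarrow> smooth_on V (\<lambda>x. p x \<bullet> b)"
    and der: "\<And>x. x \<in> V \<Longrightarrow> (p has_derivative p' x) (at x)" and inj: "\<And>x v. x \<in> V \<Longrightarrow> p' x v = 0 \<Longrightarrow> v = 0"
  shows "local_param M V (\<lambda>x. \<phi> (p x))"
proof -
  have pV: "p ` V = V'" using hom by (simp add: homeomorphism_def)
  have im: "(\<lambda>x. \<phi> (p x)) ` V = \<phi> ` V'" using pV by auto
  obtain \<psi> where \<psi>: "homeomorphism U (\<phi> ` U) \<phi> \<psi>" using homeo by blast
  have "openin (top_of_set (\<phi> ` U)) (\<phi> ` V')"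
    using homeomorphism_imp_open_map[OF \<psi>] opV(2) sub by (simp add: openin_open_eq[OF open_U])
  then have op: "openin (top_of_set M) (\<phi> ` V')" using openin_image openin_trans by blast
  have "homeomorphism V' (\<phi> ` V') \<phi> \<psi>" using homeomorphism_of_subsets[OF \<psi> sub] by blast
  then have "homeomorphism V (\<phi> ` V') (\<phi> \<circ> p) (g \<circ> \<psi>)" by (rule homeomorphism_compose[OF hom])
  then have hom': "\<exists>\<psi>. homeomorphism V (\<phi> ` V') (\<lambda>x. \<phi> (p x)) \<psi>" by (auto simp: o_def)
  have sm: "smooth_on V (\<lambda>x. \<phi> (p x) c)" for c
    using asmooth_\<phi> pV sub by (intro smooth_on_compose[OF opV(1) open_U _ smooth]) (auto simp: asmooth_def)
  have "v = 0" if "x \<in> V" "apd v (\<lambda>x. \<phi> (p x)) x = (\<lambda>_. 0)" for x v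
  proof -
    have px: "p x \<in> U" using that(1) pV sub by auto
    have "apd (p' x v) \<phi> (p x) = (\<lambda>_. 0)"
      using apd_compose(2)[OF der[OF that(1)] adiff_\<phi>[OF px]] that(2) by simp
    then show ?thesis using immersed[OF px] inj[OF that(1)] by blast
  qed
  then show ?thesis
    unfolding local_param_def ambient_deriv_eq_apd using opV(1) sm op hom' im by simp
qed

text \<open>A quadratic map with invertible linear part \<open>a\<close> and prescribed symmetric second derivatives \<open>q\<close> is a
  diffeomorphism near \<open>0\<close> by the inverse function theorem.\<close>

lemma ex_quadratic_reparametrization:
  assumes u: "u \<in> U" and a: "\<And>v. v = (\<Sum>k\<in>UNIV. L v k *\<^sub>R a k)" and q: "\<And>k l. q k l = q l k"
  obtains V p where "local_param M V (\<lambda>x. \<phi> (p x))" "0 \<in> V" "open V" "p 0 = u" "p ` V \<subseteq> U"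
    "\<And>x. (p has_derivative (\<lambda>v. \<Sum>k\<in>UNIV. v $ k *\<^sub>R (a k + (\<Sum>l\<in>UNIV. x $ l *\<^sub>R q k l)))) (at x)"
proof -
  define p where "p x = u + (\<Sum>k\<in>UNIV. x $ k *\<^sub>R a k) + (1/2) *\<^sub>R (\<Sum>k\<in>UNIV. \<Sum>l\<in>UNIV. (x $ k * x $ l) *\<^sub>R q k l)"
    for x :: "real^'m"
  define D where "D x v = (\<Sum>k\<in>UNIV. v $ k *\<^sub>R (a k + (\<Sum>l\<in>UNIV. x $ l *\<^sub>R q k l)))" for x v :: "real^'m"
  have der: "(p has_derivative D x) (at x)" for x
  proof -
    have "(p has_derivative (\<lambda>v. (\<Sum>k\<in>UNIV. v $ k *\<^sub>R a k) +
        (1/2) *\<^sub>R (\<Sum>k\<in>UNIV. \<Sum>l\<in>UNIV. (x $ k * v $ l + v $ k * x $ l) *\<^sub>R q k l))) (at x)"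
      unfolding p_def
      by (auto intro!: derivative_eq_intros bounded_linear_imp_has_derivative bounded_linear_vec_nth)
    moreover have "(\<Sum>k\<in>UNIV. v $ k *\<^sub>R a k) +
        (1/2) *\<^sub>R (\<Sum>k\<in>UNIV. \<Sum>l\<in>UNIV. (x $ k * v $ l + v $ k * x $ l) *\<^sub>R q k l) = D x v" for v
    proof -
      have "(\<Sum>k\<in>UNIV. \<Sum>l\<in>UNIV. (x $ k * v $ l) *\<^sub>R q k l) = (\<Sum>k\<in>UNIV. \<Sum>l\<in>UNIV. (v $ k * x $ l) *\<^sub>R q k l)"
        by (subst sum.swap) (simp add: mult.commute q)
      then have "(\<Sum>k\<in>UNIV. \<Sum>l\<in>UNIV. (x $ k * v $ l + v $ k * x $ l) *\<^sub>R q k l) =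
          2 *\<^sub>R (\<Sum>k\<in>UNIV. \<Sum>l\<in>UNIV. (v $ k * x $ l) *\<^sub>R q k l)"
        by (simp add: scaleR_add_left sum.distrib scaleR_2)
      then show ?thesis
        by (simp add: D_def scaleR_add_right sum.distrib scaleR_sum_right)
    qed
    ultimately show ?thesis by simp
  qed
  have blD: "bounded_linear (D x)" for x using der has_derivative_bounded_linear by blast
  define Dl where "Dl x = Blinfun (D 0) + (\<Sum>l\<in>UNIV. x $ l *\<^sub>R Blinfun (\<lambda>v. \<Sum>k\<in>UNIV. v $ k *\<^sub>R q k l))" for x :: "real^'m"
  have blq: "bounded_linear (\<lambda>v. \<Sum>k\<in>UNIV. (v::real^'m) $ k *\<^sub>R q k l)" for l
    by (intro bounded_linear_sum bounded_linear_scaleR_const bounded_linear_vec_nth)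
  have Dl: "blinfun_apply (Dl x) = D x" for x
  proof
    fix v
    have "(\<Sum>k\<in>UNIV. \<Sum>l\<in>UNIV. v $ k *\<^sub>R x $ l *\<^sub>R q k l) = (\<Sum>l\<in>UNIV. \<Sum>k\<in>UNIV. x $ l *\<^sub>R v $ k *\<^sub>R q k l)"
      by (subst sum.swap) (simp add: mult.commute)
    then show "blinfun_apply (Dl x) v = D x v"
      by (simp add: Dl_def plus_blinfun.rep_eq blinfun.sum_left scaleR_blinfun.rep_eq
          bounded_linear_Blinfun_apply[OF blD] bounded_linear_Blinfun_apply[OF blq] D_def
          scaleR_add_right sum.distrib scaleR_sum_right)
  qed
  have contDl: "continuous_on X Dl" for X
    unfolding Dl_def by (intro continuous_intros)
  have surjD: "surj (D 0)"
  proof (rule surjI)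
    show "D 0 (\<chi> k. L v k) = v" for v by (simp add: D_def a[symmetric])
  qed
  have linD: "linear (D 0)" using blD bounded_linear.linear by blast
  obtain G where G: "linear G" "G \<circ> D 0 = id"
    using linear_injective_left_inverse[OF linD] linear_surjective_imp_injective[OF linD surjD] by blast
  have "bounded_linear G" using G(1) linear_conv_bounded_linear by blast
  then have inv: "Blinfun G o\<^sub>L Dl 0 = id_blinfun"
    using G(2) by (intro blinfun_eqI) (simp add: bounded_linear_Blinfun_apply Dl fun_eq_iff)
  define S where "S = p -` U"
  have contp: "continuous_on UNIV p"
    using der has_derivative_continuous by (simp add: continuous_on_eq_continuous_at) blast
  have "open S" unfolding S_def using contp open_U open_vimage by blast
  have p0: "p 0 = u" by (simp add: p_def)
  have "0 \<in> S" using p0 u by (simp add: S_def)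
  obtain V V' g g' where V: "open V" "V \<subseteq> S" "0 \<in> V" "open V'" "p 0 \<in> V'" "homeomorphism V V' p g"
    "\<And>y. y \<in> V' \<Longrightarrow> bij (blinfun_apply (Dl (g y)))"
  proof (rule inverse_function_theorem[OF \<open>open S\<close> _ contDl \<open>0 \<in> S\<close> inv])
    show "(p has_derivative blinfun_apply (Dl x)) (at x)" for x unfolding Dl by (rule der)
  qed metis
  have pV: "p ` V = V'" and gp: "\<And>x. x \<in> V \<Longrightarrow> g (p x) = x" using V(6) by (auto simp: homeomorphism_def)
  have sub: "V' \<subseteq> U" using pV V(2) by (auto simp: S_def)
  have inj: "v = 0" if "x \<in> V" "D x v = 0" for x v
  proof -
    have "bij (D x)" using V(7)[of "p x"] gp[OF that(1)] pV that(1) by (auto simp: Dl)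
    moreover have "D x 0 = 0" by (simp add: D_def)
    ultimately show ?thesis using that(2) by (metis bij_is_inj injD)
  qed
  have smooth: "smooth_on V (\<lambda>x. p x \<bullet> b)" for b
  proof -
    have x: "smooth_on V (\<lambda>x. x $ k)" for k by (rule smooth_on_linear[OF bounded_linear_vec_nth])
    have "p x \<bullet> b = u \<bullet> b + (\<Sum>k\<in>UNIV. x $ k * (a k \<bullet> b)) + (1/2) * (\<Sum>k\<in>UNIV. \<Sum>l\<in>UNIV. (x $ k * x $ l) * (q k l \<bullet> b))" for x
      by (simp add: p_def inner_add_left inner_sum_left)
    then show ?thesis
      by (simp only:) (intro smooth_on_add smooth_on_mult smooth_on_sum smooth_on_const x V(1))
  qed
  have "local_param M V (\<lambda>x. \<phi> (p x))"
    by (rule reparametrization[OF V(6,1,4) sub smooth der inj])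
  then show ?thesis
    by (rule that) (use V(1,3) p0 pV sub der in \<open>auto simp: D_def[abs_def]\<close>)
qed

end

context framed_chart
begin

text \<open>The linear part of the coordinate change makes the coordinate vectors at \<open>0\<close> the frame vectors; the second derivatives \<open>q k l\<close> are
  chosen so that their image under the differential of \<open>\<phi>\<close> cancels the tangential part of the second derivatives.\<close>

lemma ex_normal_coordinates:
  assumes u: "u \<in> U"
  obtains V \<rho> where "local_param M V \<rho>" "0 \<in> V" "\<rho> 0 = \<phi> u"
    "\<And>k l. pip n (apd (axis k 1) \<rho> 0) (apd (axis l 1) \<rho> 0) = (if k = l then 1 else 0)"
    "\<And>k l j. pip n (apd (axis k 1) (apd (axis l 1) \<rho>) 0) (apd (axis j 1) \<rho> 0) = 0"
proof -
  define a where "a k = A k u" for k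
  define B where "B k l = apd (a k) (apd (a l) \<phi>) u" for k l
  define q where "q k l = - (\<Sum>j\<in>UNIV. pip n (B k l) (e j u) *\<^sub>R a j)" for k l
  have Bsym: "B k l = B l k" for k l
    unfolding B_def apd_def using asmooth_\<phi> by (intro ext pd_commute[OF open_U u]) (simp add: asmooth_def)
  have qsym: "q k l = q l k" for k l by (simp add: q_def Bsym)
  obtain V p where V: "local_param M V (\<lambda>x. \<phi> (p x))" "0 \<in> V" "open V" "p 0 = u" "p ` V \<subseteq> U"
    "\<And>x. (p has_derivative (\<lambda>v. \<Sum>k\<in>UNIV. v $ k *\<^sub>R (a k + (\<Sum>l\<in>UNIV. x $ l *\<^sub>R q k l)))) (at x)"
  proof (rule ex_quadratic_reparametrization[where u=u and a=a and q=q
        and L="\<lambda>v j. pip n (apd v \<phi> u) (e j u)"])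
    show "v = (\<Sum>k\<in>UNIV. pip n (apd v \<phi> u) (e k u) *\<^sub>R a k)" for v
      unfolding a_def by (rule coefficient_expansion[OF u])
  qed (rule u, rule qsym, rule that)
  define \<rho> where "\<rho> x = \<phi> (p x)" for x
  have lin: "linear (\<lambda>v. apd v \<phi> x c)" if "x \<in> U" for x c by (rule linear_apd_\<phi>[OF that])
  have d1: "apd (axis k 1) \<rho> x = (\<lambda>c. apd (a k) \<phi> (p x) c + (\<Sum>l\<in>UNIV. x $ l * apd (q k l) \<phi> (p x) c))"
    if "x \<in> V" for x k
  proof -
    have px: "p x \<in> U" using that V(5) by auto
    have ax: "(\<Sum>i\<in>UNIV. axis k (1::real) $ i *\<^sub>R w i) = w k" for w :: "'m \<Rightarrow> real^'m"
      by (simp add: axis_def if_distrib[of "\<lambda>r. r *\<^sub>R _"] cong: if_cong)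
    have "apd (axis k 1) \<rho> x = apd (a k + (\<Sum>l\<in>UNIV. x $ l *\<^sub>R q k l)) \<phi> (p x)"
      unfolding \<rho>_def apd_compose(2)[OF V(6) adiff_\<phi>[OF px]] ax ..
    then show ?thesis
      by (intro ext) (simp add: linear_add[OF lin[OF px]] linear_sum[OF lin[OF px]]
        linear_scale[OF lin[OF px], unfolded real_scaleR_def])
  qed
  have e: "apd (axis k 1) \<rho> 0 = e k u" for k
    unfolding d1[OF V(2)] using V(4) by (simp add: e_def a_def)
  have d2: "apd (axis k 1) (apd (axis l 1) \<rho>) 0 = (\<lambda>c. B k l c - (\<Sum>j\<in>UNIV. pip n (B k l) (e j u) * e j u c))" for k l
  proof
    fix c
    have p0: "p 0 \<in> U" using u V(4) by simp
    have dp: "(\<lambda>x. apd v \<phi> (p x) c) differentiable (at 0)"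
      and pdp: "pd w (\<lambda>x. apd v \<phi> (p x) c) 0 = apd (\<Sum>k\<in>UNIV. w $ k *\<^sub>R a k) (apd v \<phi>) u c" for v w
      using apd_compose[OF V(6)[of 0], of "apd v \<phi>"] asmooth_adiff[OF asmooth_apd[OF asmooth_\<phi>] p0] V(4)
      by (simp_all add: adiff_def apd_def[of _ "\<lambda>x. apd v \<phi> (p x)"] apd_def[of _ "apd v \<phi>"] fun_eq_iff)
    have hx: "((\<lambda>x::real^'m. x $ j) has_derivative (\<lambda>v. v $ j)) (at 0)" for j
      by (rule bounded_linear_imp_has_derivative[OF bounded_linear_vec_nth])
    have dx: "(\<lambda>x::real^'m. x $ j) differentiable (at 0)" for j
      using hx by (auto simp: differentiable_def)
    have pdx: "pd w (\<lambda>x::real^'m. x $ j) 0 = w $ j" for j w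
      by (rule pd_eqI[OF hx])
    have dxp: "(\<lambda>x. x $ j * apd v \<phi> (p x) c) differentiable (at 0)" for j v
      by (intro differentiable_mult dx dp)
    have "apd (axis k 1) (apd (axis l 1) \<rho>) 0 c =
        pd (axis k 1) (\<lambda>x. apd (a l) \<phi> (p x) c + (\<Sum>j\<in>UNIV. x $ j * apd (q l j) \<phi> (p x) c)) 0"
      unfolding apd_def[of _ "apd (axis l 1) \<rho>"] by (rule pd_cong_open(2)[OF V(3,2)]) (simp add: d1)
    also have "\<dots> = pd (axis k 1) (\<lambda>x. apd (a l) \<phi> (p x) c) 0 +
        (\<Sum>j\<in>UNIV. pd (axis k 1) (\<lambda>x. x $ j * apd (q l j) \<phi> (p x) c) 0)"
      by (subst pd_add) (auto intro!: dp dxp differentiable_sum simp: pd_sum[OF dxp])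
    also have "pd (axis k 1) (\<lambda>x. apd (a l) \<phi> (p x) c) 0 = B k l c"
      by (simp add: pdp B_def axis_def if_distrib[of "\<lambda>r. r *\<^sub>R _"] cong: if_cong)
    also have "(\<Sum>j\<in>UNIV. pd (axis k 1) (\<lambda>x. x $ j * apd (q l j) \<phi> (p x) c) 0) = apd (q l k) \<phi> u c"
      by (simp add: pd_mult[OF dx dp] pdx V(4) axis_def if_distrib[of "\<lambda>r. r * _"] cong: if_cong)
    also have "apd (q l k) \<phi> u c = - (\<Sum>j\<in>UNIV. pip n (B k l) (e j u) * e j u c)"
      unfolding q_def Bsym[of l k] linear_neg[OF lin[OF u]] linear_sum[OF lin[OF u]]
      by (simp add: linear_scale[OF lin[OF u], unfolded real_scaleR_def] e_def a_def)
    finally show "apd (axis k 1) (apd (axis l 1) \<rho>) 0 c = B k l c - (\<Sum>j\<in>UNIV. pip n (B k l) (e j u) * e j u c)"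
      by simp
  qed
  show ?thesis
  proof (rule that[of V \<rho>])
    show "local_param M V \<rho>" using V(1) by (simp add: \<rho>_def[abs_def])
    show "\<rho> 0 = \<phi> u" by (simp add: \<rho>_def V(4))
    show "pip n (apd (axis k 1) \<rho> 0) (apd (axis l 1) \<rho> 0) = (if k = l then 1 else 0)" for k l
      by (simp add: e e_orthonormal[OF u])
    show "pip n (apd (axis k 1) (apd (axis l 1) \<rho>) 0) (apd (axis j 1) \<rho> 0) = 0" for k l j
      unfolding d2 e using nu_normal[OF u, of "B k l" j] by (simp add: nu_def)
  qed (rule V(2))
qed

end

lemma ex_normal_chart:
  fixes M :: "'m::finite ambient set"
  assumes "spacelike_submanifold n M" "p \<in> M"
  obtains U \<phi> A u0 where "normal_chart n M U \<phi> A u0" "\<phi> u0 = p"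
proof -
  have "\<exists>U \<phi>. local_param M U \<phi> \<and> p \<in> \<phi> ` U"
    using assms by (simp add: spacelike_submanifold_def submanifold_def)
  then obtain U \<phi> where "local_param M U \<phi>" "p \<in> \<phi> ` U" by blast
  then obtain u where U: "local_param M U \<phi>" "u \<in> U" "\<phi> u = p" by auto
  interpret c: spacelike_chart n M U \<phi> using assms U by unfold_locales
  obtain A :: "'m \<Rightarrow> real^'m \<Rightarrow> real^'m" where "framed_chart n M U \<phi> A"
    using c.ex_orthonormal_coefficients unfolding framed_chart_def framed_chart_axioms_def
    using c.spacelike_chart_axioms by blast
  then interpret f: framed_chart n M U \<phi> A .
  obtain V \<rho> where V: "local_param M V \<rho>" "0 \<in> V" "\<rho> 0 = \<phi> u"
    "\<And>k l. pip n (apd (axis k 1) \<rho> 0) (apd (axis l 1) \<rho> 0) = (if k = l then 1 else 0)"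
    "\<And>k l j. pip n (apd (axis k 1) (apd (axis l 1) \<rho>) 0) (apd (axis j 1) \<rho> 0) = 0"
    using f.ex_normal_coordinates[OF U(2)] by blast
  interpret c': spacelike_chart n M V \<rho> using assms V by unfold_locales
  obtain A' :: "'m \<Rightarrow> real^'m \<Rightarrow> real^'m" where "framed_chart n M V \<rho> A'"
    using c'.ex_orthonormal_coefficients unfolding framed_chart_def framed_chart_axioms_def
    using c'.spacelike_chart_axioms by blast
  then have "normal_chart n M V \<rho> A' 0"
    unfolding normal_chart_def normal_chart_axioms_def using V by blast
  then show ?thesis using that V(3) U(3) by metis
qed



section \<open>The maximum principle\<close>

lemma second_derivative_local_max:
  fixes L L' :: "real \<Rightarrow> real"
  assumes "\<delta> > 0" and L: "\<And>t. \<bar>t\<bar> < \<delta> \<Longrightarrow> (L has_real_derivative L' t) (at t)"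
    and L2: "(L' has_real_derivative L2) (at 0)" and max: "\<And>t. \<bar>t\<bar> < \<delta> \<Longrightarrow> L t \<le> L 0"
  shows "L' 0 = 0" "L2 \<le> 0"
proof -
  show 0: "L' 0 = 0"
    by (rule DERIV_local_max[of L _ 0 \<delta>]) (use assms in auto)
  show "L2 \<le> 0"
  proof (rule ccontr)
    assume "\<not> L2 \<le> 0"
    then obtain d where d: "d > 0" "\<And>t. 0 < t \<Longrightarrow> t < d \<Longrightarrow> L' t > L' 0"
      using DERIV_pos_inc_right[OF L2] by force
    define t where "t = min d \<delta> / 2"
    have t: "0 < t" "t < d" "t < \<delta>" using d(1) assms(1) by (auto simp: t_def)
    obtain s where s: "0 < s" "s < t" "L t - L 0 = (t - 0) * L' s"
      using MVT2[of 0 t L L'] L t by auto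
    have "L' s > 0" using d(2)[of s] s t 0 by auto
    then have "L t > L 0" using s t by (smt (verit) mult_pos_pos)
    then show False using max[of t] t by auto
  qed
qed

text \<open>First and second order conditions for \<open>p log (k - Z) + log G - 2 log (Z + 1)\<close> at an interior maximum, along one
  coordinate line.\<close>

lemma log_max_conditions:
  fixes Z G Z' G' :: "real \<Rightarrow> real" and p :: nat and a c k :: real
  assumes \<delta>: "\<delta> > 0"
    and Z: "\<And>t. \<bar>t\<bar> < \<delta> \<Longrightarrow> (Z has_real_derivative Z' t) (at t)"
    and G: "\<And>t. \<bar>t\<bar> < \<delta> \<Longrightarrow> (G has_real_derivative G' t) (at t)"
    and Z2: "(Z' has_real_derivative Z2) (at 0)" and G2: "(G' has_real_derivative G2) (at 0)"
    and range: "\<And>t. \<bar>t\<bar> < \<delta> \<Longrightarrow> 0 \<le> Z t \<and> Z t < k" and pos: "G 0 > 0"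
    and max: "\<And>t. \<bar>t\<bar> < \<delta> \<Longrightarrow> (k - Z t) ^ p * G t / (Z t + 1)\<^sup>2 \<le> (k - Z 0) ^ p * G 0 / (Z 0 + 1)\<^sup>2"
  defines "a \<equiv> 1 / (k - Z 0)" and "c \<equiv> 1 / (Z 0 + 1)"
  shows "G' 0 = (p * a + 2 * c) * G 0 * Z' 0"
    and "G2 / G 0 - (G' 0 / G 0)\<^sup>2 - (p * a + 2 * c) * Z2 - p * a\<^sup>2 * (Z' 0)\<^sup>2 + 2 * c\<^sup>2 * (Z' 0)\<^sup>2 \<le> 0"
proof -
  have "isCont G 0" using G[of 0] \<delta> DERIV_isCont by auto
  then obtain d where d: "d > 0" "\<And>t. \<bar>t\<bar> < d \<Longrightarrow> G t > 0"
  proof -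
    have "eventually (\<lambda>t. G t > 0) (at 0)"
      using \<open>isCont G 0\<close> pos by (simp add: isCont_def order_tendstoD(1))
    then obtain d where "d > 0" "\<And>t. t \<noteq> 0 \<Longrightarrow> dist t 0 < d \<Longrightarrow> G t > 0"
      by (auto simp: eventually_at)
    then show ?thesis using that[of d] pos by (metis dist_real_def diff_zero)
  qed
  define e where "e = min d \<delta>"
  have e: "e > 0" "\<And>t. \<bar>t\<bar> < e \<Longrightarrow> \<bar>t\<bar> < d \<and> \<bar>t\<bar> < \<delta>" using d \<delta> by (auto simp: e_def)
  define L where "L t = p * ln (k - Z t) + ln (G t) - 2 * ln (Z t + 1)" for t
  define L' where "L' t = - real p * Z' t / (k - Z t) + G' t / G t - 2 * Z' t / (Z t + 1)" for t
  define L2 where "L2 = G2 / G 0 - (G' 0 / G 0)\<^sup>2 - (p * a + 2 * c) * Z2 - p * a\<^sup>2 * (Z' 0)\<^sup>2 + 2 * c\<^sup>2 * (Z' 0)\<^sup>2"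
  have L: "(L has_real_derivative L' t) (at t)" if "\<bar>t\<bar> < e" for t
  proof -
    have t: "0 \<le> Z t" "Z t < k" "G t > 0" using range[of t] d(2)[of t] e(2)[OF that] by auto
    show ?thesis unfolding L_def L'_def
      using t by (auto intro!: derivative_eq_intros Z G e(2)[OF that, THEN conjunct2] simp: mult.commute)
  qed
  have 0: "\<bar>0::real\<bar> < \<delta>" using \<delta> by simp
  have nz: "k - Z 0 \<noteq> 0" "G 0 \<noteq> 0" "Z 0 + 1 \<noteq> 0" using range[OF 0] pos by auto
  have "(L' has_real_derivative
      - ((p * Z2 * (k - Z 0) + p * Z' 0 * Z' 0) / ((k - Z 0) * (k - Z 0)))
      + (G2 * G 0 - G' 0 * G' 0) / (G 0 * G 0)
      - (2 * Z2 * (Z 0 + 1) - 2 * Z' 0 * Z' 0) / ((Z 0 + 1) * (Z 0 + 1))) (at 0)"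
    unfolding L'_def using nz
    by (auto intro!: derivative_eq_intros Z[OF 0] G[OF 0] Z2 G2 simp: mult.commute)
  moreover have "- ((p * Z2 * (k - Z 0) + p * Z' 0 * Z' 0) / ((k - Z 0) * (k - Z 0)))
      + (G2 * G 0 - G' 0 * G' 0) / (G 0 * G 0)
      - (2 * Z2 * (Z 0 + 1) - 2 * Z' 0 * Z' 0) / ((Z 0 + 1) * (Z 0 + 1)) = L2"
  proof -
    have "- ((p * Z2 * (k - Z 0) + p * Z' 0 * Z' 0) / ((k - Z 0) * (k - Z 0))) = - real p * a * Z2 - p * a\<^sup>2 * (Z' 0)\<^sup>2"
    proof -
      have "- ((P * A * d + P * B * B) / (d * d)) = - P * (1 / d) * A - P * (1 / d)\<^sup>2 * B\<^sup>2"
        if "d \<noteq> 0" for A B P d :: real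
        using that by (simp add: field_simps power2_eq_square)
      from this[OF nz(1)] show ?thesis unfolding a_def .
    qed
    moreover have "(G2 * G 0 - G' 0 * G' 0) / (G 0 * G 0) = G2 / G 0 - (G' 0 / G 0)\<^sup>2"
      using nz by (simp add: field_simps power2_eq_square)
    moreover have "(2 * Z2 * (Z 0 + 1) - 2 * Z' 0 * Z' 0) / ((Z 0 + 1) * (Z 0 + 1)) = 2 * c * Z2 - 2 * c\<^sup>2 * (Z' 0)\<^sup>2"
      using nz unfolding c_def
      by (simp add: divide_simps power2_eq_square)
    ultimately show ?thesis unfolding L2_def by (simp add: algebra_simps)
  qed
  ultimately have L2: "(L' has_real_derivative L2) (at 0)" by simp
  have Lmax: "L t \<le> L 0" if "\<bar>t\<bar> < e" for t
  proof -
    have ln: "ln ((k - Z t) ^ p * G t / (Z t + 1)\<^sup>2) = L t" if "\<bar>t\<bar> < e" for t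
    proof -
      have t: "0 \<le> Z t" "Z t < k" "G t > 0" using range[of t] d(2)[of t] e(2)[OF that] by auto
      then show ?thesis by (simp add: L_def ln_mult ln_div ln_realpow)
    qed
    have t: "0 \<le> Z t" "Z t < k" "G t > 0" using range[of t] d(2)[of t] e(2)[OF that] by auto
    have "ln ((k - Z t) ^ p * G t / (Z t + 1)\<^sup>2) \<le> ln ((k - Z 0) ^ p * G 0 / (Z 0 + 1)\<^sup>2)"
      using max[of t] e(2)[OF that] t by (intro ln_mono) (auto intro!: divide_pos_pos mult_pos_pos)
    then show ?thesis using ln[OF that] ln[of 0] e(1) by simp
  qed
  have "L' 0 = 0" "L2 \<le> 0"
    using second_derivative_local_max[OF e(1) L L2 Lmax] by auto
  have "L' 0 = G' 0 / G 0 - (p * a + 2 * c) * Z' 0"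
    by (simp add: L'_def a_def c_def distrib_right)
  with \<open>L' 0 = 0\<close> have "G' 0 / G 0 = (p * a + 2 * c) * Z' 0" by simp
  moreover have "G' 0 = G' 0 / G 0 * G 0" using nz by simp
  ultimately show "G' 0 = (p * a + 2 * c) * G 0 * Z' 0" by (simp add: mult_ac)
  show "G2 / G 0 - (G' 0 / G 0)\<^sup>2 - (p * a + 2 * c) * Z2 - p * a\<^sup>2 * (Z' 0)\<^sup>2 + 2 * c\<^sup>2 * (Z' 0)\<^sup>2 \<le> 0"
    using \<open>L2 \<le> 0\<close> unfolding L2_def .
qed

text \<open>Subtract from \<open>\<tau>\<close> the projection to the eigenvector \<open>x\<close> times its eigenvalue. The rest \<open>\<sigma>\<close> is orthogonal to what
  was subtracted, and its squared norm is at least that of its diagonal, which the Cauchy-Schwarz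
  inequality compares with its trace.\<close>

lemma eigenvector_trace_bound:
  fixes \<tau> :: "'m::finite \<Rightarrow> 'm \<Rightarrow> real"
  assumes r: "r = (\<Sum>j\<in>UNIV. (x j)\<^sup>2)" "r > 0" and ev: "\<And>i. (\<Sum>j\<in>UNIV. \<tau> i j * x j) = l * x i"
  shows "l\<^sup>2 + ((\<Sum>i\<in>UNIV. \<tau> i i) - l)\<^sup>2 / CARD('m) \<le> (\<Sum>i\<in>UNIV. \<Sum>j\<in>UNIV. (\<tau> i j)\<^sup>2)"
proof -
  define \<mu> where "\<mu> = l / r"
  define \<sigma> where "\<sigma> i j = \<tau> i j - \<mu> * (x i * x j)" for i j
  have xx: "(\<Sum>i\<in>UNIV. \<Sum>j\<in>UNIV. (x i * x j)\<^sup>2) = r\<^sup>2"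
    by (simp add: r(1) power2_eq_square sum_product mult_ac)
  have \<tau>x: "(\<Sum>i\<in>UNIV. \<Sum>j\<in>UNIV. \<tau> i j * (x i * x j)) = l * r"
  proof -
    have "(\<Sum>i\<in>UNIV. \<Sum>j\<in>UNIV. \<tau> i j * (x i * x j)) = (\<Sum>i\<in>UNIV. x i * (\<Sum>j\<in>UNIV. \<tau> i j * x j))"
      by (simp add: sum_distrib_left mult_ac)
    also have "\<dots> = l * r"
      by (simp only: ev) (simp add: r(1) sum_distrib_left power2_eq_square mult_ac)
    finally show ?thesis .
  qed
  have "(\<Sum>i\<in>UNIV. \<Sum>j\<in>UNIV. (\<sigma> i j)\<^sup>2) = (\<Sum>i\<in>UNIV. \<Sum>j\<in>UNIV. (\<tau> i j)\<^sup>2)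
      - 2 * \<mu> * (\<Sum>i\<in>UNIV. \<Sum>j\<in>UNIV. \<tau> i j * (x i * x j)) + \<mu>\<^sup>2 * (\<Sum>i\<in>UNIV. \<Sum>j\<in>UNIV. (x i * x j)\<^sup>2)"
    unfolding \<sigma>_def power2_diff sum.distrib sum_subtractf
    by (simp add: sum_distrib_left power_mult_distrib mult_ac)
  then have "(\<Sum>i\<in>UNIV. \<Sum>j\<in>UNIV. (\<sigma> i j)\<^sup>2) =
      (\<Sum>i\<in>UNIV. \<Sum>j\<in>UNIV. (\<tau> i j)\<^sup>2) - 2 * \<mu> * (l * r) + \<mu>\<^sup>2 * r\<^sup>2"
    by (simp only: xx \<tau>x)
  moreover have "2 * \<mu> * (l * r) = 2 * l\<^sup>2" "\<mu>\<^sup>2 * r\<^sup>2 = l\<^sup>2"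
    using r(2) by (simp_all add: \<mu>_def power2_eq_square)
  ultimately have \<sigma>2: "(\<Sum>i\<in>UNIV. \<Sum>j\<in>UNIV. (\<sigma> i j)\<^sup>2) = (\<Sum>i\<in>UNIV. \<Sum>j\<in>UNIV. (\<tau> i j)\<^sup>2) - l\<^sup>2"
    by linarith
  have "(\<Sum>i\<in>UNIV. \<sigma> i i) = (\<Sum>i\<in>UNIV. \<tau> i i) - \<mu> * r"
    unfolding \<sigma>_def r(1) by (simp add: sum_subtractf sum_distrib_left power2_eq_square)
  then have "((\<Sum>i\<in>UNIV. \<tau> i i) - l)\<^sup>2 = (\<Sum>i\<in>UNIV. \<sigma> i i)\<^sup>2"
    using r(2) by (simp add: \<mu>_def)
  also have "\<dots> \<le> (\<Sum>i\<in>UNIV. (\<sigma> i i)\<^sup>2) * CARD('m)"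
    by (rule sum_squared_le_sum_of_squares)
  also have "(\<Sum>i\<in>UNIV. (\<sigma> i i)\<^sup>2) \<le> (\<Sum>i\<in>UNIV. \<Sum>j\<in>UNIV. (\<sigma> i j)\<^sup>2)"
    by (intro sum_mono member_le_sum) auto
  finally show ?thesis using \<sigma>2 by (simp add: field_simps mult_right_mono)
qed

text \<open>Here \<open>x\<close> is half the gradient of \<open>z\<close>, \<open>\<tau>\<close> half its Hessian, \<open>a = 1/(k - z)\<close>, \<open>c = 1/(z + 1)\<close>, and
  \<open>\<beta> i\<close> is the squared length of the normal vector \<open>B(x, e\<^sub>i)\<close>. The eigenvalue is \<open>l = r s\<close>; both sums in the second
  order condition are at least \<open>l\<^sup>2\<close> to leading order, which cancels \<open>4 s\<^sup>2 r\<close>, and the trace part leaves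
  \<open>2 s\<^sup>2 r / m\<close>. The choice of the exponent \<open>4 m\<close> in \<open>s\<close> makes half of this absorb the term with \<open>a\<^sup>2\<close>.\<close>

lemma max_point_inequality:
  fixes \<tau> :: "'m::finite \<Rightarrow> 'm \<Rightarrow> real" and m :: real
  assumes m: "m = real CARD('m)" and r: "r = (\<Sum>j\<in>UNIV. (x j)\<^sup>2)" "r > 0"
    and ac: "a > 0" "c > 0" and s: "s = 4 * m * a + 2 * c"
    and ev: "\<And>i. (\<Sum>j\<in>UNIV. \<tau> i j * x j) = r * s * x i"
    and \<beta>: "\<And>i. ((\<Sum>j\<in>UNIV. \<tau> i j * x j) - x i)\<^sup>2 \<le> r * \<beta> i"
    and second: "(\<Sum>i\<in>UNIV. \<Sum>j\<in>UNIV. (\<tau> i j)\<^sup>2) * 2 / r + (\<Sum>i\<in>UNIV. \<beta> i) * 2 / r - 4 * s\<^sup>2 * r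
       - 2 * s * (\<Sum>i\<in>UNIV. \<tau> i i) - 4 * (4 * m) * a\<^sup>2 * r + 8 * c\<^sup>2 * r \<le> 0"
  shows "r * s \<le> 4 * m + (4 + 2 * m) * (\<Sum>i\<in>UNIV. \<tau> i i)"
proof -
  define t where "t = (\<Sum>i\<in>UNIV. \<tau> i i)"
  define l where "l = r * s"
  have m1: "m \<ge> 1" using m by (simp add: Suc_le_eq)
  have spos: "s > 0" using s ac m1 by (simp add: add_pos_pos)
  have S: "l\<^sup>2 + (t - l)\<^sup>2 / m \<le> (\<Sum>i\<in>UNIV. \<Sum>j\<in>UNIV. (\<tau> i j)\<^sup>2)"
    unfolding t_def m using eigenvector_trace_bound[OF r, of \<tau> l] ev by (simp add: l_def)
  have "r * (l - 1)\<^sup>2 = (\<Sum>i\<in>UNIV. ((\<Sum>j\<in>UNIV. \<tau> i j * x j) - x i)\<^sup>2)"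
    unfolding ev r(1) l_def[symmetric]
    by (subst sum_distrib_right) (intro sum.cong refl, simp add: power2_eq_square algebra_simps l_def r(1))
  also have "\<dots> \<le> (\<Sum>i\<in>UNIV. r * \<beta> i)" by (intro sum_mono \<beta>)
  finally have B: "(l - 1)\<^sup>2 \<le> (\<Sum>i\<in>UNIV. \<beta> i)" using r(2) by (simp add: sum_distrib_left[symmetric])
  have tl: "l\<^sup>2 - 2 * t * l \<le> (t - l)\<^sup>2" by (simp add: power2_diff)
  have "(l\<^sup>2 - 2 * t * l) / m \<le> (t - l)\<^sup>2 / m"
    using tl m1 by (simp add: divide_right_mono)
  with S have "l\<^sup>2 + (l\<^sup>2 - 2 * t * l) / m \<le> (\<Sum>i\<in>UNIV. \<Sum>j\<in>UNIV. (\<tau> i j)\<^sup>2)" by linarith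
  then have "(l\<^sup>2 + (l\<^sup>2 - 2 * t * l) / m) * 2 / r \<le> (\<Sum>i\<in>UNIV. \<Sum>j\<in>UNIV. (\<tau> i j)\<^sup>2) * 2 / r"
    using r(2) by (intro divide_right_mono mult_right_mono) auto
  moreover have "(l\<^sup>2 - 2 * l) * 2 / r \<le> (\<Sum>i\<in>UNIV. \<beta> i) * 2 / r"
    using B r(2) by (intro divide_right_mono) (auto simp: power2_diff)
  ultimately have "(l\<^sup>2 + (l\<^sup>2 - 2 * t * l) / m) * 2 / r + (l\<^sup>2 - 2 * l) * 2 / r - 4 * s\<^sup>2 * r
       - 2 * s * t - 4 * (4 * m) * a\<^sup>2 * r + 8 * c\<^sup>2 * r \<le> 0"
    using second unfolding t_def by linarith
  moreover have "(l\<^sup>2 + (l\<^sup>2 - 2 * t * l) / m) * 2 / r + (l\<^sup>2 - 2 * l) * 2 / r =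
      4 * s\<^sup>2 * r + 2 * s\<^sup>2 * r / m - 4 * s * t / m - 4 * s"
    using r(2) m1 by (simp add: l_def field_simps power2_eq_square)
  ultimately have 1: "2 * s\<^sup>2 * r / m - 4 * s * t / m - 4 * s - 2 * s * t - 16 * m * a\<^sup>2 * r + 8 * c\<^sup>2 * r \<le> 0"
    by linarith
  have "(4 * m * a)\<^sup>2 \<le> s\<^sup>2" using s ac m1 by (intro power_mono) auto
  then have "(4 * m * a)\<^sup>2 * r \<le> s\<^sup>2 * r" using r(2) by (intro mult_right_mono) auto
  then have "16 * m * a\<^sup>2 * r \<le> s\<^sup>2 * r / m"
    using m1 by (simp add: field_simps power2_eq_square)
  moreover have "8 * c\<^sup>2 * r \<ge> 0" using r(2) by simp
  ultimately have "s\<^sup>2 * r / m \<le> 4 * s * t / m + 4 * s + 2 * s * t"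
    using 1 by linarith
  then have "s * (s * r) \<le> s * (4 * t + 4 * m + 2 * t * m)"
    using m1 by (simp add: field_simps power2_eq_square)
  then have "s * r \<le> 4 * t + 4 * m + 2 * t * m" using spos by simp
  then show ?thesis by (simp add: t_def algebra_simps)
qed

text \<open>An inequality \<open>q\<^sup>2 \<le> m\<^sup>2 (5 + 3 h q) (z + 1)\<close> for \<open>q = sqrt r\<close> bounds \<open>q\<close> linearly in \<open>z + 1\<close>: either \<open>q \<le> 1\<close>, or the constant \<open>5\<close> may be
  replaced by \<open>5 q\<close> and a factor \<open>q\<close> cancels.\<close>

lemma quadratic_root_bound:
  fixes m h r s c t z :: real
  assumes "m \<ge> 1" "h \<ge> 0" "r \<ge> 0" "z \<ge> 0" and s: "s \<ge> 2 / (z + 1)"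
    and t: "t \<le> m + m * h * sqrt r" and rs: "r * s \<le> 4 * m + (4 + 2 * m) * t"
  shows "2 * sqrt r \<le> 2 * m\<^sup>2 * (5 + 3 * h) * (z + 1)"
proof -
  define q where "q = sqrt r"
  have q: "q \<ge> 0" "r = q\<^sup>2" using assms by (auto simp: q_def)
  have "r * (2 / (z + 1)) \<le> r * s" using s assms by (intro mult_left_mono) auto
  also have "\<dots> \<le> 4 * m + (4 + 2 * m) * (m + m * h * q)"
  proof -
    have "(4 + 2 * m) * t \<le> (4 + 2 * m) * (m + m * h * q)"
      using t assms(1) unfolding q_def by (intro mult_left_mono) auto
    then show ?thesis using rs by linarith
  qed
  also have "\<dots> \<le> 4 * m\<^sup>2 + (6 * m) * (m + m * h * q)"
  proof (intro add_mono mult_right_mono)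
    show "4 * m \<le> 4 * m\<^sup>2" using assms(1) by (simp add: power2_eq_square)
  qed (use assms q in auto)
  also have "\<dots> = 2 * m\<^sup>2 * (5 + 3 * h * q)" by (simp add: power2_eq_square algebra_simps)
  finally have main: "q\<^sup>2 \<le> m\<^sup>2 * (5 + 3 * h * q) * (z + 1)"
    using assms(4) q by (simp add: field_simps)
  define K where "K = m\<^sup>2 * (5 + 3 * h) * (z + 1)"
  have m2: "m\<^sup>2 \<ge> 1" using assms(1) by simp
  have "1 * 1 * 1 \<le> K" unfolding K_def using m2 assms by (intro mult_mono) auto
  then have K1: "K \<ge> 1" by simp
  have "q \<le> K"
  proof (cases "q \<le> 1")
    case True then show ?thesis using K1 by simp
  next
    case False
    have "m\<^sup>2 * (5 + 3 * h * q) * (z + 1) \<le> m\<^sup>2 * ((5 + 3 * h) * q) * (z + 1)"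
      using False assms by (intro mult_right_mono mult_left_mono) (auto simp: algebra_simps)
    then have "q * q \<le> K * q" using main by (simp add: K_def power2_eq_square algebra_simps)
    then show ?thesis using False by simp
  qed
  then show ?thesis by (simp add: K_def q_def algebra_simps)
qed



section \<open>The Bochner formula at a maximum point\<close>

lemma apd_add:
  assumes "adiff \<Phi> u" "adiff \<Psi> u"
  shows "apd v (\<lambda>x c. \<Phi> x c + \<Psi> x c) u = (\<lambda>c. apd v \<Phi> u c + apd v \<Psi> u c)"
  using assms by (auto simp: apd_def adiff_def pd_add)

context normal_chart
begin

text \<open>The components of the tangential part of the position vector \<open>X = \<phi> u0\<close>, that is, half the gradient of \<open>z\<close>.\<close>

definition xc :: "'m \<Rightarrow> real" where
  "xc j = pip n (\<phi> u0) (\<phi>1 j u0)"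

text \<open>Half the Hessian of \<open>z\<close> at \<open>u0\<close>. It is also the tangential part of the derivative of the tangential
  part of \<open>X\<close>.\<close>

definition \<tau> :: "'m \<Rightarrow> 'm \<Rightarrow> real" where
  "\<tau> i j = (if i = j then 1 else 0) + pip n (\<phi> u0) (\<phi>2 i j u0)"

text \<open>The normal part of \<open>X\<close>.\<close>

definition XN :: "'m ambient" where
  "XN = (\<lambda>c. \<phi> u0 c - (\<Sum>j\<in>UNIV. xc j * \<phi>1 j u0 c))"

text \<open>The second fundamental form applied to a coordinate vector and the tangential part of \<open>X\<close>.\<close>

definition Bx :: "'m \<Rightarrow> 'm ambient" where
  "Bx i = (\<lambda>c. \<Sum>j\<in>UNIV. xc j * \<phi>2 i j u0 c)"

text \<open>The coefficients of the test field \<open>T\<close>. Their first derivatives \<open>\<tau>\<close> make \<open>T\<close> agree to first order at \<open>u0\<close> with the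
  tangential part of the position vector.\<close>

definition tc :: "'m \<Rightarrow> real^'m \<Rightarrow> real" where
  "tc j u = xc j + (\<Sum>l\<in>UNIV. \<tau> j l * (u $ l - u0 $ l))"

definition T :: "real^'m \<Rightarrow> 'm ambient" where
  "T u = (\<lambda>c. \<Sum>j\<in>UNIV. tc j u * \<phi>1 j u c)"

text \<open>The support function of the squared gradient norm of \<open>z\<close>: it lies below it and touches it at \<open>u0\<close>.\<close>

definition G :: "real^'m \<Rightarrow> real" where
  "G u = 4 * (2 * pip n (\<phi> u) (T u) - pip n (T u) (T u))"

lemma \<phi>2_commute: "u \<in> U \<Longrightarrow> \<phi>2 i j u = \<phi>2 j i u"
  unfolding apd_def using asmooth_\<phi> by (intro ext pd_commute[OF open_U]) (simp_all add: asmooth_def)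

lemma \<tau>_commute: "\<tau> i j = \<tau> j i"
  by (simp add: \<tau>_def \<phi>2_commute[OF u0, of i j])

text \<open>In Riemannian terms, this symmetry is the Codazzi equation.\<close>

lemma \<phi>3_commute: "apd (axis i 1) (\<phi>2 i j) u0 = apd (axis j 1) (\<phi>2 i i) u0"
proof -
  have "apd (axis i 1) (\<phi>2 i j) u0 = apd (axis i 1) (\<phi>2 j i) u0"
    by (rule apd_cong_open(2)[OF open_U u0 \<phi>2_commute])
  also have "\<dots> = apd (axis j 1) (\<phi>2 i i) u0"
    unfolding apd_def using asmooth_\<phi>1[of i]
    by (intro ext pd_commute[OF open_U u0]) (simp add: asmooth_def apd_def)
  finally show ?thesis .
qed

lemma pip_coord: "(\<Sum>j\<in>UNIV. a j * pip n (\<phi>1 k u0) (\<phi>1 j u0)) = a k"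
  "(\<Sum>j\<in>UNIV. a j * pip n (\<phi>1 j u0) (\<phi>1 k u0)) = a k"
  by (simp_all add: coord_orthonormal if_distrib cong: if_cong)

lemma XN_normal: "pip n XN (\<phi>1 j u0) = 0"
  by (simp add: XN_def pip_diff_left pip_lincomb_left pip_coord xc_def[symmetric])

lemma XN_normal': "pip n XN (apd v \<phi> u0) = 0"
  using XN_normal normal_iff_coord by blast

lemma XN_pseudo_space: "XN \<in> pseudo_space n"
  unfolding XN_def by (intro pseudo_space_diff pseudo_space_lincomb \<phi>_pseudo_space \<phi>1_pseudo_space u0)

lemma Bx_pseudo_space: "Bx i \<in> pseudo_space n"
  unfolding Bx_def by (intro pseudo_space_lincomb \<phi>2_pseudo_space u0)

lemma Bx_normal: "pip n (Bx i) (apd v \<phi> u0) = 0"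
proof -
  have "\<forall>j. pip n (Bx i) (\<phi>1 j u0) = 0" by (simp add: Bx_def pip_lincomb_left christoffel_zero)
  then show ?thesis using normal_iff_coord by blast
qed

lemma XN_\<phi>2: "pip n XN (\<phi>2 i j u0) = \<tau> i j - (if i = j then 1 else 0)"
  unfolding XN_def pip_diff_left pip_lincomb_left
  by (simp add: pip_commute[of n "\<phi>1 _ u0"] christoffel_zero \<tau>_def)

lemma XN_Bx: "pip n XN (Bx i) = (\<Sum>j\<in>UNIV. \<tau> i j * xc j) - xc i"
  unfolding Bx_def pip_lincomb_right XN_\<phi>2 right_diff_distrib sum_subtractf
  by (simp add: mult.commute if_distrib cong: if_cong)

lemma tc_smooth: "smooth_on U (tc j)"
proof -
  have "smooth_on U (\<lambda>u::real^'m. u $ l)" for l by (rule smooth_on_linear[OF bounded_linear_vec_nth])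
  then show ?thesis
    unfolding tc_def[abs_def]
    by (intro smooth_on_add smooth_on_const smooth_on_sum smooth_on_mult smooth_on_diff open_U)
qed

lemma tc_differentiable: "u \<in> U \<Longrightarrow> tc j differentiable (at u)"
  using tc_smooth smooth_on_differentiable by blast

lemma tc_at_u0: "tc j u0 = xc j"
  by (simp add: tc_def)

lemma pd_tc: "pd (axis i 1) (tc j) u = \<tau> i j"
proof -
  have "(tc j has_derivative (\<lambda>v. \<Sum>l\<in>UNIV. \<tau> j l * v $ l)) (at u)"
    unfolding tc_def[abs_def]
    by (auto intro!: derivative_eq_intros bounded_linear_imp_has_derivative bounded_linear_vec_nth)
  then have "pd (axis i 1) (tc j) u = (\<Sum>l\<in>UNIV. \<tau> j l * (axis i 1 :: real^'m) $ l)"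
    by (rule pd_eqI)
  also have "\<dots> = \<tau> j i" by (simp add: axis_def if_distrib cong: if_cong)
  finally show ?thesis by (simp only: \<tau>_commute[of j i])
qed

lemma asmooth_T: "asmooth U T"
  unfolding T_def[abs_def] by (intro asmooth_lincomb open_U tc_smooth asmooth_\<phi>1)

lemma T_tangent: "u \<in> U \<Longrightarrow> T u = apd (\<chi> j. tc j u) \<phi> u"
  by (subst apd_\<phi>_expand) (simp_all add: T_def)

lemma T_first: "u \<in> U \<Longrightarrow> apd (axis i 1) T u =
    (\<lambda>c. (\<Sum>j\<in>UNIV. tc j u * \<phi>2 i j u c) + (\<Sum>j\<in>UNIV. \<tau> i j * \<phi>1 j u c))"
  unfolding T_def[abs_def]
  by (subst apd_lincomb) (auto intro: tc_differentiable asmooth_adiff[OF asmooth_\<phi>1] simp: pd_tc)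

lemma T_second: "apd (axis i 1) (apd (axis i 1) T) u0 =
    (\<lambda>c. (\<Sum>j\<in>UNIV. xc j * apd (axis i 1) (\<phi>2 i j) u0 c) + 2 * (\<Sum>j\<in>UNIV. \<tau> i j * \<phi>2 i j u0 c))"
proof -
  have ad1: "adiff (\<lambda>x c. \<Sum>j\<in>UNIV. tc j x * \<phi>2 i j x c) u0"
    by (intro adiff_lincomb tc_differentiable u0 asmooth_adiff[OF asmooth_\<phi>2])
  have ad2: "adiff (\<lambda>x c. \<Sum>j\<in>UNIV. \<tau> i j * \<phi>1 j x c) u0"
    by (intro adiff_lincomb asmooth_adiff[OF asmooth_\<phi>1 u0]) simp
  have "apd (axis i 1) (apd (axis i 1) T) u0 =
      apd (axis i 1) (\<lambda>x c. (\<Sum>j\<in>UNIV. tc j x * \<phi>2 i j x c) + (\<Sum>j\<in>UNIV. \<tau> i j * \<phi>1 j x c)) u0"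
    by (rule apd_cong_open(2)[OF open_U u0 T_first])
  also have "\<dots> = (\<lambda>c. apd (axis i 1) (\<lambda>x c. \<Sum>j\<in>UNIV. tc j x * \<phi>2 i j x c) u0 c
      + apd (axis i 1) (\<lambda>x c. \<Sum>j\<in>UNIV. \<tau> i j * \<phi>1 j x c) u0 c)"
    by (rule apd_add[OF ad1 ad2])
  also have "apd (axis i 1) (\<lambda>x c. \<Sum>j\<in>UNIV. tc j x * \<phi>2 i j x c) u0 =
      (\<lambda>c. (\<Sum>j\<in>UNIV. xc j * apd (axis i 1) (\<phi>2 i j) u0 c) + (\<Sum>j\<in>UNIV. \<tau> i j * \<phi>2 i j u0 c))"
    by (subst apd_lincomb) (auto intro: tc_differentiable u0 asmooth_adiff[OF asmooth_\<phi>2] simp: pd_tc tc_at_u0)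
  also have "apd (axis i 1) (\<lambda>x c. \<Sum>j\<in>UNIV. \<tau> i j * \<phi>1 j x c) u0 = (\<lambda>c. \<Sum>j\<in>UNIV. \<tau> i j * \<phi>2 i j u0 c)"
    by (subst apd_lincomb) (auto intro: asmooth_adiff[OF asmooth_\<phi>1 u0] simp: pd_const)
  finally show ?thesis by (simp add: add.commute)
qed

lemma T_at_u0: "T u0 = (\<lambda>c. \<Sum>j\<in>UNIV. xc j * \<phi>1 j u0 c)"
  by (simp add: T_def tc_at_u0)

lemma \<phi>_minus_T: "(\<lambda>c. \<phi> u0 c - T u0 c) = XN"
  by (simp add: T_at_u0 XN_def)

abbreviation r :: real where
  "r \<equiv> \<Sum>j\<in>UNIV. (xc j)\<^sup>2"

lemma pip_T_T: "pip n (T u0) (T u0) = r"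
  unfolding T_at_u0
  by (simp add: pip_lincomb_left pip_lincomb_right pip_coord power2_eq_square)

lemma pip_\<phi>_T: "pip n (\<phi> u0) (T u0) = r"
  unfolding T_at_u0 by (simp add: pip_lincomb_right xc_def power2_eq_square)

lemma G_at_u0: "G u0 = 4 * r"
  by (simp add: G_def pip_T_T pip_\<phi>_T)

lemma pip_XN_XN: "pip n XN XN = pip n (\<phi> u0) (\<phi> u0) - r"
proof -
  have "pip n XN XN = pip n (\<phi> u0) (\<phi> u0) - 2 * pip n (\<phi> u0) (T u0) + pip n (T u0) (T u0)"
    unfolding \<phi>_minus_T[symmetric] pip_diff_left pip_diff_right by (simp add: pip_commute[of n "T u0" "\<phi> u0"])
  then show ?thesis by (simp add: pip_T_T pip_\<phi>_T)
qed

text \<open>The tangential part of \<open>X\<close> has length \<open>sqrt r\<close> in any orthonormal basis; here the frame is compared with the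
  coordinate basis.\<close>

lemma gradient_norm_at_u0: "gradient_norm n M (pseudo_distance n) (\<phi> u0) = 2 * sqrt r"
proof -
  have "pip n (\<phi> u0) (e j u0) = pip n (T u0) (e j u0)" for j
    using XN_normal'[of "A j u0"] unfolding \<phi>_minus_T[symmetric] pip_diff_left by (simp add: e_def)
  moreover have "pip n (T u0) (T u0) = (\<Sum>j\<in>UNIV. (pip n (T u0) (e j u0))\<^sup>2)"
    by (subst (2) T_tangent[OF u0], subst tangent_expansion[OF u0])
      (simp add: pip_lincomb_right T_tangent[OF u0, symmetric] power2_eq_square)
  ultimately show ?thesis by (simp add: gradient_norm_pseudo_distance[OF u0] pip_T_T)
qed

lemma G_le_gradient_norm: "u \<in> U \<Longrightarrow> G u \<le> (gradient_norm n M (pseudo_distance n) (\<phi> u))\<^sup>2"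
  using gradient_norm_lower_bound[of u "\<chi> j. tc j u"] by (simp add: G_def T_tangent)

text \<open>The first partial derivatives of \<open>G\<close>.\<close>

definition G1 :: "'m \<Rightarrow> real^'m \<Rightarrow> real" where
  "G1 i u = 8 * (pip n (\<phi>1 i u) (T u) + pip n (\<phi> u) (apd (axis i 1) T u) - pip n (T u) (apd (axis i 1) T u))"

lemma smooth_G: "smooth_on U G"
  unfolding G_def[abs_def]
  by (intro smooth_on_diff smooth_on_mult smooth_on_const smooth_on_pip asmooth_T asmooth_\<phi> open_U)

lemma pd_G: "u \<in> U \<Longrightarrow> pd (axis i 1) G u = G1 i u"
proof -
  assume u: "u \<in> U"
  have a: "adiff \<phi> u" "adiff T u" using u asmooth_adiff asmooth_\<phi> asmooth_T by blast+
  note d = pd_pip(1)[OF a, of n] pd_pip(1)[OF a(2) a(2), of n]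
  have "pd (axis i 1) G u = 4 * (2 * pd (axis i 1) (\<lambda>u. pip n (\<phi> u) (T u)) u - pd (axis i 1) (\<lambda>u. pip n (T u) (T u)) u)"
    unfolding G_def[abs_def]
    by (subst pd_cmult, intro differentiable_diff differentiable_mult d differentiable_const,
        subst pd_diff, intro differentiable_mult d differentiable_const, rule d, subst pd_cmult, rule d, rule refl)
  then show ?thesis
    unfolding pd_pip(2)[OF a] pd_pip(2)[OF a(2) a(2)] G1_def
    using pip_commute[of n "apd (axis i 1) T u" "T u"] by (simp add: algebra_simps)
qed

lemma smooth_G1: "smooth_on U (G1 i)"
  using smooth_on_pd[OF smooth_G, of "axis i 1"] smooth_on_cong[OF open_U, of "pd (axis i 1) G" "G1 i"] pd_G
  by simp

lemma G1_at_u0: "G1 i u0 = 8 * (\<Sum>j\<in>UNIV. \<tau> i j * xc j)"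
proof -
  have "G1 i u0 = 8 * (pip n (\<phi>1 i u0) (T u0) + pip n XN (apd (axis i 1) T u0))"
    unfolding G1_def \<phi>_minus_T[symmetric] pip_diff_left by simp
  also have "pip n (\<phi>1 i u0) (T u0) = xc i"
    unfolding T_at_u0 pip_lincomb_right pip_coord ..
  also have "pip n XN (apd (axis i 1) T u0) = pip n XN (Bx i)"
    unfolding T_first[OF u0] pip_add_right Bx_def pip_lincomb_right by (simp add: XN_normal tc_at_u0)
  finally show ?thesis by (simp add: XN_Bx)
qed

text \<open>The second derivative of the test field is paired only with \<open>X - T\<close>, which at \<open>u0\<close> is the normal part of \<open>X\<close>. This is
  why third derivatives of the parametrization enter only through their normal component. The contributions linear in
  \<open>\<tau> i i\<close> cancel.\<close>

lemma pd_G1: "pd (axis i 1) (G1 i) u0 =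
    8 * ((\<Sum>j\<in>UNIV. xc j * pip n XN (apd (axis i 1) (\<phi>2 i j) u0)) + (\<Sum>j\<in>UNIV. (\<tau> i j)\<^sup>2) - pip n (Bx i) (Bx i))"
proof -
  let ?T1 = "apd (axis i 1) T" and ?T2 = "apd (axis i 1) (apd (axis i 1) T) u0"
  have a: "adiff \<phi> u0" "adiff T u0" "adiff (\<phi>1 i) u0" "adiff ?T1 u0"
    using u0 asmooth_adiff asmooth_\<phi> asmooth_T asmooth_\<phi>1 asmooth_apd[OF asmooth_T] by blast+
  note d = pd_pip(1)[OF a(3) a(2), of n] pd_pip(1)[OF a(1) a(4), of n] pd_pip(1)[OF a(2) a(4), of n]
  have "pd (axis i 1) (G1 i) u0 = 8 * (pd (axis i 1) (\<lambda>u. pip n (\<phi>1 i u) (T u)) u0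
      + pd (axis i 1) (\<lambda>u. pip n (\<phi> u) (?T1 u)) u0 - pd (axis i 1) (\<lambda>u. pip n (T u) (?T1 u)) u0)"
    unfolding G1_def[abs_def]
    by (subst pd_cmult, intro differentiable_diff differentiable_add d,
        subst pd_diff, intro differentiable_add d, rule d, subst pd_add, rule d, rule d, rule refl)
  also have "\<dots> = 8 * (pip n (\<phi>2 i i u0) (T u0) + 2 * pip n (\<phi>1 i u0) (?T1 u0)
      + pip n XN ?T2 - pip n (?T1 u0) (?T1 u0))"
    unfolding pd_pip(2)[OF a(3) a(2)] pd_pip(2)[OF a(1) a(4)] pd_pip(2)[OF a(2) a(4)]
      \<phi>_minus_T[symmetric] pip_diff_left by simp
  also have "pip n (\<phi>2 i i u0) (T u0) = 0"
    unfolding T_at_u0 pip_lincomb_right by (simp add: christoffel_zero)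
  also have "pip n (\<phi>1 i u0) (?T1 u0) = \<tau> i i"
    unfolding T_first[OF u0] pip_add_right pip_lincomb_right pip_coord
    by (simp add: pip_commute[of n "\<phi>1 i u0"] christoffel_zero)
  also have "pip n XN ?T2 = (\<Sum>j\<in>UNIV. xc j * pip n XN (apd (axis i 1) (\<phi>2 i j) u0))
      + 2 * ((\<Sum>j\<in>UNIV. (\<tau> i j)\<^sup>2) - \<tau> i i)"
    unfolding T_second pip_add_right pip_scale_right pip_lincomb_right XN_\<phi>2 right_diff_distrib sum_subtractf
    by (simp add: power2_eq_square if_distrib cong: if_cong)
  also have "pip n (?T1 u0) (?T1 u0) = (\<Sum>j\<in>UNIV. (\<tau> i j)\<^sup>2) + pip n (Bx i) (Bx i)"
  proof -
    have T1: "?T1 u0 = (\<lambda>c. Bx i c + (\<Sum>j\<in>UNIV. \<tau> i j * \<phi>1 j u0 c))"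
      unfolding T_first[OF u0] Bx_def tc_at_u0 ..
    have "pip n (Bx i) (\<phi>1 j u0) = 0" "pip n (\<phi>1 j u0) (Bx i) = 0" for j
      using Bx_normal pip_commute by metis+
    then show ?thesis
      unfolding T1 pip_add_left pip_add_right pip_lincomb_left pip_lincomb_right pip_coord
      by (simp add: power2_eq_square pip_coord)
  qed
  finally show ?thesis by (simp add: algebra_simps)
qed

text \<open>The Bochner formula for \<open>z\<close> at \<open>u0\<close>, up to a factor. Since normal vectors are time-like, the subtracted sum is not
  positive.\<close>

lemma bochner:
  assumes "parallel_mean_curvature n M"
  shows "(\<Sum>i\<in>UNIV. pd (axis i 1) (G1 i) u0) =
    8 * ((\<Sum>i\<in>UNIV. \<Sum>j\<in>UNIV. (\<tau> i j)\<^sup>2) - (\<Sum>i\<in>UNIV. pip n (Bx i) (Bx i)))"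
proof -
  have eq: "pip n XN (apd (axis i 1) (\<phi>2 i j) u0) = pip n XN (apd (axis j 1) (\<phi>2 i i) u0)" for i j
    by (rule arg_cong[OF \<phi>3_commute])
  have "(\<Sum>i\<in>UNIV. \<Sum>j\<in>UNIV. xc j * pip n XN (apd (axis i 1) (\<phi>2 i j) u0)) =
      (\<Sum>i\<in>UNIV. \<Sum>j\<in>UNIV. xc j * pip n XN (apd (axis j 1) (\<phi>2 i i) u0))"
    by (intro sum.cong refl arg_cong2[where f="(*)"] eq)
  also have "\<dots> = (\<Sum>j\<in>UNIV. xc j * (\<Sum>i\<in>UNIV. pip n XN (apd (axis j 1) (\<phi>2 i i) u0)))"
    by (subst sum.swap) (simp add: sum_distrib_left)
  also have "\<dots> = 0"
    using parallel_third_derivative[OF assms, of XN] by (simp add: XN_normal)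
  finally show ?thesis
    unfolding pd_G1 sum_distrib_left[symmetric] sum.distrib sum_subtractf by simp
qed

text \<open>Half the Laplacian of \<open>z\<close> is \<open>m + m \<langle>XN, H\<rangle>\<close>. As \<open>z \<ge> 0\<close>, the length of \<open>XN\<close> is at most \<open>sqrt r\<close>, so that the
  Cauchy-Schwarz inequality in the normal space gives the bound.\<close>

lemma trace_bound:
  fixes h :: real
  assumes H: "mean_curvature_norm n M (\<phi> u0) = h" and z: "pip n (\<phi> u0) (\<phi> u0) \<ge> 0"
  shows "(\<Sum>i\<in>UNIV. \<tau> i i) \<le> CARD('m) + CARD('m) * h * sqrt r"
proof -
  define m where "m = real CARD('m)"
  define \<eta> where "\<eta> = mean_curvature n M (\<phi> u0)"
  have \<eta>: "\<eta> = (\<lambda>c. (1 / m) * (\<Sum>k\<in>UNIV. \<phi>2 k k u0 c))"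
    by (simp add: \<eta>_def mean_curvature_at_u0 m_def)
  have \<eta>ps: "\<eta> \<in> pseudo_space n"
    unfolding \<eta> by (intro pseudo_space_scale pseudo_space_sum \<phi>2_pseudo_space u0)
  have "\<forall>j. pip n \<eta> (\<phi>1 j u0) = 0"
    unfolding \<eta> pip_scale_left pip_sum_left by (simp add: christoffel_zero)
  then have \<eta>n: "pip n \<eta> (apd v \<phi> u0) = 0" for v using normal_iff_coord by blast
  have \<eta>le: "pip n \<eta> \<eta> \<le> 0" by (rule normal_pip_nonpos[OF u0 \<eta>ps \<eta>n])
  have h: "h \<ge> 0" "h\<^sup>2 = - pip n \<eta> \<eta>"
    using H \<eta>le by (auto simp: mean_curvature_norm_def \<eta>_def)
  have "(pip n XN \<eta>)\<^sup>2 \<le> pip n XN XN * pip n \<eta> \<eta>"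
    by (rule normal_cauchy_schwarz[OF u0 XN_pseudo_space XN_normal' \<eta>ps \<eta>n])
  also have "\<dots> = (r - pip n (\<phi> u0) (\<phi> u0)) * h\<^sup>2"
    by (simp add: pip_XN_XN h(2) algebra_simps)
  also have "\<dots> \<le> r * h\<^sup>2" using z by (intro mult_right_mono) auto
  also have "\<dots> = (sqrt r * h)\<^sup>2" by (simp add: power_mult_distrib sum_nonneg)
  finally have "\<bar>pip n XN \<eta>\<bar> \<le> \<bar>sqrt r * h\<bar>" using abs_le_square_iff by blast
  then have b: "pip n XN \<eta> \<le> sqrt r * h" using h(1) by (simp add: sum_nonneg)
  have "(\<Sum>i\<in>UNIV. \<tau> i i) = m + m * pip n XN \<eta>"
  proof -
    have "m * pip n XN \<eta> = (\<Sum>i\<in>UNIV. pip n XN (\<phi>2 i i u0))"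
      unfolding \<eta> pip_scale_right pip_sum_right by (simp add: m_def)
    also have "\<dots> = (\<Sum>i\<in>UNIV. \<tau> i i) - m" by (simp add: XN_\<phi>2 sum_subtractf m_def)
    finally show ?thesis by simp
  qed
  also have "\<dots> \<le> m + m * (sqrt r * h)" using b by (intro add_left_mono mult_left_mono) (auto simp: m_def)
  finally show ?thesis by (simp add: m_def mult_ac)
qed

text \<open>The maximum is inherited by the support function \<open>G\<close>. The conditions along the coordinate lines through \<open>u0\<close> are
  added up; in normal coordinates this sum plays the role of the Laplacian.\<close>

lemma gradient_bound_at_max:
  fixes k h :: real
  defines "z \<equiv> \<lambda>u. pseudo_distance n (\<phi> u)"
    and "g \<equiv> \<lambda>u. gradient_norm n M (pseudo_distance n) (\<phi> u)"
    and "m \<equiv> real CARD('m)"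
  assumes par: "parallel_mean_curvature n M" and H: "mean_curvature_norm n M (\<phi> u0) = h" and h: "h \<ge> 0"
    and W: "open W" "u0 \<in> W" "W \<subseteq> U"
    and range: "\<And>u. u \<in> W \<Longrightarrow> 0 \<le> z u \<and> z u < k"
    and max: "\<And>u. u \<in> W \<Longrightarrow>
      (k - z u) ^ (4 * CARD('m)) * (g u)\<^sup>2 / (z u + 1)\<^sup>2 \<le> (k - z u0) ^ (4 * CARD('m)) * (g u0)\<^sup>2 / (z u0 + 1)\<^sup>2"
  shows "g u0 \<le> 2 * m\<^sup>2 * (5 + 3 * h) * (z u0 + 1)"
proof (cases "r = 0")
  case True
  have "z u0 \<ge> 0" using range W by blast
  then show ?thesis using h by (simp add: g_def gradient_norm_at_u0 True)
next
  case False
  then have rpos: "r > 0" by (simp add: sum_nonneg less_le)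
  have z0: "0 \<le> z u0" "z u0 < k" using range W by blast+
  define a where "a = 1 / (k - z u0)"
  define c where "c = 1 / (z u0 + 1)"
  define s where "s = 4 * m * a + 2 * c"
  have ac: "a > 0" "c > 0" using z0 by (simp_all add: a_def c_def)
  have zd: "z u = pip n (\<phi> u) (\<phi> u)" for u by (simp add: z_def pseudo_distance_def)
  have zs: "smooth_on U z" unfolding zd[abs_def] by (intro smooth_on_pip open_U asmooth_\<phi>)
  have pdz: "pd (axis i 1) z u = 2 * pip n (\<phi> u) (\<phi>1 i u)" if "u \<in> U" for i u
    unfolding zd[abs_def] pd_pip(2)[OF adiff_\<phi>[OF that] adiff_\<phi>[OF that]]
    using pip_commute[of n "\<phi> u"] by simp
  have pdz0: "pd (axis i 1) z u0 = 2 * xc i" for i by (simp add: pdz[OF u0] xc_def)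
  have pdz2: "pd (axis i 1) (pd (axis i 1) z) u0 = 2 * \<tau> i i" for i
  proof -
    note b = adiff_\<phi>[OF u0] asmooth_adiff[OF asmooth_\<phi>1 u0]
    have "pd (axis i 1) (pd (axis i 1) z) u0 = pd (axis i 1) (\<lambda>u. 2 * pip n (\<phi> u) (\<phi>1 i u)) u0"
      by (rule pd_cong_open(2)[OF open_U u0 pdz])
    also have "\<dots> = 2 * (pip n (\<phi>1 i u0) (\<phi>1 i u0) + pip n (\<phi> u0) (\<phi>2 i i u0))"
      by (subst pd_cmult, rule pd_pip(1)[OF b], subst pd_pip(2)[OF b], rule refl)
    finally show ?thesis by (simp add: coord_orthonormal \<tau>_def)
  qed
  obtain \<delta> where \<delta>: "\<delta> > 0" "\<And>x. dist x u0 < \<delta> \<Longrightarrow> x \<in> W" using W(1,2) open_dist by blast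
  have line: "u0 + t *\<^sub>R axis i 1 \<in> W" if "\<bar>t\<bar> < \<delta>" for t i
    using \<delta>(2)[of "u0 + t *\<^sub>R axis i 1"] that by (simp add: dist_norm norm_axis_1)
  have Wmax: "(k - z u) ^ (4 * CARD('m)) * G u / (z u + 1)\<^sup>2 \<le> (k - z u0) ^ (4 * CARD('m)) * G u0 / (z u0 + 1)\<^sup>2"
    if "u \<in> W" for u
  proof -
    have "(k - z u) ^ (4 * CARD('m)) * G u / (z u + 1)\<^sup>2 \<le> (k - z u) ^ (4 * CARD('m)) * (g u)\<^sup>2 / (z u + 1)\<^sup>2"
      using G_le_gradient_norm[of u] range[OF that] that W(3)
      unfolding g_def by (intro divide_right_mono mult_left_mono) auto
    also have "\<dots> \<le> (k - z u0) ^ (4 * CARD('m)) * (g u0)\<^sup>2 / (z u0 + 1)\<^sup>2" by (rule max[OF that])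
    also have "(g u0)\<^sup>2 = G u0"
      by (simp add: g_def gradient_norm_at_u0 G_at_u0 power_mult_distrib sum_nonneg)
    finally show ?thesis .
  qed
  have cond: "G1 i u0 = s * G u0 * (2 * xc i) \<and>
      pd (axis i 1) (G1 i) u0 / G u0 - (G1 i u0 / G u0)\<^sup>2 - s * (2 * \<tau> i i)
        - 4 * m * a\<^sup>2 * (2 * xc i)\<^sup>2 + 2 * c\<^sup>2 * (2 * xc i)\<^sup>2 \<le> 0" for i
  proof -
    let ?l = "\<lambda>t. u0 + t *\<^sub>R axis i 1"
    have U: "?l t \<in> U" if "\<bar>t\<bar> < \<delta>" for t using line[OF that] W(3) by blast
    have d0: "\<bar>0::real\<bar> < \<delta>" using \<delta>(1) by simp
    have 1: "((\<lambda>t. z (?l t)) has_real_derivative pd (axis i 1) z (?l t)) (at t)" if "\<bar>t\<bar> < \<delta>" for t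
      by (rule pd_line[OF smooth_on_differentiable[OF zs U[OF that]]])
    have 2: "((\<lambda>t. G (?l t)) has_real_derivative G1 i (?l t)) (at t)" if "\<bar>t\<bar> < \<delta>" for t
      using pd_line[OF smooth_on_differentiable[OF smooth_G U[OF that]]] by (simp add: pd_G[OF U[OF that]])
    have 3: "((\<lambda>t. pd (axis i 1) z (?l t)) has_real_derivative 2 * \<tau> i i) (at 0)"
      using pd_line[where f="pd (axis i 1) z" and v="axis i 1" and x=u0 and t=0,
        OF smooth_on_differentiable[OF smooth_on_pd[OF zs] U[OF d0]]] by (simp add: pdz2)
    have 4: "((\<lambda>t. G1 i (?l t)) has_real_derivative pd (axis i 1) (G1 i) u0) (at 0)"
      using pd_line[OF smooth_on_differentiable[OF smooth_G1 U[OF d0]]] by simp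
    note * = log_max_conditions[where Z="\<lambda>t. z (?l t)" and G="\<lambda>t. G (?l t)" and k=k and p="4 * CARD('m)",
      OF \<delta>(1) 1 2 3 4]
    have "0 \<le> z (?l t) \<and> z (?l t) < k" if "\<bar>t\<bar> < \<delta>" for t using range[OF line[OF that]] .
    moreover have "G (?l 0) > 0" using rpos by (simp add: G_at_u0)
    moreover have "(k - z (?l t)) ^ (4 * CARD('m)) * G (?l t) / (z (?l t) + 1)\<^sup>2
        \<le> (k - z (?l 0)) ^ (4 * CARD('m)) * G (?l 0) / (z (?l 0) + 1)\<^sup>2" if "\<bar>t\<bar> < \<delta>" for t
      using Wmax[OF line[OF that]] by simp
    ultimately show ?thesis
      using *(1) *(2) by (simp add: pdz0 a_def c_def s_def m_def)
  qed
  have ev: "(\<Sum>j\<in>UNIV. \<tau> i j * xc j) = r * s * xc i" for i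
    using cond[of i] by (simp add: G1_at_u0 G_at_u0)
  define \<beta> where "\<beta> i = - pip n (Bx i) (Bx i)" for i
  have \<beta>0: "\<beta> i \<ge> 0" for i
    using normal_pip_nonpos[OF u0 Bx_pseudo_space Bx_normal] by (simp add: \<beta>_def)
  have \<beta>: "((\<Sum>j\<in>UNIV. \<tau> i j * xc j) - xc i)\<^sup>2 \<le> r * \<beta> i" for i
  proof -
    have "(pip n XN (Bx i))\<^sup>2 \<le> pip n XN XN * pip n (Bx i) (Bx i)"
      by (rule normal_cauchy_schwarz[OF u0 XN_pseudo_space XN_normal' Bx_pseudo_space Bx_normal])
    also have "\<dots> = (r - z u0) * \<beta> i" by (simp add: pip_XN_XN zd \<beta>_def algebra_simps)
    also have "\<dots> \<le> r * \<beta> i" using z0 \<beta>0 by (intro mult_right_mono) auto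
    finally show ?thesis by (simp add: XN_Bx)
  qed
  have "(\<Sum>i\<in>UNIV. pd (axis i 1) (G1 i) u0 / G u0 - (G1 i u0 / G u0)\<^sup>2 - s * (2 * \<tau> i i)
        - 4 * m * a\<^sup>2 * (2 * xc i)\<^sup>2 + 2 * c\<^sup>2 * (2 * xc i)\<^sup>2) \<le> 0"
    using cond by (intro sum_nonpos) blast
  also have "(\<Sum>i\<in>UNIV. pd (axis i 1) (G1 i) u0 / G u0 - (G1 i u0 / G u0)\<^sup>2 - s * (2 * \<tau> i i)
        - 4 * m * a\<^sup>2 * (2 * xc i)\<^sup>2 + 2 * c\<^sup>2 * (2 * xc i)\<^sup>2) =
      (\<Sum>i\<in>UNIV. \<Sum>j\<in>UNIV. (\<tau> i j)\<^sup>2) * 2 / r + (\<Sum>i\<in>UNIV. \<beta> i) * 2 / r - 4 * s\<^sup>2 * r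
       - 2 * s * (\<Sum>i\<in>UNIV. \<tau> i i) - 4 * (4 * m) * a\<^sup>2 * r + 8 * c\<^sup>2 * r"
  proof -
    have "(\<Sum>i\<in>UNIV. pd (axis i 1) (G1 i) u0 / G u0) = 8 * ((\<Sum>i\<in>UNIV. \<Sum>j\<in>UNIV. (\<tau> i j)\<^sup>2) + (\<Sum>i\<in>UNIV. \<beta> i)) / (4 * r)"
      unfolding sum_divide_distrib[symmetric] bochner[OF par] G_at_u0 by (simp add: \<beta>_def sum_negf)
    also have "\<dots> = (\<Sum>i\<in>UNIV. \<Sum>j\<in>UNIV. (\<tau> i j)\<^sup>2) * 2 / r + (\<Sum>i\<in>UNIV. \<beta> i) * 2 / r"
      by (simp add: add_divide_distrib algebra_simps)
    finally have 1: "(\<Sum>i\<in>UNIV. pd (axis i 1) (G1 i) u0 / G u0) =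
      (\<Sum>i\<in>UNIV. \<Sum>j\<in>UNIV. (\<tau> i j)\<^sup>2) * 2 / r + (\<Sum>i\<in>UNIV. \<beta> i) * 2 / r" .
    have "G1 i u0 / G u0 = 2 * s * xc i" for i
      using cond[of i] rpos by (simp add: G_at_u0)
    then have 2: "(\<Sum>i\<in>UNIV. (G1 i u0 / G u0)\<^sup>2) = 4 * s\<^sup>2 * r"
      by (simp add: power_mult_distrib sum_distrib_left)
    show ?thesis
      unfolding sum.distrib sum_subtractf 1 2
      by (simp add: power_mult_distrib sum_distrib_left[symmetric] sum_distrib_right[symmetric] mult_ac)
  qed
  finally have "r * s \<le> 4 * m + (4 + 2 * m) * (\<Sum>i\<in>UNIV. \<tau> i i)"
    by (intro max_point_inequality[OF _ refl rpos ac s_def ev \<beta>]) (simp_all add: m_def)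
  moreover have "(\<Sum>i\<in>UNIV. \<tau> i i) \<le> m + m * h * sqrt r"
    unfolding m_def using trace_bound[OF H] z0(1) by (simp add: zd)
  moreover have "s \<ge> 2 / (z u0 + 1)" using ac by (simp add: s_def c_def m_def)
  moreover have "m \<ge> 1" by (simp add: m_def Suc_le_eq)
  ultimately show ?thesis
    unfolding g_def gradient_norm_at_u0
    using quadratic_root_bound[of m h r "z u0" s] h z0(1) rpos by simp
qed

end



section \<open>The gradient estimate\<close>

lemma continuous_on_pseudo_distance: "continuous_on S (pseudo_distance n :: 'm::finite ambient \<Rightarrow> real)"
proof -
  have c: "continuous_on S (\<lambda>v::'m ambient. v c)" for c
    by (rule continuous_on_subset[OF continuous_on_product_coordinates]) simp
  show ?thesis
    unfolding pseudo_distance_def[abs_def] pip_def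
    by (intro continuous_on_diff continuous_on_sum continuous_on_mult c)
qed

lemma (in framed_chart) continuous_on_gradient_norm_image:
  "continuous_on (\<phi> ` U) (gradient_norm n M (pseudo_distance n))"
proof -
  obtain \<psi> where \<psi>: "homeomorphism U (\<phi> ` U) \<phi> \<psi>" using homeo by blast
  then have inv: "\<psi> (\<phi> u) = u" if "u \<in> U" for u using that by (simp add: homeomorphism_def)
  have "continuous_on U (\<lambda>u. 2 * sqrt (\<Sum>j\<in>UNIV. (pip n (\<phi> u) (e j u))\<^sup>2))"
    by (intro continuous_intros smooth_on_continuous smooth_on_pip open_U asmooth_\<phi> asmooth_e)
  then have "continuous_on (\<phi> ` U) ((\<lambda>u. 2 * sqrt (\<Sum>j\<in>UNIV. (pip n (\<phi> u) (e j u))\<^sup>2)) \<circ> \<psi>)"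
    using \<psi> by (intro continuous_on_compose) (auto simp: homeomorphism_def)
  then show ?thesis
    by (rule continuous_on_eq) (auto simp: inv gradient_norm_pseudo_distance)
qed

lemma continuous_on_gradient_norm:
  fixes M :: "'m::finite ambient set"
  assumes "spacelike_submanifold n M"
  shows "continuous_on M (gradient_norm n M (pseudo_distance n))"
  unfolding continuous_on_eq_continuous_within
proof
  fix p assume p: "p \<in> M"
  obtain U \<phi> A u0 where "normal_chart n M U \<phi> A u0" "\<phi> u0 = p"
    using ex_normal_chart[OF assms p] by metis
  then interpret c: normal_chart n M U \<phi> A u0 by simp
  obtain T where T: "open T" "\<phi> ` U = M \<inter> T" using c.openin_image by (auto simp: openin_open)
  have pU: "p \<in> \<phi> ` U" using c.u0 \<open>\<phi> u0 = p\<close> by blast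
  then have "continuous (at p within \<phi> ` U) (gradient_norm n M (pseudo_distance n))"
    using c.continuous_on_gradient_norm_image unfolding continuous_on_eq_continuous_within by (rule bspec[rotated])
  moreover have "at p within M = at p within \<phi> ` U"
    by (rule at_within_nhd[of p T]) (use T pU in auto)
  ultimately show "continuous (at p within M) (gradient_norm n M (pseudo_distance n))" by simp
qed

lemma gradient_norm_nonneg:
  fixes M :: "'m::finite ambient set"
  assumes "spacelike_submanifold n M" "p \<in> M"
  shows "gradient_norm n M (pseudo_distance n) p \<ge> 0"
proof -
  obtain U \<phi> A u0 where "normal_chart n M U \<phi> A u0" "\<phi> u0 = p"
    using ex_normal_chart[OF assms] by metis
  then interpret c: normal_chart n M U \<phi> A u0 by simp
  show ?thesis using c.gradient_norm_at_u0 \<open>\<phi> u0 = p\<close> by (simp add: sum_nonneg)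
qed

text \<open>The coordinate-free form: normal coordinates exist at the maximum point, and nearby points still satisfy \<open>z < k\<close>.\<close>

lemma gradient_bound_at_interior_max:
  fixes M :: "'m::finite ambient set" and n :: nat and k h :: real
  defines "z \<equiv> pseudo_distance n" and "g \<equiv> gradient_norm n M (pseudo_distance n)" and "m \<equiv> real CARD('m)"
  assumes M: "spacelike_submanifold n M" "parallel_mean_curvature n M" "\<And>x. x \<in> M \<Longrightarrow> mean_curvature_norm n M x = h"
    and h: "h \<ge> 0" and z: "\<And>x. x \<in> M \<Longrightarrow> z x \<ge> 0"
    and p: "p \<in> M" "z p < k"
    and max: "\<And>x. x \<in> M \<Longrightarrow> z x \<le> k \<Longrightarrow>
      (k - z x) ^ (4 * CARD('m)) * (g x)\<^sup>2 / (z x + 1)\<^sup>2 \<le> (k - z p) ^ (4 * CARD('m)) * (g p)\<^sup>2 / (z p + 1)\<^sup>2"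
  shows "g p \<le> 2 * m\<^sup>2 * (5 + 3 * h) * (z p + 1)"
proof -
  obtain U \<phi> A u0 where "normal_chart n M U \<phi> A u0" "\<phi> u0 = p"
    using ex_normal_chart[OF M(1) p(1)] by metis
  then interpret c: normal_chart n M U \<phi> A u0 by simp
  define W where "W = U \<inter> \<phi> -` (z -` {..<k})"
  have cont: "continuous_on U (\<lambda>u. z (\<phi> u))"
    unfolding z_def
    by (rule continuous_on_compose2[OF continuous_on_pseudo_distance c.continuous_\<phi> subset_UNIV])
  have "open ((\<lambda>u. z (\<phi> u)) -` {..<k} \<inter> U)"
    using cont c.open_U open_lessThan by (simp add: continuous_on_open_vimage)
  then have W: "open W" "u0 \<in> W" "W \<subseteq> U"
    using c.u0 p(2) \<open>\<phi> u0 = p\<close> by (auto simp: W_def vimage_def Int_commute)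
  have "gradient_norm n M (pseudo_distance n) (\<phi> u0)
      \<le> 2 * (real CARD('m))\<^sup>2 * (5 + 3 * h) * (pseudo_distance n (\<phi> u0) + 1)"
  proof (rule c.gradient_bound_at_max[OF M(2) _ h W, where k=k])
    show "mean_curvature_norm n M (\<phi> u0) = h" using M(3) c.\<phi>_in_M[OF c.u0] .
    fix u assume u: "u \<in> W"
    then have "\<phi> u \<in> M" "z (\<phi> u) < k" using c.\<phi>_in_M by (auto simp: W_def)
    then show "0 \<le> pseudo_distance n (\<phi> u) \<and> pseudo_distance n (\<phi> u) < k"
      and "(k - pseudo_distance n (\<phi> u)) ^ (4 * CARD('m)) * (gradient_norm n M (pseudo_distance n) (\<phi> u))\<^sup>2
          / (pseudo_distance n (\<phi> u) + 1)\<^sup>2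
        \<le> (k - pseudo_distance n (\<phi> u0)) ^ (4 * CARD('m)) * (gradient_norm n M (pseudo_distance n) (\<phi> u0))\<^sup>2
          / (pseudo_distance n (\<phi> u0) + 1)\<^sup>2"
      using z[of "\<phi> u"] max[of "\<phi> u"] \<open>\<phi> u0 = p\<close> by (simp_all add: z_def g_def)
  qed
  then show ?thesis using \<open>\<phi> u0 = p\<close> by (simp add: z_def g_def m_def)
qed

text \<open>The function \<open>F\<close> attains its maximum on the compact set. If \<open>z = k\<close> at the maximum point, then \<open>F\<close>
  vanishes there; otherwise the bound at interior maxima applies. The factor \<open>2^(2m)\<close> is the square root of
  \<open>(k / (k/2))^(4m)\<close>.\<close>

lemma gradient_estimate:
  fixes M :: "'m::finite ambient set" and n :: nat and k h :: real
  defines "z \<equiv> pseudo_distance n" and "g \<equiv> gradient_norm n M (pseudo_distance n)" and "m \<equiv> real CARD('m)"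
  assumes M: "spacelike_submanifold n M" "parallel_mean_curvature n M" "\<And>x. x \<in> M \<Longrightarrow> mean_curvature_norm n M x = h"
    and h: "h \<ge> 0" and z: "\<And>x. x \<in> M \<Longrightarrow> z x \<ge> 0"
    and k: "k > 0" and comp: "compact {x \<in> M. z x \<le> k}" and x: "x \<in> M" "z x \<le> k / 2"
  shows "g x \<le> 2 ^ (2 * CARD('m)) * (2 * m\<^sup>2 * (5 + 3 * h)) * (z x + 1)"
proof -
  define p where "p = 4 * CARD('m)"
  define C where "C = 2 * m\<^sup>2 * (5 + 3 * h)"
  have C: "C \<ge> 0" using h by (simp add: C_def)
  define K where "K = {x \<in> M. z x \<le> k}"
  define F where "F q = (k - z q) ^ p * (g q)\<^sup>2 / (z q + 1)\<^sup>2" for q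
  have xK: "x \<in> K" using x k by (simp add: K_def)
  have gc: "continuous_on K g" unfolding g_def
    by (rule continuous_on_subset[OF continuous_on_gradient_norm[OF M(1)]]) (auto simp: K_def)
  have zc: "continuous_on K z" unfolding z_def by (rule continuous_on_pseudo_distance)
  have "\<forall>q\<in>K. (z q + 1)\<^sup>2 \<noteq> 0" using z by (force simp: K_def)
  then have "continuous_on K F"
    unfolding F_def[abs_def] using gc zc by (intro continuous_intros) auto
  then obtain q where q: "q \<in> K" "\<And>y. y \<in> K \<Longrightarrow> F y \<le> F q"
    using continuous_attains_sup[of K F] comp xK by (auto simp: K_def)
  then have qM: "q \<in> M" "z q \<le> k" "z q \<ge> 0" using z by (auto simp: K_def)
  have Fq: "F q \<le> k ^ p * C\<^sup>2"
  proof (cases "z q = k")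
    case True
    have "p > 0" by (simp add: p_def)
    then show ?thesis using k True by (simp add: F_def zero_power)
  next
    case False
    have "g q \<le> C * (z q + 1)"
      unfolding C_def m_def z_def g_def
    proof (rule gradient_bound_at_interior_max[OF M h _ qM(1)])
      show "pseudo_distance n y \<ge> 0" if "y \<in> M" for y using z[OF that] by (simp add: z_def)
      show "pseudo_distance n q < k" using False qM by (simp add: z_def)
      show "(k - pseudo_distance n y) ^ (4 * CARD('m)) * (gradient_norm n M (pseudo_distance n) y)\<^sup>2
          / (pseudo_distance n y + 1)\<^sup>2
        \<le> (k - pseudo_distance n q) ^ (4 * CARD('m)) * (gradient_norm n M (pseudo_distance n) q)\<^sup>2
          / (pseudo_distance n q + 1)\<^sup>2" if "y \<in> M" "pseudo_distance n y \<le> k" for y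
        using q(2)[of y] that by (simp add: K_def F_def z_def g_def p_def)
    qed
    then have "(g q)\<^sup>2 \<le> (C * (z q + 1))\<^sup>2"
      using gradient_norm_nonneg[OF M(1) qM(1)] unfolding g_def by (intro power_mono)
    then have "(g q)\<^sup>2 / (z q + 1)\<^sup>2 \<le> C\<^sup>2"
      using qM(3) by (simp add: power_mult_distrib divide_le_eq)
    moreover have "(k - z q) ^ p \<le> k ^ p" using qM by (intro power_mono) auto
    ultimately have "(k - z q) ^ p * ((g q)\<^sup>2 / (z q + 1)\<^sup>2) \<le> k ^ p * C\<^sup>2"
      using qM k by (intro mult_mono) auto
    then show ?thesis by (simp add: F_def)
  qed
  have zx: "z x + 1 > 0" using z[OF x(1)] by simp
  have "(k / 2) ^ p * ((g x)\<^sup>2 / (z x + 1)\<^sup>2) \<le> (k - z x) ^ p * ((g x)\<^sup>2 / (z x + 1)\<^sup>2)"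
    using x(2) k by (intro mult_right_mono power_mono) auto
  also have "\<dots> \<le> k ^ p * C\<^sup>2" using q(2)[OF xK] Fq by (simp add: F_def)
  also have "\<dots> = (k / 2) ^ p * (2 ^ p * C\<^sup>2)" by (simp add: power_divide)
  finally have "(g x)\<^sup>2 / (z x + 1)\<^sup>2 \<le> 2 ^ p * C\<^sup>2"
    by (rule mult_left_le_imp_le) (use k in simp)
  then have "(g x)\<^sup>2 \<le> 2 ^ p * C\<^sup>2 * (z x + 1)\<^sup>2" using zx by (simp add: divide_le_eq)
  also have "(2::real) ^ p = (2 ^ (2 * CARD('m)))\<^sup>2" by (simp add: p_def power_mult[symmetric] mult.commute)
  also have "\<dots> * C\<^sup>2 * (z x + 1)\<^sup>2 = (2 ^ (2 * CARD('m)) * C * (z x + 1))\<^sup>2"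
    by (simp only: power_mult_distrib)
  finally have "g x \<le> 2 ^ (2 * CARD('m)) * C * (z x + 1)"
    by (rule power2_le_imp_le) (use C zx in simp)
  then show ?thesis by (simp add: C_def)
qed

theorem proposition3p2:
  fixes h :: real
  assumes "h \<ge> 0"
  shows "\<exists>b::real. \<forall>(n::nat) (M::('m::finite) ambient set) (k::real).
    n \<ge> 1 \<longrightarrow> spacelike_submanifold n M \<longrightarrow> connected M \<longrightarrow>
    parallel_mean_curvature n M \<longrightarrow> (\<forall>x\<in>M. mean_curvature_norm n M x = h) \<longrightarrow>
    (\<forall>x\<in>M. pseudo_distance n x \<ge> 0) \<longrightarrow>
    k > 0 \<longrightarrow> compact {x \<in> M. pseudo_distance n x \<le> k} \<longrightarrow>
    (\<forall>x\<in>M. pseudo_distance n x \<le> k / 2 \<longrightarrow>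
       gradient_norm n M (pseudo_distance n) x \<le> b * (pseudo_distance n x + 1))"
  using gradient_estimate[OF _ _ _ assms, where 'm='m]
  by (intro exI[of _ "2 ^ (2 * CARD('m)) * (2 * (real CARD('m))\<^sup>2 * (5 + 3 * h))"] allI impI ballI) simp


end
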